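(* Let $f$ be in the class $\bar U_{NP}$ and satisfy a distortion condition $(\mathrm{D})$, which is $(\mathrm{DD}_r)$ for some $r\in\mathbb{N}^+$ or $(\mathrm{AD}_\delta)$ for some $\delta>0$. Let $L=(L_{jk})_{j,k\ge0}$ be the matrix of the transfer operator of $f$ in the Chebyshev polynomial basis. Then for every $p>\check\lambda^{-1}$ there exists $K\in\kappa(\mathrm{D})$ such that $|L_{jk}|\le K(|j-pk|)$ whenever $j/k>p$ or $k=0$.
   Context: Class $\bar U_{NP}$: full-branch Markov maps $f$ of $[-1,1]$: disjoint open intervals $\mathcal{O}_\iota$, $\iota\in I$ ($I$ countable), covering $[-1,1]$ up to a countable set, such that $f|_{\mathcal{O}_\iota}$ extends to a $C^2$ bijection $\hat f_\iota:\overline{\mathcal{O}_\iota}\to[-1,1]$, with inverse branches $v_\iota=\hat f_\iota^{-1}$; it is required that $\sup_{\iota,x}|v_\iota''(x)/v_\iota'(x)|<\infty$, that the C-expansion parameter $\check\lambda:=\inf_{x\in\cup_\iota\mathcal{O}_\iota}\frac{\sqrt{1-x^2}}{\sqrt{1-f(x)^2}}|f'(x)|$ is positive, and that $\Xi:=\sup\{|\mathcal{O}_\iota|/d(\mathcal{O}_\iota,\sigma):\iota\in I,\sigma\in\{\pm1\},\sigma\notin\overline{\mathcal{O}_\iota}\}<\infty$. $(\mathrm{DD}_r)$: $\sup_{\iota,x\in[-1,1]}|v_\iota^{(n+1)}(x)/v_\iota'(x)|<\infty$ for all $n\le r$. $(\mathrm{AD}_\delta)$: each $v_\iota$ is holomorphic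 on the closed region bounded by the Bernstein ellipse of parameter $e^\delta$ (centre $0$, semi-axes $\cosh\delta$ real and $\sinh\delta$ imaginary), and $\sup_{\iota,z}|v_\iota''(z)/v_\iota'(z)|<\infty$ there. $\kappa(\mathrm{DD}_r)=\{x\mapsto C(1+x)^{-r}:C>0\}$, $\kappa(\mathrm{AD}_\delta)=\{x\mapsto Ce^{-\zeta x}:C>0,\zeta\in(0,\delta]\}$. Transfer operator $(\mathcal{L}B)(x)=\sum_{f(y)=x}B(y)/|f'(y)|$. Chebyshev polynomials $T_k(x)=\cos(k\cos^{-1}x)$; matrix entries $L_{jk}=\frac{t_j}{\pi}\int_{-1}^1(\mathcal{L}T_k)(x)T_j(x)(1-x^2)^{-1/2}dx$ with $t_j=2-\delta_{j0}$. *)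

theory Defs
  imports "HOL-Analysis.Analysis"
begin

definition has_derivs_on :: "nat \<Rightarrow> (real \<Rightarrow> real) \<Rightarrow> (nat \<Rightarrow> real \<Rightarrow> real) \<Rightarrow> real set \<Rightarrow> bool" where
  "has_derivs_on m g D S \<longleftrightarrow>
     (\<forall>x\<in>S. D 0 x = g x) \<and>
     (\<forall>n<m. \<forall>x\<in>S. (D n has_real_derivative D (Suc n) x) (at x within S))"

definition C2_on :: "(real \<Rightarrow> real) \<Rightarrow> real set \<Rightarrow> bool" where
  "C2_on g S \<longleftrightarrow> (\<exists>D. has_derivs_on 2 g D S \<and> continuous_on S (D 2))"

definition branch :: "('i \<Rightarrow> real) \<Rightarrow> ('i \<Rightarrow> real) \<Rightarrow> 'i \<Rightarrow> real set" where
  "branch a b i = {a i<..<b i}"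

definition UNP :: "(real \<Rightarrow> real) \<Rightarrow> 'i set \<Rightarrow> ('i \<Rightarrow> real) \<Rightarrow> ('i \<Rightarrow> real)
     \<Rightarrow> ('i \<Rightarrow> real \<Rightarrow> real) \<Rightarrow> ('i \<Rightarrow> real \<Rightarrow> real) \<Rightarrow> bool" where
  "UNP f I a b fhat v \<longleftrightarrow>
     countable I \<and>
     (\<forall>i\<in>I. -1 \<le> a i \<and> a i < b i \<and> b i \<le> 1) \<and>
     (\<forall>i\<in>I. \<forall>j\<in>I. i \<noteq> j \<longrightarrow> branch a b i \<inter> branch a b j = {}) \<and>
     countable ({-1..1} - (\<Union>i\<in>I. branch a b i)) \<and>
     (\<forall>i\<in>I. C2_on (fhat i) {a i..b i} \<and> bij_betw (fhat i) {a i..b i} {-1..1} \<and>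
        (\<forall>x\<in>branch a b i. f x = fhat i x) \<and>
        (\<forall>y\<in>{-1..1}. v i y \<in> {a i..b i} \<and> fhat i (v i y) = y)) \<and>
     (\<exists>C. \<forall>i\<in>I. \<exists>D. has_derivs_on 2 (v i) D {-1..1} \<and> continuous_on {-1..1} (D 2) \<and>
        (\<forall>x\<in>{-1..1}. D 1 x \<noteq> 0 \<and> \<bar>D 2 x / D 1 x\<bar> \<le> C)) \<and>
     (\<exists>C. \<forall>i\<in>I. \<forall>\<sigma>\<in>{-1,1::real}. \<sigma> \<notin> {a i..b i} \<longrightarrow>
        (b i - a i) / infdist \<sigma> (branch a b i) \<le> C)"

definition check_lambda :: "(real \<Rightarrow> real) \<Rightarrow> 'i set \<Rightarrow> ('i \<Rightarrow> real) \<Rightarrow> ('i \<Rightarrow> real) \<Rightarrow> real" where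
  "check_lambda f I a b =
     (INF x\<in>(\<Union>i\<in>I. branch a b i). sqrt (1 - x\<^sup>2) / sqrt (1 - (f x)\<^sup>2) * \<bar>deriv f x\<bar>)"

text \<open>Closed region bounded by the Bernstein ellipse of parameter e^\<delta>.\<close>
definition bernstein_region :: "real \<Rightarrow> complex set" where
  "bernstein_region \<delta> = {z. (Re z / cosh \<delta>)\<^sup>2 + (Im z / sinh \<delta>)\<^sup>2 \<le> 1}"

datatype dcond = DD nat | AD real

definition dcond_valid :: "dcond \<Rightarrow> bool" where
  "dcond_valid D = (case D of DD r \<Rightarrow> r \<ge> 1 | AD \<delta> \<Rightarrow> \<delta> > 0)"

definition satisfies_D :: "dcond \<Rightarrow> 'i set \<Rightarrow> ('i \<Rightarrow> real \<Rightarrow> real) \<Rightarrow> bool" where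
  "satisfies_D D I v = (case D of
     DD r \<Rightarrow> (\<exists>C. \<forall>i\<in>I. \<exists>Dv. has_derivs_on (r + 1) (v i) Dv {-1..1} \<and>
               (\<forall>x\<in>{-1..1}. Dv 1 x \<noteq> 0 \<and> (\<forall>n\<le>r. \<bar>Dv (n + 1) x / Dv 1 x\<bar> \<le> C)))
   | AD \<delta> \<Rightarrow> (\<exists>C. \<forall>i\<in>I. \<exists>g U. open U \<and> bernstein_region \<delta> \<subseteq> U \<and> g holomorphic_on U \<and>
               (\<forall>x\<in>{-1..1}. g (complex_of_real x) = complex_of_real (v i x)) \<and>
               (\<forall>z\<in>bernstein_region \<delta>. deriv g z \<noteq> 0 \<and>
                   cmod (deriv (deriv g) z / deriv g z) \<le> C)))"

definition kappa :: "dcond \<Rightarrow> (real \<Rightarrow> real) set" where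
  "kappa D = (case D of
     DD r \<Rightarrow> {K. \<exists>C>0. K = (\<lambda>x. C * (1 + x) powr (- real r))}
   | AD \<delta> \<Rightarrow> {K. \<exists>C>0. \<exists>\<zeta>. 0 < \<zeta> \<and> \<zeta> \<le> \<delta> \<and> K = (\<lambda>x. C * exp (- \<zeta> * x))})"

definition cheb :: "nat \<Rightarrow> real \<Rightarrow> real" where
  "cheb k x = cos (real k * arccos x)"

definition transfer :: "(real \<Rightarrow> real) \<Rightarrow> real set \<Rightarrow> (real \<Rightarrow> real) \<Rightarrow> real \<Rightarrow> real" where
  "transfer f Dom B x = (\<Sum>\<^sub>\<infinity>y\<in>{y\<in>Dom. f y = x}. B y / \<bar>deriv f y\<bar>)"

definition Lmat :: "(real \<Rightarrow> real) \<Rightarrow> real set \<Rightarrow> nat \<Rightarrow> nat \<Rightarrow> real" where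
  "Lmat f Dom j k = (if j = 0 then 1 else 2) / pi *
     (LBINT x:{-1<..<1}. transfer f Dom (cheb k) x * cheb j x / sqrt (1 - x\<^sup>2))"

end

theory Submission
  imports Defs "HOL-Complex_Analysis.Complex_Analysis"
begin

text \<open>
  Put \<open>x = cos (2 * t)\<close>. For an inverse branch \<open>v\<close> with image of length \<open>len\<close> and
  \<open>V t = v (cos (2 * t))\<close>, both \<open>1 - V\<close> and \<open>1 + V\<close> are a positive constant times a positive
  function as regular as \<open>v'\<close> times the square of \<open>1\<close>, \<open>sqrt 2 * sin t\<close> or \<open>sqrt 2 * cos t\<close>,
  according to whether (and where) \<open>v\<close> touches the endpoint. Hence \<open>1 - V\<^sup>2\<close> has a regular square root
  \<open>S\<close>, of period \<open>2 * pi\<close> in \<open>t\<close> (in the full angle \<open>2 * t\<close> the period is only \<open>4 * pi\<close>, whence the half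
  angle). The function \<open>E = V + \<i> * S\<close> lies on the unit circle, satisfies \<open>E' = \<i> * g * E\<close> with
  \<open>g = 2 * sin (2 * t) * v' / S\<close> regular uniformly over the branches, and \<open>T\<^sub>k(V) = Re (E ^ k)\<close>.
  The C-expansion parameter enters only through \<open>\<bar>g\<bar> \<le> 2 / \<lambda>\<close>.

  The contribution of one branch to \<open>L\<^sub>j\<^sub>k\<close> is a sum of integrals of
  \<open>v' * E ^ (\<plusminus> k) * exp (2 * \<i> * j * t)\<close> over a period, whose phase has derivative
  \<open>2 * j \<plusminus> k * g\<close>, bounded below by a multiple of \<open>j\<close> when \<open>j > p * k\<close>. Under \<open>(DD\<^sub>r)\<close> one integrates by
  parts \<open>r\<close> times; under \<open>(AD\<^sub>\<delta>)\<close> one shifts the contour to a line \<open>Im = \<eta>\<close> so close to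
  the real axis that \<open>\<bar>g\<bar> \<le> 2 * p\<close> up to it. All bounds are proportional to \<open>len\<close>, and the lengths sum to at most 2.
\<close>

text \<open>The obvious phase arccos (v x) has root singularities where \<open>v\<close> reaches 1
  or -1 and degenerates along branches that come close to an endpoint without reaching it. The first
  defect is cured by the substitution: 1 - cos (2 * t) and 1 + cos (2 * t) are twice a square, so a
  root with changing sign can be taken instead of the nonnegative one. The second is controlled by
  \<Xi>: when \<open>len\<close> is at most M times the distance d to the endpoint \<sigma>, the
  ratio of 1 - \<sigma> * v to d stays between 1 and 1 + M. Uniformity over infinitely many branches
  comes from dividing v' and all difference quotients by \<open>len\<close>, after which bounded
  distortion controls them from above and below. The strict inequality p > 1 / \<lambda> is spent
  differently in the two cases: under \<open>DD\<close> it bounds the normalised derivative of the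
  total phase below by 1 - q / p with q = 1 / \<lambda>, under \<open>AD\<close> it is the room in
  which |g| may grow on leaving the real axis. Uniformly smooth and uniformly analytic families are
  closed under the same operations, so E and g are constructed once for both.\<close>

subsection \<open>Uniformly smooth families\<close>

text \<open>At the excluded points \<open>sin (2 * t) = 0\<close>, that is \<open>x = 1\<close> or \<open>x = -1\<close>, the top-order derivative of a
  quotient such as \<open>(v 1 - v x) / (1 - x)\<close> need not exist.\<close>
fun smooth_family :: "nat \<Rightarrow> 'i set \<Rightarrow> ('i \<Rightarrow> real \<Rightarrow> real) \<Rightarrow> bool" where
  "smooth_family 0 X f \<longleftrightarrow> (\<exists>B. \<forall>i\<in>X. \<forall>t. \<bar>f i t\<bar> \<le> B)"
| "smooth_family (Suc n) X f \<longleftrightarrow>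
     (\<exists>B. \<forall>i\<in>X. \<forall>t. \<bar>f i t\<bar> \<le> B) \<and> (\<forall>i\<in>X. continuous_on UNIV (f i)) \<and>
     (\<exists>f'. smooth_family n X f' \<and>
        (\<forall>i\<in>X. \<forall>t. sin (2 * t) \<noteq> 0 \<longrightarrow> (f i has_real_derivative f' i t) (at t)))"

lemma smooth_family_bounded:
  assumes "smooth_family n X f"
  obtains B where "B > 0" "\<And>i t. i \<in> X \<Longrightarrow> \<bar>f i t\<bar> \<le> B"
proof -
  obtain B where B: "\<forall>i\<in>X. \<forall>t. \<bar>f i t\<bar> \<le> B"
    using assms by (cases n) auto
  show ?thesis
    by (rule that[of "max 1 B"]) (use B in \<open>auto simp: le_max_iff_disj\<close>)
qed

lemma smooth_family_SucD: "smooth_family (Suc n) X f \<Longrightarrow> smooth_family n X f"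
proof (induction n arbitrary: f)
  case (Suc n)
  then obtain f' where "smooth_family (Suc n) X f'"
    "\<forall>i\<in>X. \<forall>t. sin (2 * t) \<noteq> 0 \<longrightarrow> (f i has_real_derivative f' i t) (at t)"
    by auto
  with Suc.IH[of f'] Suc.prems show ?case
    by auto
qed auto

lemma smooth_family_cong:
  assumes "smooth_family n X f" "\<And>i t. i \<in> X \<Longrightarrow> f i t = g i t"
  shows "smooth_family n X g"
proof -
  have eq: "f i = g i" if "i \<in> X" for i
    using assms(2)[OF that] by blast
  show ?thesis
    using assms(1) by (cases n) (auto simp: eq)
qed

lemma smooth_family_const:
  assumes "\<And>i. i \<in> X \<Longrightarrow> \<bar>c i\<bar> \<le> B"
  shows "smooth_family n X (\<lambda>i t. c i)"
  using assms
proof (induction n arbitrary: c B)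
  case (Suc n)
  have "smooth_family n X (\<lambda>i t. 0)"
    by (rule Suc.IH[of "\<lambda>_. 0" 0]) simp
  with Suc.prems show ?case
    by (auto intro!: exI[of _ "\<lambda>_ _. 0"])
qed auto

lemma smooth_family_add:
  assumes "smooth_family n X f" "smooth_family n X g"
  shows "smooth_family n X (\<lambda>i t. f i t + g i t)"
  using assms
proof (induction n arbitrary: f g)
  case 0
  obtain B C where "\<And>i t. i \<in> X \<Longrightarrow> \<bar>f i t\<bar> \<le> B" "\<And>i t. i \<in> X \<Longrightarrow> \<bar>g i t\<bar> \<le> C"
    using smooth_family_bounded[OF 0(1)] smooth_family_bounded[OF 0(2)] by metis
  then have "\<forall>i\<in>X. \<forall>t. \<bar>f i t + g i t\<bar> \<le> B + C"
    by (meson abs_triangle_ineq add_mono order_trans)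
  then show ?case by auto
next
  case (Suc n)
  obtain B C where "\<And>i t. i \<in> X \<Longrightarrow> \<bar>f i t\<bar> \<le> B" "\<And>i t. i \<in> X \<Longrightarrow> \<bar>g i t\<bar> \<le> C"
    using smooth_family_bounded[OF Suc.prems(1)] smooth_family_bounded[OF Suc.prems(2)] by metis
  then have B: "\<forall>i\<in>X. \<forall>t. \<bar>f i t + g i t\<bar> \<le> B + C"
    by (meson abs_triangle_ineq add_mono order_trans)
  obtain f' g' where f': "smooth_family n X f'" "smooth_family n X g'"
    and "\<forall>i\<in>X. \<forall>t. sin (2 * t) \<noteq> 0 \<longrightarrow> (f i has_real_derivative f' i t) (at t)"
    "\<forall>i\<in>X. \<forall>t. sin (2 * t) \<noteq> 0 \<longrightarrow> (g i has_real_derivative g' i t) (at t)"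
    using Suc.prems by auto
  then have "\<forall>i\<in>X. \<forall>t. sin (2 * t) \<noteq> 0 \<longrightarrow>
      ((\<lambda>t. f i t + g i t) has_real_derivative f' i t + g' i t) (at t)"
    by (auto intro!: derivative_eq_intros)
  moreover have "\<forall>i\<in>X. continuous_on UNIV (\<lambda>t. f i t + g i t)"
    using Suc.prems by (auto intro!: continuous_intros)
  ultimately show ?case
    using B Suc.IH[OF f'] by (auto intro!: exI[of _ "\<lambda>i t. f' i t + g' i t"])
qed

lemma smooth_family_mult:
  assumes "smooth_family n X f" "smooth_family n X g"
  shows "smooth_family n X (\<lambda>i t. f i t * g i t)"
  using assms
proof (induction n arbitrary: f g)
  case 0
  obtain B C where "B > 0" "C > 0" "\<And>i t. i \<in> X \<Longrightarrow> \<bar>f i t\<bar> \<le> B" "\<And>i t. i \<in> X \<Longrightarrow> \<bar>g i t\<bar> \<le> C"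
    using smooth_family_bounded[OF 0(1)] smooth_family_bounded[OF 0(2)] by metis
  then have "\<forall>i\<in>X. \<forall>t. \<bar>f i t * g i t\<bar> \<le> B * C"
    by (auto simp: abs_mult intro!: mult_mono)
  then show ?case by auto
next
  case (Suc n)
  obtain B C where "B > 0" "C > 0" "\<And>i t. i \<in> X \<Longrightarrow> \<bar>f i t\<bar> \<le> B" "\<And>i t. i \<in> X \<Longrightarrow> \<bar>g i t\<bar> \<le> C"
    using smooth_family_bounded[OF Suc.prems(1)] smooth_family_bounded[OF Suc.prems(2)] by metis
  then have B: "\<forall>i\<in>X. \<forall>t. \<bar>f i t * g i t\<bar> \<le> B * C"
    by (auto simp: abs_mult intro!: mult_mono)
  obtain f' g' where f': "smooth_family n X f'" "smooth_family n X g'"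
    and "\<forall>i\<in>X. \<forall>t. sin (2 * t) \<noteq> 0 \<longrightarrow> (f i has_real_derivative f' i t) (at t)"
    "\<forall>i\<in>X. \<forall>t. sin (2 * t) \<noteq> 0 \<longrightarrow> (g i has_real_derivative g' i t) (at t)"
    using Suc.prems by auto
  then have "\<forall>i\<in>X. \<forall>t. sin (2 * t) \<noteq> 0 \<longrightarrow>
      ((\<lambda>t. f i t * g i t) has_real_derivative f' i t * g i t + f i t * g' i t) (at t)"
    by (auto intro!: derivative_eq_intros)
  moreover have "\<forall>i\<in>X. continuous_on UNIV (\<lambda>t. f i t * g i t)"
    using Suc.prems by (auto intro!: continuous_intros)
  moreover have "smooth_family n X (\<lambda>i t. f' i t * g i t + f i t * g' i t)"
    by (intro smooth_family_add Suc.IH f' smooth_family_SucD[OF Suc.prems(1)]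
        smooth_family_SucD[OF Suc.prems(2)])
  ultimately show ?case
    using B by (auto intro!: exI[of _ "\<lambda>i t. f' i t * g i t + f i t * g' i t"])
qed

text \<open>The derivative is a product of \<open>f'\<close> and copies of the very function under
  consideration, so the induction hypothesis at one order less closes the step. The bound
  \<open>c\<close> is common to the whole family, which keeps the result uniform.\<close>

lemma smooth_family_inverse:
  assumes "smooth_family n X f" "c > 0" "\<And>i t. i \<in> X \<Longrightarrow> c \<le> f i t"
  shows "smooth_family n X (\<lambda>i t. 1 / f i t)"
  using assms(1)
proof (induction n)
  case 0
  have "\<forall>i\<in>X. \<forall>t. \<bar>1 / f i t\<bar> \<le> 1 / c"
    using assms(2,3) by (smt (verit) divide_nonneg_nonneg frac_le)
  then show ?case by auto
next
  case (Suc n)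
  have pos: "f i t > 0" if "i \<in> X" for i t
    using assms(2,3) that by (meson less_le_trans)
  have B: "\<forall>i\<in>X. \<forall>t. \<bar>1 / f i t\<bar> \<le> 1 / c"
    using assms(2,3) by (smt (verit) divide_nonneg_nonneg frac_le)
  obtain f' where f': "smooth_family n X f'"
    and "\<forall>i\<in>X. \<forall>t. sin (2 * t) \<noteq> 0 \<longrightarrow> (f i has_real_derivative f' i t) (at t)"
    using Suc.prems by auto
  then have "\<forall>i\<in>X. \<forall>t. sin (2 * t) \<noteq> 0 \<longrightarrow>
      ((\<lambda>t. 1 / f i t) has_real_derivative - 1 * f' i t * (1 / f i t) * (1 / f i t)) (at t)"
    using pos by (auto intro!: derivative_eq_intros simp: less_imp_neq[symmetric] divide_inverse)
  moreover have "\<forall>i\<in>X. continuous_on UNIV (\<lambda>t. 1 / f i t)"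
    using Suc.prems pos by (auto intro!: continuous_intros simp: less_imp_neq[symmetric])
  moreover have "smooth_family n X (\<lambda>i t. - 1 * f' i t * (1 / f i t) * (1 / f i t))"
    by (intro smooth_family_mult Suc.IH smooth_family_SucD[OF Suc.prems] f'
        smooth_family_const[of _ _ 1]) auto
  ultimately show ?case
    using B unfolding smooth_family.simps by blast
qed

text \<open>The phase derivative \<open>g\<close> contains square roots only in denominators.
  Differentiating 1 / sqrt f reproduces 1 / sqrt f up to the factors f' and 1 / f, so the induction
  runs as for reciprocals.\<close>

lemma smooth_family_inverse_sqrt:
  assumes "smooth_family n X f" "c > 0" "\<And>i t. i \<in> X \<Longrightarrow> c \<le> f i t"
  shows "smooth_family n X (\<lambda>i t. 1 / sqrt (f i t))"
  using assms(1)
proof (induction n)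
  case 0
  have "\<forall>i\<in>X. \<forall>t. \<bar>1 / sqrt (f i t)\<bar> \<le> 1 / sqrt c"
    using assms(2,3) by (auto simp: abs_divide intro!: frac_le order_trans[OF _ abs_ge_self])
  then show ?case by auto
next
  case (Suc n)
  have pos: "f i t > 0" if "i \<in> X" for i t
    using assms(2,3) that by (meson less_le_trans)
  have B: "\<forall>i\<in>X. \<forall>t. \<bar>1 / sqrt (f i t)\<bar> \<le> 1 / sqrt c"
    using assms(2,3) by (auto simp: abs_divide intro!: frac_le order_trans[OF _ abs_ge_self])
  obtain f' where f': "smooth_family n X f'"
    and D: "\<forall>i\<in>X. \<forall>t. sin (2 * t) \<noteq> 0 \<longrightarrow> (f i has_real_derivative f' i t) (at t)"
    using Suc.prems by auto
  have "((\<lambda>t. 1 / sqrt (f i t)) has_real_derivative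
       - (1/2) * f' i t * (1 / f i t) * (1 / sqrt (f i t))) (at t)"
    if "i \<in> X" "sin (2 * t) \<noteq> 0" for i t
  proof -
    have "(f i has_real_derivative f' i t) (at t)" using D that by blast
    moreover have "sqrt (f i t) \<noteq> 0" using pos[OF that(1), of t] by simp
    ultimately show ?thesis
      using pos[OF that(1), of t]
      by (auto intro!: derivative_eq_intros simp: divide_simps real_sqrt_mult_self)
  qed
  moreover have "\<forall>i\<in>X. continuous_on UNIV (\<lambda>t. 1 / sqrt (f i t))"
    using Suc.prems pos by (auto intro!: continuous_intros simp: less_imp_neq[symmetric])
  moreover have "smooth_family n X (\<lambda>i t. - (1/2) * f' i t * (1 / f i t) * (1 / sqrt (f i t)))"
    by (intro smooth_family_mult Suc.IH smooth_family_SucD[OF Suc.prems] f'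
        smooth_family_const[of _ _ 1] smooth_family_inverse[OF _ assms(2,3)]) auto
  ultimately show ?case
    using B unfolding smooth_family.simps by blast
qed

lemma smooth_family_subset: "smooth_family n X f \<Longrightarrow> Y \<subseteq> X \<Longrightarrow> smooth_family n Y f"
proof (induction n arbitrary: f)
  case (Suc n)
  then obtain f' where "smooth_family n X f'"
    "\<forall>i\<in>X. \<forall>t. sin (2 * t) \<noteq> 0 \<longrightarrow> (f i has_real_derivative f' i t) (at t)"
    by auto
  with Suc.IH[of f'] Suc.prems show ?case
    unfolding smooth_family.simps by blast
qed auto

lemma smooth_family_disjoint_Un:
  assumes "smooth_family n X f" "smooth_family n Y f" "X \<inter> Y = {}"
  shows "smooth_family n (X \<union> Y) f"
  using assms(1,2)
proof (induction n arbitrary: f)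
  case 0
  obtain B C where "\<And>i t. i \<in> X \<Longrightarrow> \<bar>f i t\<bar> \<le> B" "\<And>i t. i \<in> Y \<Longrightarrow> \<bar>f i t\<bar> \<le> C"
    using smooth_family_bounded[OF 0(1)] smooth_family_bounded[OF 0(2)] by metis
  then have "\<forall>i\<in>X \<union> Y. \<forall>t. \<bar>f i t\<bar> \<le> max B C"
    by (auto simp: le_max_iff_disj)
  then show ?case by auto
next
  case (Suc n)
  obtain B C where "\<And>i t. i \<in> X \<Longrightarrow> \<bar>f i t\<bar> \<le> B" "\<And>i t. i \<in> Y \<Longrightarrow> \<bar>f i t\<bar> \<le> C"
    using smooth_family_bounded[OF Suc.prems(1)] smooth_family_bounded[OF Suc.prems(2)] by metis
  then have B: "\<forall>i\<in>X \<union> Y. \<forall>t. \<bar>f i t\<bar> \<le> max B C"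
    by (auto simp: le_max_iff_disj)
  obtain g h where g: "smooth_family n X g" and h: "smooth_family n Y h"
    and D: "\<forall>i\<in>X. \<forall>t. sin (2 * t) \<noteq> 0 \<longrightarrow> (f i has_real_derivative g i t) (at t)"
    "\<forall>i\<in>Y. \<forall>t. sin (2 * t) \<noteq> 0 \<longrightarrow> (f i has_real_derivative h i t) (at t)"
    using Suc.prems by auto
  \<comment> \<open>Disjointness makes this choice agree with \<open>h\<close> on all of
    \<open>Y\<close>; the derivative families found on \<open>X\<close> and on \<open>Y\<close> are
    otherwise unrelated.\<close>
  define f' where "f' = (\<lambda>i. if i \<in> X then g i else h i)"
  have "smooth_family n (X \<union> Y) f'"
    by (rule Suc.IH; rule smooth_family_cong[OF g] smooth_family_cong[OF h])
       (use assms(3) in \<open>auto simp: f'_def\<close>)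
  moreover have "\<forall>i\<in>X \<union> Y. \<forall>t. sin (2 * t) \<noteq> 0 \<longrightarrow> (f i has_real_derivative f' i t) (at t)"
    using D by (auto simp: f'_def)
  ultimately show ?case
    using B Suc.prems by auto
qed

lemma smooth_family_Un:
  assumes "smooth_family n X f" "smooth_family n Y f"
  shows "smooth_family n (X \<union> Y) f"
  using smooth_family_disjoint_Un[OF assms(1) smooth_family_subset[OF assms(2), of "Y - X"]]
  by auto

text \<open>Sine and cosine are each other's derivative up to sign, so the induction carries both at
  once.\<close>

lemma smooth_family_sin_cos:
  "smooth_family n X (\<lambda>i. sin) \<and> smooth_family n X (\<lambda>i. cos)"
proof (induction n)
  case 0
  then show ?case by (auto intro!: exI[of _ 1])
next
  case (Suc n)
  have "smooth_family n X (\<lambda>i t. - 1 * sin t)"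
    by (intro smooth_family_mult smooth_family_const[of _ _ 1]) (use Suc in auto)
  moreover have "\<forall>i\<in>X. \<forall>t. \<bar>sin t::real\<bar> \<le> 1 \<and> \<bar>cos t::real\<bar> \<le> 1"
    by auto
  moreover have "(sin has_real_derivative cos t) (at t)" "(cos has_real_derivative - 1 * sin t) (at t)" for t
    by (auto intro!: derivative_eq_intros)
  moreover have "continuous_on UNIV (sin :: real \<Rightarrow> real)" "continuous_on UNIV (cos :: real \<Rightarrow> real)"
    by (auto intro!: continuous_intros)
  ultimately show ?case
    using Suc unfolding smooth_family.simps by blast
qed

text \<open>\<open>h m\<close> stands for the m-th derivative of \<open>h 0\<close>. Derivatives are
  asked for in the open interval only, since cos (2 * t) is an endpoint exactly where sin (2 * t) =
  0. The chain-rule factor -2 * sin (2 * t) is written with sin t and cos t, whose regularity is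
  known.\<close>

lemma smooth_family_compose_cos:
  fixes h :: "nat \<Rightarrow> 'i \<Rightarrow> real \<Rightarrow> real"
  assumes "\<And>m. m < n \<Longrightarrow> \<forall>i\<in>X. continuous_on {-1..1} (h m i)"
    and "\<And>m. m \<le> n \<Longrightarrow> \<exists>B. \<forall>i\<in>X. \<forall>x\<in>{-1..1}. \<bar>h m i x\<bar> \<le> B"
    and "\<And>m i x. m < n \<Longrightarrow> i \<in> X \<Longrightarrow> x \<in> {-1<..<1} \<Longrightarrow>
           (h m i has_real_derivative h (Suc m) i x) (at x)"
  shows "smooth_family n X (\<lambda>i t. h 0 i (cos (2 * t)))"
  using assms
proof (induction n arbitrary: h)
  case 0
  then obtain B where "\<forall>i\<in>X. \<forall>x\<in>{-1..1}. \<bar>h 0 i x\<bar> \<le> B" by blast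
  then show ?case by (auto intro!: exI[of _ B])
next
  case (Suc n)
  have "smooth_family n X (\<lambda>i t. h (Suc 0) i (cos (2 * t)))"
    by (rule Suc.IH[of "\<lambda>m. h (Suc m)"]) (use Suc.prems in auto)
  then have "smooth_family n X (\<lambda>i t. h (Suc 0) i (cos (2 * t)) * ((-4) * (sin t * cos t)))"
    by (intro smooth_family_mult smooth_family_const[of _ _ 4])
       (use smooth_family_sin_cos[of n X] in auto)
  moreover have "((\<lambda>t. h 0 i (cos (2 * t))) has_real_derivative
      h (Suc 0) i (cos (2 * t)) * ((-4) * (sin t * cos t))) (at t)" if "i \<in> X" "sin (2 * t) \<noteq> 0" for i t
  proof -
    have "(cos (2 * t))\<^sup>2 < 1"
      using that(2) sin_cos_squared_add[of "2 * t"] by (smt (verit) zero_less_power2)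
    then have "cos (2 * t) \<in> {-1<..<1}"
      by (auto simp: abs_square_less_1 abs_less_iff)
    from Suc.prems(3)[OF _ that(1) this, of 0]
    have "(h 0 i has_real_derivative h (Suc 0) i (cos (2 * t))) (at (cos (2 * t)))" by simp
    moreover have "((\<lambda>t. cos (2 * t)) has_real_derivative (-4) * (sin t * cos t)) (at t)"
      by (auto intro!: derivative_eq_intros simp: sin_double)
    ultimately show ?thesis
      by (rule DERIV_chain2)
  qed
  moreover have "continuous_on UNIV (\<lambda>t. h 0 i (cos (2 * t)))" if "i \<in> X" for i
    by (rule continuous_on_compose2[of "{-1..1}" "h 0 i"])
       (use Suc.prems(1)[of 0] that in \<open>auto intro!: continuous_intros\<close>)
  moreover obtain B where "\<forall>i\<in>X. \<forall>x\<in>{-1..1}. \<bar>h 0 i x\<bar> \<le> B"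
    using Suc.prems(2)[of 0] by auto
  then have "\<exists>B. \<forall>i\<in>X. \<forall>t. \<bar>h 0 i (cos (2 * t))\<bar> \<le> B"
    by (intro exI[of _ B]) auto
  ultimately show ?case
    unfolding smooth_family.simps by blast
qed

subsection \<open>Uniformly analytic families\<close>

definition strip :: "real \<Rightarrow> complex set" where
  "strip \<epsilon> = {z. \<bar>Im z\<bar> < \<epsilon>}"

lemma open_strip: "open (strip \<epsilon>)"
  unfolding strip_def by (intro open_Collect_less continuous_intros)

lemma convex_strip: "convex (strip \<epsilon>)"
proof -
  have "strip \<epsilon> = {z. Im z < \<epsilon>} \<inter> {z. Im z > -\<epsilon>}"
    by (auto simp: strip_def)
  then show ?thesis
    by (simp add: convex_Int convex_halfspace_Im_lt convex_halfspace_Im_gt)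
qed

lemma of_real_in_strip: "\<epsilon> > 0 \<Longrightarrow> complex_of_real t \<in> strip \<epsilon>"
  by (simp add: strip_def)

lemma strip_mono: "\<epsilon> \<le> \<epsilon>' \<Longrightarrow> strip \<epsilon> \<subseteq> strip \<epsilon>'"
  by (auto simp: strip_def)

text \<open>No width is prescribed: every use of a lower bound or of a Cauchy estimate narrows the
  strip, and the final rate may be any number in (0, \<delta>]. What matters is that width and bound
  are common to all members.\<close>

definition analytic_family :: "'i set \<Rightarrow> ('i \<Rightarrow> real \<Rightarrow> real) \<Rightarrow> bool" where
  "analytic_family X f \<longleftrightarrow> (\<exists>\<epsilon>>0. \<exists>B. \<forall>i\<in>X. \<exists>h. h holomorphic_on strip \<epsilon> \<and>
     (\<forall>z\<in>strip \<epsilon>. cmod (h z) \<le> B) \<and> (\<forall>t. h (of_real t) = of_real (f i t)))"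

lemma analytic_familyE:
  assumes "analytic_family X f"
  obtains \<epsilon> B h where "\<epsilon> > 0" "B > 0"
    "\<And>i. i \<in> X \<Longrightarrow> h i holomorphic_on strip \<epsilon>"
    "\<And>i z. i \<in> X \<Longrightarrow> z \<in> strip \<epsilon> \<Longrightarrow> cmod (h i z) \<le> B"
    "\<And>i t. i \<in> X \<Longrightarrow> h i (of_real t) = of_real (f i t)"
proof -
  obtain \<epsilon> B where "\<epsilon> > 0" and *: "\<forall>i\<in>X. \<exists>h. h holomorphic_on strip \<epsilon> \<and>
     (\<forall>z\<in>strip \<epsilon>. cmod (h z) \<le> B) \<and> (\<forall>t. h (of_real t) = of_real (f i t))"
    using assms unfolding analytic_family_def by auto
  from bchoice[OF *] obtain h where h: "\<forall>i\<in>X. h i holomorphic_on strip \<epsilon> \<and>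
     (\<forall>z\<in>strip \<epsilon>. cmod (h i z) \<le> B) \<and> (\<forall>t. h i (of_real t) = of_real (f i t))"
    by auto
  show ?thesis
    by (rule that[of \<epsilon> "max 1 B" h]) (use \<open>\<epsilon> > 0\<close> h in \<open>auto simp: le_max_iff_disj\<close>)
qed

lemma analytic_familyI:
  assumes "\<epsilon> > 0"
    "\<And>i. i \<in> X \<Longrightarrow> h i holomorphic_on strip \<epsilon>"
    "\<And>i z. i \<in> X \<Longrightarrow> z \<in> strip \<epsilon> \<Longrightarrow> cmod (h i z) \<le> B"
    "\<And>i t. i \<in> X \<Longrightarrow> h i (of_real t) = of_real (f i t)"
  shows "analytic_family X f"
  unfolding analytic_family_def using assms by blast

lemma analytic_family_cong:
  assumes "analytic_family X f" "\<And>i t. i \<in> X \<Longrightarrow> f i t = g i t"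
  shows "analytic_family X g"
  using assms unfolding analytic_family_def by auto

lemma analytic_family_continuous:
  assumes "analytic_family X f" "i \<in> X"
  shows "continuous_on UNIV (f i)"
proof -
  obtain \<epsilon> B h where h: "\<epsilon> > 0"
    "\<And>i. i \<in> X \<Longrightarrow> h i holomorphic_on strip \<epsilon>"
    "\<And>i t. i \<in> X \<Longrightarrow> h i (of_real t) = of_real (f i t)"
    using analytic_familyE[OF assms(1)] by metis
  have "continuous_on UNIV (\<lambda>t. h i (of_real t))"
    by (rule continuous_on_compose2[OF holomorphic_on_imp_continuous_on[OF h(2)[OF assms(2)]]])
       (use h(1) of_real_in_strip in \<open>auto intro!: continuous_intros\<close>)
  then have "continuous_on UNIV (\<lambda>t. Re (h i (of_real t)))"
    by (intro continuous_intros)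
  then show ?thesis
    by (simp add: h(3)[OF assms(2)])
qed

lemma analytic_family_const:
  assumes "\<And>i. i \<in> X \<Longrightarrow> \<bar>c i\<bar> \<le> B"
  shows "analytic_family X (\<lambda>i t. c i)"
  by (rule analytic_familyI[of 1 X "\<lambda>i z. of_real (c i)" B]) (use assms in auto)

text \<open>Reduces to the smaller width and the larger bound. Two index sets are allowed because
  the same reduction serves unions.\<close>

lemma analytic_family_pairE:
  assumes "analytic_family X f" "analytic_family Y g"
  obtains e B h k where "e > 0" "B > 0" "\<And>i. i \<in> X \<Longrightarrow> h i holomorphic_on strip e"
    "\<And>i z. i \<in> X \<Longrightarrow> z \<in> strip e \<Longrightarrow> cmod (h i z) \<le> B"
    "\<And>i t. i \<in> X \<Longrightarrow> h i (of_real t) = of_real (f i t)"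
    "\<And>i. i \<in> Y \<Longrightarrow> k i holomorphic_on strip e"
    "\<And>i z. i \<in> Y \<Longrightarrow> z \<in> strip e \<Longrightarrow> cmod (k i z) \<le> B"
    "\<And>i t. i \<in> Y \<Longrightarrow> k i (of_real t) = of_real (g i t)"
proof -
  obtain e B h where h: "e > 0" "B > 0"
    "\<And>i. i \<in> X \<Longrightarrow> h i holomorphic_on strip e"
    "\<And>i z. i \<in> X \<Longrightarrow> z \<in> strip e \<Longrightarrow> cmod (h i z) \<le> B"
    "\<And>i t. i \<in> X \<Longrightarrow> h i (of_real t) = of_real (f i t)"
    using analytic_familyE[OF assms(1)] by blast
  obtain e' C k where k: "e' > 0" "C > 0"
    "\<And>i. i \<in> Y \<Longrightarrow> k i holomorphic_on strip e'"
    "\<And>i z. i \<in> Y \<Longrightarrow> z \<in> strip e' \<Longrightarrow> cmod (k i z) \<le> C"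
    "\<And>i t. i \<in> Y \<Longrightarrow> k i (of_real t) = of_real (g i t)"
    using analytic_familyE[OF assms(2)] by blast
  have sub: "strip (min e e') \<subseteq> strip e" "strip (min e e') \<subseteq> strip e'"
    by (auto intro!: strip_mono)
  show ?thesis
  proof (rule that[of "min e e'" "max B C" h k])
    show "h i holomorphic_on strip (min e e')" if "i \<in> X" for i
      using h(3)[OF that] sub(1) holomorphic_on_subset by blast
    show "k i holomorphic_on strip (min e e')" if "i \<in> Y" for i
      using k(3)[OF that] sub(2) holomorphic_on_subset by blast
    show "cmod (h i z) \<le> max B C" if "i \<in> X" "z \<in> strip (min e e')" for i z
      using h(4)[OF that(1)] sub(1) that(2) by (simp add: le_max_iff_disj subset_iff)
    show "cmod (k i z) \<le> max B C" if "i \<in> Y" "z \<in> strip (min e e')" for i z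
      using k(4)[OF that(1)] sub(2) that(2) by (simp add: le_max_iff_disj subset_iff)
  qed (use h k in auto)
qed

lemma analytic_family_add:
  assumes "analytic_family X f" "analytic_family X g"
  shows "analytic_family X (\<lambda>i t. f i t + g i t)"
proof -
  obtain e B h k where e: "e > 0" "B > 0" and h: "\<And>i. i \<in> X \<Longrightarrow> h i holomorphic_on strip e"
    "\<And>i z. i \<in> X \<Longrightarrow> z \<in> strip e \<Longrightarrow> cmod (h i z) \<le> B"
    "\<And>i t. i \<in> X \<Longrightarrow> h i (of_real t) = of_real (f i t)"
    and k: "\<And>i. i \<in> X \<Longrightarrow> k i holomorphic_on strip e"
    "\<And>i z. i \<in> X \<Longrightarrow> z \<in> strip e \<Longrightarrow> cmod (k i z) \<le> B"
    "\<And>i t. i \<in> X \<Longrightarrow> k i (of_real t) = of_real (g i t)"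
    by (rule analytic_family_pairE[OF assms]) (rule that)
  show ?thesis
  proof (rule analytic_familyI[OF e(1), of X "\<lambda>i z. h i z + k i z" "B + B"])
    show "(\<lambda>z. h i z + k i z) holomorphic_on strip e" if "i \<in> X" for i
      by (intro holomorphic_intros h(1) k(1) that)
    show "cmod (h i z + k i z) \<le> B + B" if "i \<in> X" "z \<in> strip e" for i z
      by (intro norm_triangle_mono h(2) k(2) that)
  qed (simp add: h(3) k(3))
qed

lemma analytic_family_mult:
  assumes "analytic_family X f" "analytic_family X g"
  shows "analytic_family X (\<lambda>i t. f i t * g i t)"
proof -
  obtain e B h k where e: "e > 0" "B > 0" and h: "\<And>i. i \<in> X \<Longrightarrow> h i holomorphic_on strip e"
    "\<And>i z. i \<in> X \<Longrightarrow> z \<in> strip e \<Longrightarrow> cmod (h i z) \<le> B"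
    "\<And>i t. i \<in> X \<Longrightarrow> h i (of_real t) = of_real (f i t)"
    and k: "\<And>i. i \<in> X \<Longrightarrow> k i holomorphic_on strip e"
    "\<And>i z. i \<in> X \<Longrightarrow> z \<in> strip e \<Longrightarrow> cmod (k i z) \<le> B"
    "\<And>i t. i \<in> X \<Longrightarrow> k i (of_real t) = of_real (g i t)"
    by (rule analytic_family_pairE[OF assms]) (rule that)
  show ?thesis
  proof (rule analytic_familyI[OF e(1), of X "\<lambda>i z. h i z * k i z" "B * B"])
    show "(\<lambda>z. h i z * k i z) holomorphic_on strip e" if "i \<in> X" for i
      by (intro holomorphic_intros h(1) k(1) that)
    show "cmod (h i z * k i z) \<le> B * B" if "i \<in> X" "z \<in> strip e" for i z
      unfolding norm_mult by (intro mult_mono h(2) k(2) that) (use e(2) in auto)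
  qed (simp add: h(3) k(3))
qed

text \<open>Cauchy's inequality on discs of radius \<epsilon> / 2, which stay inside the strip,
  bounds the derivative by 2 * B / \<epsilon> on the half strip; the mean value inequality between z
  and its real part does the rest. This carries information off the real axis: lower bounds for real
  parts, and later the bound on \<open>g\<close>.\<close>

lemma strip_deviation:
  assumes "h holomorphic_on strip \<epsilon>" "\<And>z. z \<in> strip \<epsilon> \<Longrightarrow> cmod (h z) \<le> B" "z \<in> strip (\<epsilon> / 2)"
  shows "cmod (h z - h (of_real (Re z))) \<le> 2 * B / \<epsilon> * \<bar>Im z\<bar>"
proof -
  have eps: "\<epsilon> > 0" using assms(3) by (auto simp: strip_def)
  have sub: "strip (\<epsilon> / 2) \<subseteq> strip \<epsilon>" by (rule strip_mono) (use eps in auto)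
  have bnd: "cmod (deriv h w) \<le> 2 * B / \<epsilon>" if w: "w \<in> strip (\<epsilon> / 2)" for w
  proof -
    have cb: "cball w (\<epsilon> / 2) \<subseteq> strip \<epsilon>"
    proof
      fix u assume "u \<in> cball w (\<epsilon> / 2)"
      then have "\<bar>Im (w - u)\<bar> \<le> \<epsilon> / 2"
        by (metis abs_Im_le_cmod dist_norm mem_cball order_trans)
      with w show "u \<in> strip \<epsilon>"
        unfolding strip_def mem_Collect_eq minus_complex.sel by linarith
    qed
    have hc: "h holomorphic_on cball w (\<epsilon> / 2)"
      using assms(1) cb holomorphic_on_subset by blast
    have "cmod ((deriv ^^ 1) h w) \<le> fact 1 * B / (\<epsilon> / 2) ^ 1"
      by (rule Cauchy_inequality)
         (use hc eps cb assms(2) in \<open>auto intro: holomorphic_on_imp_continuous_on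
            elim: holomorphic_on_subset simp: subset_eq dist_norm\<close>)
    then show ?thesis by (simp add: field_simps)
  qed
  have "cmod (h z - h (of_real (Re z))) \<le> 2 * B / \<epsilon> * cmod (z - of_real (Re z))"
  proof (rule field_differentiable_bound[OF convex_strip _ bnd])
    show "(h has_field_derivative deriv h w) (at w within strip (\<epsilon> / 2))" if "w \<in> strip (\<epsilon> / 2)" for w
      using assms(1) open_strip sub that
      by (meson has_field_derivative_at_within holomorphic_derivI subsetD)
  qed (use assms(3) eps of_real_in_strip in auto)
  moreover have "cmod (z - of_real (Re z)) = \<bar>Im z\<bar>"
    by (simp add: cmod_def)
  ultimately show ?thesis by simp
qed

text \<open>Values in a right half-plane avoid the branch cut of \<open>csqrt\<close>. The width of
  the strip depends only on c and on the uniform data of the family, so inverse square roots of all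
  members live on one strip.\<close>

lemma analytic_family_halfplane:
  assumes "analytic_family X f" "c > 0" "\<And>i t. i \<in> X \<Longrightarrow> c \<le> f i t"
  obtains \<epsilon> h where "\<epsilon> > 0"
    "\<And>i. i \<in> X \<Longrightarrow> h i holomorphic_on strip \<epsilon>"
    "\<And>i z. i \<in> X \<Longrightarrow> z \<in> strip \<epsilon> \<Longrightarrow> Re (h i z) \<ge> c / 2"
    "\<And>i t. i \<in> X \<Longrightarrow> h i (of_real t) = of_real (f i t)"
proof -
  obtain e B h where h: "e > 0" "B > 0"
    "\<And>i. i \<in> X \<Longrightarrow> h i holomorphic_on strip e"
    "\<And>i z. i \<in> X \<Longrightarrow> z \<in> strip e \<Longrightarrow> cmod (h i z) \<le> B"
    "\<And>i t. i \<in> X \<Longrightarrow> h i (of_real t) = of_real (f i t)"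
    using analytic_familyE[OF assms(1)] by blast
  \<comment> \<open>The second entry makes the deviation from the real axis, at most 2 * B / e * d,
    no larger than c / 2; the first keeps z in the half strip where that estimate holds.\<close>
  define d where "d = min (e / 2) (c * e / (4 * B))"
  have d: "d > 0" "d \<le> e / 2" "2 * B / e * d \<le> c / 2"
  proof -
    have "2 * B / e * d \<le> 2 * B / e * (c * e / (4 * B))"
      using h(1,2) by (intro mult_left_mono) (auto simp: d_def)
    also have "\<dots> = c / 2" using h(1,2) by (simp add: field_simps)
    finally show "2 * B / e * d \<le> c / 2" .
  qed (use h(1,2) assms(2) in \<open>auto simp: d_def\<close>)
  have sub: "strip d \<subseteq> strip (e / 2)" "strip d \<subseteq> strip e"
    using d(2) h(1) by (auto intro!: strip_mono)
  show ?thesis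
  proof (rule that[of d h])
    show "h i holomorphic_on strip d" if "i \<in> X" for i
      using h(3)[OF that] sub(2) holomorphic_on_subset by blast
    show "Re (h i z) \<ge> c / 2" if "i \<in> X" "z \<in> strip d" for i z
    proof -
      have "cmod (h i z - h i (of_real (Re z))) \<le> 2 * B / e * \<bar>Im z\<bar>"
        by (rule strip_deviation[OF h(3) h(4)]) (use that sub in auto)
      also have "\<dots> \<le> 2 * B / e * d"
        using that(2) h(1,2) by (intro mult_left_mono) (auto simp: strip_def)
      finally have "\<bar>Re (h i z - h i (of_real (Re z)))\<bar> \<le> c / 2"
        using d(3) abs_Re_le_cmod order_trans by meson
      then show ?thesis
        using assms(3)[OF that(1), of "Re z"] unfolding minus_complex.sel h(5)[OF that(1)] by (simp only: Re_complex_of_real)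
    qed
  qed (use d(1) h(5) in auto)
qed

lemma analytic_family_inverse_sqrt:
  assumes "analytic_family X f" "c > 0" "\<And>i t. i \<in> X \<Longrightarrow> c \<le> f i t"
  shows "analytic_family X (\<lambda>i t. 1 / sqrt (f i t))"
proof -
  obtain e h where h: "e > 0"
    "\<And>i. i \<in> X \<Longrightarrow> h i holomorphic_on strip e"
    "\<And>i z. i \<in> X \<Longrightarrow> z \<in> strip e \<Longrightarrow> Re (h i z) \<ge> c / 2"
    "\<And>i t. i \<in> X \<Longrightarrow> h i (of_real t) = of_real (f i t)"
    using analytic_family_halfplane[OF assms] by blast
  have low: "cmod (csqrt (h i z)) \<ge> sqrt (c / 2)" if "i \<in> X" "z \<in> strip e" for i z
    using h(3)[OF that] complex_Re_le_cmod[of "h i z"] by simp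
  show ?thesis
  proof (rule analytic_familyI[OF h(1), of X "\<lambda>i z. 1 / csqrt (h i z)" "1 / sqrt (c / 2)"])
    show "(\<lambda>z. 1 / csqrt (h i z)) holomorphic_on strip e" if "i \<in> X" for i
    proof (intro holomorphic_intros h(2)[OF that])
      show "h i z \<notin> \<real>\<^sub>\<le>\<^sub>0" if "z \<in> strip e" for z
        using h(3)[OF \<open>i \<in> X\<close> that] assms(2) by (auto simp: complex_nonpos_Reals_iff)
      show "csqrt (h i z) \<noteq> 0" if "z \<in> strip e" for z
        using h(3)[OF \<open>i \<in> X\<close> that] assms(2) by auto
    qed
    show "cmod (1 / csqrt (h i z)) \<le> 1 / sqrt (c / 2)" if "i \<in> X" "z \<in> strip e" for i z
      using low[OF that] assms(2) unfolding norm_divide norm_one by (intro frac_le) auto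
    show "1 / csqrt (h i (of_real t)) = of_real (1 / sqrt (f i t))" if "i \<in> X" for i t
      using assms(2) assms(3)[OF that, of t] by (simp add: h(4)[OF that])
  qed
qed

lemma analytic_family_Un:
  assumes "analytic_family X f" "analytic_family Y f"
  shows "analytic_family (X \<union> Y) f"
proof -
  obtain e B h k where e: "e > 0" "B > 0" and h: "\<And>i. i \<in> X \<Longrightarrow> h i holomorphic_on strip e"
    "\<And>i z. i \<in> X \<Longrightarrow> z \<in> strip e \<Longrightarrow> cmod (h i z) \<le> B"
    "\<And>i t. i \<in> X \<Longrightarrow> h i (of_real t) = of_real (f i t)"
    and k: "\<And>i. i \<in> Y \<Longrightarrow> k i holomorphic_on strip e"
    "\<And>i z. i \<in> Y \<Longrightarrow> z \<in> strip e \<Longrightarrow> cmod (k i z) \<le> B"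
    "\<And>i t. i \<in> Y \<Longrightarrow> k i (of_real t) = of_real (f i t)"
    by (rule analytic_family_pairE[OF assms]) (rule that)
  show ?thesis
    by (rule analytic_familyI[OF e(1), of _ "\<lambda>i. if i \<in> X then h i else k i" B]) (use h k in auto)
qed

lemma norm_exp_ii_strip: "z \<in> strip 1 \<Longrightarrow> cmod (exp (\<i> * z)) \<le> exp 1" "z \<in> strip 1 \<Longrightarrow> cmod (exp (- (\<i> * z))) \<le> exp 1"
  by (auto simp: strip_def)

lemma analytic_family_sin: "analytic_family X (\<lambda>i. sin)"
proof (rule analytic_familyI[of 1 X "\<lambda>i. sin" "exp 1"])
  show "cmod (sin z) \<le> exp 1" if "z \<in> strip 1" for z
  proof -
    have "cmod (exp (\<i> * z) - exp (- (\<i> * z))) \<le> exp 1 + exp 1"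
      by (intro order_trans[OF norm_triangle_ineq4] add_mono norm_exp_ii_strip that)
    then show ?thesis
      by (simp add: sin_exp_eq norm_divide norm_mult)
  qed
qed (auto simp: sin_of_real intro!: holomorphic_intros)

lemma analytic_family_cos: "analytic_family X (\<lambda>i. cos)"
proof (rule analytic_familyI[of 1 X "\<lambda>i. cos" "exp 1"])
  show "cmod (cos z) \<le> exp 1" if "z \<in> strip 1" for z
  proof -
    have "cmod (exp (\<i> * z) + exp (- (\<i> * z))) \<le> exp 1 + exp 1"
      by (intro order_trans[OF norm_triangle_ineq] add_mono norm_exp_ii_strip that)
    then show ?thesis
      by (simp add: cos_exp_eq norm_divide norm_mult)
  qed
qed (auto simp: cos_of_real intro!: holomorphic_intros)

subsection \<open>Oscillatory integrals\<close>

lemma finite_sin_double_zeros: "finite {t \<in> {a..b}. sin (2 * t) = (0::real)}"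
proof -
  have "{t \<in> {a..b}. sin (2 * t) = 0} \<subseteq> (\<lambda>n. of_int n * pi / 2) ` {\<lfloor>2 * a / pi\<rfloor>..\<lceil>2 * b / pi\<rceil>}"
  proof
    fix t assume t: "t \<in> {t \<in> {a..b}. sin (2 * t) = 0}"
    then obtain n :: int where n: "2 * t = of_int n * pi"
      by (auto simp: sin_zero_iff_int2)
    then have n': "of_int n = 2 * t / pi" by (simp add: field_simps)
    have "2 * a / pi \<le> of_int n" "of_int n \<le> 2 * b / pi"
      unfolding n' using t by (auto intro!: divide_right_mono)
    then have "n \<in> {\<lfloor>2 * a / pi\<rfloor>..\<lceil>2 * b / pi\<rceil>}"
      by (auto simp: le_ceiling_iff floor_le_iff)
    moreover have "t = of_int n * pi / 2" using n by simp
    ultimately show "t \<in> (\<lambda>n. of_int n * pi / 2) ` {\<lfloor>2 * a / pi\<rfloor>..\<lceil>2 * b / pi\<rceil>}" by blast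
  qed
  then show ?thesis by (rule finite_subset) auto
qed

lemma open_sin_double_nonzero: "open {t::real. sin (2 * t) \<noteq> 0}"
  by (intro open_Collect_neq continuous_intros)

text \<open>A compact interval contains only finitely many zeros of sin (2 * t), and continuity of f
  bridges them.\<close>

lemma FTC_off_sin_double_zeros:
  fixes f :: "real \<Rightarrow> complex"
  assumes "a \<le> b" "continuous_on UNIV f"
    and "\<And>t. sin (2 * t) \<noteq> 0 \<Longrightarrow> (f has_vector_derivative f' t) (at t)"
  shows "(f' has_integral (f b - f a)) {a..b}"
  by (rule fundamental_theorem_of_calculus_interior_strong[OF finite_sin_double_zeros[of a b] assms(1)])
     (use assms in \<open>auto intro: continuous_on_subset\<close>)

text \<open>Serves to pass from branches to triples of a branch and two frequencies j, k, so that
  constants become uniform in j and k as well.\<close>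

lemma smooth_family_reindex:
  assumes "smooth_family n X f" "\<And>y. y \<in> Y \<Longrightarrow> \<phi> y \<in> X"
  shows "smooth_family n Y (\<lambda>y. f (\<phi> y))"
  using assms(1)
proof (induction n arbitrary: f)
  case 0
  then show ?case using assms(2) by auto
next
  case (Suc n)
  then obtain f' where f': "smooth_family n X f'"
    "\<forall>i\<in>X. \<forall>t. sin (2 * t) \<noteq> 0 \<longrightarrow> (f i has_real_derivative f' i t) (at t)"
    by auto
  moreover obtain B where "\<forall>i\<in>X. \<forall>t. \<bar>f i t\<bar> \<le> B" using Suc.prems by auto
  ultimately show ?case
    using Suc.IH[OF f'(1)] Suc.prems assms(2) unfolding smooth_family.simps by blast
qed

text \<open>The period starts at \<open>pi / 4\<close>, where \<open>sin (2 * t) \<noteq> 0\<close>, so that the boundary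
  terms only involve points at which the derivatives exist.\<close>
lemma nonstationary_phase:
  fixes A m :: "'k \<Rightarrow> real \<Rightarrow> real" and F :: "'k \<Rightarrow> real \<Rightarrow> complex" and N :: "'k \<Rightarrow> real"
  assumes "smooth_family n X A" "smooth_family n X m"
    and c: "c > 0" "\<And>k t. k \<in> X \<Longrightarrow> c \<le> m k t"
    and N: "\<And>k. k \<in> X \<Longrightarrow> N k > 0"
    and F: "\<And>k. k \<in> X \<Longrightarrow> continuous_on UNIV (F k)" "\<And>k t. k \<in> X \<Longrightarrow> cmod (F k t) = 1"
      "\<And>k t. k \<in> X \<Longrightarrow> F k (t + 2 * pi) = F k t"
      "\<And>k t. k \<in> X \<Longrightarrow> sin (2 * t) \<noteq> 0 \<Longrightarrow>
         (F k has_vector_derivative \<i> * of_real (N k * m k t) * F k t) (at t)"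
    and per: "\<And>k t. k \<in> X \<Longrightarrow> sin (2 * t) \<noteq> 0 \<Longrightarrow> A k (t + 2 * pi) = A k t"
      "\<And>k t. k \<in> X \<Longrightarrow> sin (2 * t) \<noteq> 0 \<Longrightarrow> m k (t + 2 * pi) = m k t"
  shows "\<exists>C. \<forall>k\<in>X. \<forall>y. ((\<lambda>t. of_real (A k t) * F k t) has_integral y) {pi / 4..pi / 4 + 2 * pi} \<longrightarrow>
    cmod y \<le> C / N k ^ n"
  using assms(1,2) per(1)
proof (induction n arbitrary: A)
  case 0
  obtain B where B: "B > 0" "\<And>i t. i \<in> X \<Longrightarrow> \<bar>A i t\<bar> \<le> B"
    using smooth_family_bounded[OF 0(1)] by metis
  have "cmod y \<le> (B * (2 * pi)) / N k ^ 0"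
    if "k \<in> X" "((\<lambda>t. of_real (A k t) * F k t) has_integral y) {pi / 4..pi / 4 + 2 * pi}" for k y
  proof -
    have "cmod y \<le> B * measure lborel {pi / 4..pi / 4 + 2 * pi}"
      by (rule has_integral_bound_real[OF _ finite.emptyI that(2)])
         (use B that(1) in \<open>auto simp: norm_mult F(2)\<close>)
    then show ?thesis by simp
  qed
  then show ?case by blast
next
  case (Suc n)
  \<comment> \<open>F' = i * N * m * F, hence A * F = W * F' / (i * N). Integration by parts
    replaces A by W' up to sign, one order lower, and gains the factor 1 / N.\<close>
  define W where "W = (\<lambda>k t. A k t * (1 / m k t))"
  have mpos: "m k t > 0" if "k \<in> X" for k t
    using c(1) c(2)[OF that, of t] by simp
  have W: "smooth_family (Suc n) X W"
    unfolding W_def by (intro smooth_family_mult smooth_family_inverse[OF _ c] Suc.prems)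
  then obtain W' where W': "smooth_family n X W'"
    "\<And>k t. k \<in> X \<Longrightarrow> sin (2 * t) \<noteq> 0 \<Longrightarrow> (W k has_real_derivative W' k t) (at t)"
    by auto
  have perW: "W k (t + 2 * pi) = W k t" if "k \<in> X" "sin (2 * t) \<noteq> 0" for k t
    using Suc.prems(3)[OF that] per(2)[OF that] by (simp add: W_def)
  \<comment> \<open>The induction hypothesis asks for a periodic amplitude; a derivative inherits
    periodicity from \<open>W\<close> wherever it exists.\<close>
  have perW': "W' k (t + 2 * pi) = W' k t" if k: "k \<in> X" and t: "sin (2 * t) \<noteq> 0" for k t
  proof -
    have "(W k has_real_derivative W' k (t + 2 * pi)) (at (t + 2 * pi))"
      by (rule W'(2)) (use k t in \<open>auto simp: algebra_simps sin_add\<close>)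
    then have "((\<lambda>t. W k (t + 2 * pi)) has_real_derivative W' k (t + 2 * pi)) (at t)"
      by (simp add: DERIV_shift)
    then have "(W k has_real_derivative W' k (t + 2 * pi)) (at t)"
      by (rule has_field_derivative_transform_within_open[OF _ open_sin_double_nonzero])
         (use perW k t in auto)
    with W'(2)[OF k t] show ?thesis using DERIV_unique by blast
  qed
  obtain C where C: "\<And>k y. k \<in> X \<Longrightarrow>
      ((\<lambda>t. of_real (W' k t) * F k t) has_integral y) {pi / 4..pi / 4 + 2 * pi} \<Longrightarrow> cmod y \<le> C / N k ^ n"
    using Suc.IH[OF W'(1) smooth_family_SucD[OF Suc.prems(2)] perW'] by blast
  have "cmod y \<le> C / N k ^ Suc n"
    if k: "k \<in> X" and y: "((\<lambda>t. of_real (A k t) * F k t) has_integral y) {pi / 4..pi / 4 + 2 * pi}" for k y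
  proof -
    \<comment> \<open>The integrand is the derivative of W * F. Its integral over a full period
      vanishes, as both factors take the same value at the two ends.\<close>
    have "((\<lambda>t. of_real (W' k t) * F k t + \<i> * of_real (N k) * (of_real (A k t) * F k t)) has_integral
       (of_real (W k (pi / 4 + 2 * pi)) * F k (pi / 4 + 2 * pi) - of_real (W k (pi / 4)) * F k (pi / 4)))
       {pi / 4..pi / 4 + 2 * pi}"
    proof (rule FTC_off_sin_double_zeros)
      have "continuous_on UNIV (W k)" using W k by auto
      then show "continuous_on UNIV (\<lambda>t. of_real (W k t) * F k t)"
        using F(1)[OF k] by (intro continuous_intros)
      show "((\<lambda>t. of_real (W k t) * F k t) has_vector_derivative
          of_real (W' k t) * F k t + \<i> * of_real (N k) * (of_real (A k t) * F k t)) (at t)"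
        if t: "sin (2 * t) \<noteq> 0" for t
      proof -
        have "((\<lambda>t. of_real (W k t) * F k t) has_vector_derivative
            of_real (W k t) * (\<i> * of_real (N k * m k t) * F k t) + of_real (W' k t) * F k t) (at t)"
          by (intro has_vector_derivative_mult F(4) k t has_vector_derivative_of_real
              W'(2))
        moreover have "of_real (W k t) * (\<i> * of_real (N k * m k t) * F k t) =
            \<i> * of_real (N k) * (of_real (A k t) * F k t)"
          using mpos[OF k, of t] by (simp add: W_def)
        ultimately show ?thesis by (simp only: add.commute)
      qed
    qed auto
    moreover have "W k (pi / 4 + 2 * pi) = W k (pi / 4)"
      by (rule perW[OF k]) simp
    ultimately have "((\<lambda>t. of_real (W' k t) * F k t + \<i> * of_real (N k) * (of_real (A k t) * F k t))
       has_integral 0) {pi / 4..pi / 4 + 2 * pi}"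
      by (simp only: F(3)[OF k] diff_self)
    from has_integral_diff[OF this has_integral_mult_right[OF y, of "\<i> * of_real (N k)"]]
    have "((\<lambda>t. of_real (W' k t) * F k t) has_integral - (\<i> * of_real (N k) * y))
       {pi / 4..pi / 4 + 2 * pi}"
      by simp
    from C[OF k this] have "N k * cmod y \<le> C / N k ^ n"
      using N[OF k] by (simp add: norm_mult)
    then show ?thesis using N[OF k] by (simp add: field_simps)
  qed
  then show ?case by blast
qed

section \<open>Analytic amplitudes and the shift of the contour\<close>

lemma strip_primitive:
  assumes "f holomorphic_on strip w"
  obtains g where "\<And>z. z \<in> strip w \<Longrightarrow> (g has_field_derivative f z) (at z)"
proof -
  obtain g where "\<And>z. z \<in> strip w \<Longrightarrow> (g has_field_derivative f z) (at z within strip w)"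
    using holomorphic_convex_primitive'[OF convex_strip open_strip assms] by blast
  then show ?thesis
    by (intro that[of g]) (simp add: at_within_open[OF _ open_strip])
qed

text \<open>The product of e and exp (- i * \<psi>) is continuous with derivative zero off the zeros
  of sin (2 * t), hence constant. The formula continues E into the complex strip: \<psi> will be a
  holomorphic primitive of the continuation of g, restricted to the axis.\<close>

lemma phase_eq_exp:
  fixes e \<psi> :: "real \<Rightarrow> complex" and g :: "real \<Rightarrow> complex"
  assumes "continuous_on UNIV e"
    and "\<And>t. sin (2 * t) \<noteq> 0 \<Longrightarrow> (e has_vector_derivative \<i> * g t * e t) (at t)"
    and "\<And>t. (\<psi> has_vector_derivative g t) (at t)"
  shows "e t = e 0 * exp (\<i> * (\<psi> t - \<psi> 0))"
proof -
  define u where "u = (\<lambda>t. exp (- (\<i> * \<psi> t)))"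
  have u: "(u has_vector_derivative - (\<i> * g t) * u t) (at t)" for t
  proof -
    have "((\<lambda>t. - (\<i> * \<psi> t)) has_vector_derivative - (\<i> * g t)) (at t)"
      by (intro has_vector_derivative_minus has_vector_derivative_mult_right assms(3))
    from field_vector_diff_chain_at[OF this DERIV_exp] show ?thesis
      by (simp add: u_def o_def)
  qed
  define Q where "Q = (\<lambda>t. e t * u t)"
  have "continuous_on UNIV u"
    using u by (meson continuous_at_imp_continuous_on has_vector_derivative_continuous)
  then have Qc: "continuous_on UNIV Q"
    unfolding Q_def using assms(1) by (intro continuous_on_mult)
  have Qd: "(Q has_vector_derivative (\<lambda>_. 0) t) (at t)" if "sin (2 * t) \<noteq> 0" for t
  proof -
    have "(Q has_vector_derivative e t * (- (\<i> * g t) * u t) + \<i> * g t * e t * u t) (at t)"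
      unfolding Q_def by (intro has_vector_derivative_mult assms(2) that u)
    then show ?thesis by simp
  qed
  have "Q a = Q b" if "a \<le> b" for a b
  proof -
    have "((\<lambda>_. 0) has_integral (Q b - Q a)) {a..b}"
      by (rule FTC_off_sin_double_zeros[OF that Qc Qd])
    then show ?thesis by simp
  qed
  then have "Q t = Q 0"
    by (metis linear)
  then show ?thesis
    by (simp add: Q_def u_def exp_minus exp_diff right_diff_distrib field_simps)
qed

text \<open>\<open>q\<close> will be 1 / \<lambda>. The factor 2 in the bound on g comes from the
  half angle and matches the frequency 2 * j of the Chebyshev factor.\<close>

definition phase_family ::
    "'i set \<Rightarrow> ('i \<Rightarrow> real \<Rightarrow> real) \<Rightarrow> ('i \<Rightarrow> real \<Rightarrow> complex) \<Rightarrow> real \<Rightarrow> bool" where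
  "phase_family X g E q \<longleftrightarrow> (\<forall>i\<in>X. continuous_on UNIV (E i) \<and> (\<forall>t.
     cmod (E i t) = 1 \<and> E i (t + 2 * pi) = E i t \<and> \<bar>g i t\<bar> \<le> 2 * q \<and> g i (t + 2 * pi) = g i t \<and>
     (sin (2 * t) \<noteq> 0 \<longrightarrow> (E i has_vector_derivative \<i> * of_real (g i t) * E i t) (at t))))"

lemma phase_familyD:
  assumes "phase_family X g E q" "i \<in> X"
  shows "continuous_on UNIV (E i)" "cmod (E i t) = 1" "E i (t + 2 * pi) = E i t"
    "\<bar>g i t\<bar> \<le> 2 * q" "g i (t + 2 * pi) = g i t"
    "sin (2 * t) \<noteq> 0 \<Longrightarrow> (E i has_vector_derivative \<i> * of_real (g i t) * E i t) (at t)"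
  using assms unfolding phase_family_def by blast+

definition osc_integral :: "(real \<Rightarrow> real) \<Rightarrow> (real \<Rightarrow> complex) \<Rightarrow> nat \<Rightarrow> nat \<Rightarrow> complex \<Rightarrow> bool" where
  "osc_integral a \<epsilon> j k y \<longleftrightarrow>
    ((\<lambda>t. of_real (a t) * (\<epsilon> t ^ k * exp (\<i> * of_real (2 * real j * t)))) has_integral y)
      {pi / 4..pi / 4 + 2 * pi}"

text \<open>On the line Im z = \<eta> the exponential gains exp (-2 * \<eta> * j), while each power
  of the continued phase loses at most exp (2 * p * \<eta>), because |g| stays below 2 * p up to
  this line. Hence the rate \<zeta> = 2 * \<eta>.\<close>

lemma analytic_oscillation:
  fixes A g :: "'i \<Rightarrow> real \<Rightarrow> real" and E :: "'i \<Rightarrow> real \<Rightarrow> complex"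
  assumes "analytic_family X A" "analytic_family X g"
    and ph: "phase_family X g E q" and p: "p > q" and \<delta>: "\<delta> > 0"
    and per: "\<And>i t. i \<in> X \<Longrightarrow> A i (t + 2 * pi) = A i t"
  shows "\<exists>C \<zeta>. 0 < C \<and> 0 < \<zeta> \<and> \<zeta> \<le> \<delta> \<and> (\<forall>i\<in>X. \<forall>j k. \<forall>y.
    osc_integral (A i) (E i) j k y \<longrightarrow> cmod y \<le> C * exp (- \<zeta> * (real j - p * real k)))"
proof -
  note gq = phase_familyD(4)[OF ph] and E = phase_familyD(1-3,6)[OF ph]
  obtain e B h where h: "e > 0" "B > 0"
    "\<And>i. i \<in> X \<Longrightarrow> h i holomorphic_on strip e"
    "\<And>i z. i \<in> X \<Longrightarrow> z \<in> strip e \<Longrightarrow> cmod (h i z) \<le> B"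
    "\<And>i t. i \<in> X \<Longrightarrow> h i (of_real t) = of_real (A i t)"
    using analytic_familyE[OF assms(1)] by blast
  obtain e2 B2 G where G: "e2 > 0" "B2 > 0"
    "\<And>i. i \<in> X \<Longrightarrow> G i holomorphic_on strip e2"
    "\<And>i z. i \<in> X \<Longrightarrow> z \<in> strip e2 \<Longrightarrow> cmod (G i z) \<le> B2"
    "\<And>i t. i \<in> X \<Longrightarrow> G i (of_real t) = of_real (g i t)"
    using analytic_familyE[OF assms(2)] by blast
  \<comment> \<open>The last entry limits the deviation of G from its values on the axis to 2 * (p -
    q), which turns the bound 2 * q into 2 * p; the middle one is the range of the Cauchy
    estimate.\<close>
  define w where "w = min e (min (e2 / 2) ((p - q) * e2 / B2))"
  have w: "w > 0" "w \<le> e" "w \<le> e2 / 2" "w \<le> (p - q) * e2 / B2"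
    unfolding w_def
    by (use h(1) G(1,2) p in simp, rule min.cobounded1, rule min.coboundedI2[OF min.cobounded1],
        rule min.coboundedI2[OF min.cobounded2])
  have sub: "strip w \<subseteq> strip e" "strip w \<subseteq> strip (e2 / 2)" "strip w \<subseteq> strip e2"
    using w G(1) by (auto intro!: strip_mono)
  have Gp: "cmod (G i z) \<le> 2 * p" if "i \<in> X" "z \<in> strip w" for i z
  proof -
    have "cmod (G i z - G i (of_real (Re z))) \<le> 2 * B2 / e2 * \<bar>Im z\<bar>"
      by (rule strip_deviation[OF G(3) G(4)]) (use that sub in auto)
    also have "\<dots> \<le> 2 * B2 / e2 * ((p - q) * e2 / B2)"
    proof (rule mult_left_mono)
      show "\<bar>Im z\<bar> \<le> (p - q) * e2 / B2"
        using that(2) w(4) unfolding strip_def mem_Collect_eq by linarith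
    qed (use G(1,2) in simp)
    also have "\<dots> = 2 * (p - q)" using G(1,2) by (simp add: field_simps)
    finally have "cmod (G i z - G i (of_real (Re z))) \<le> 2 * (p - q)" .
    moreover have "cmod (G i (of_real (Re z))) \<le> 2 * q"
      using gq[OF that(1), of "Re z"] by (simp add: G(5)[OF that(1)])
    ultimately have "cmod (G i z - G i (of_real (Re z)) + G i (of_real (Re z))) \<le> 2 * (p - q) + 2 * q"
      by (rule norm_triangle_mono)
    then show ?thesis by simp
  qed
  \<comment> \<open>Strictly inside the strip, and with \<zeta> = 2 * \<eta> not exceeding
    \<delta>.\<close>
  define \<eta> where "\<eta> = min (w / 2) (\<delta> / 2)"
  have \<eta>: "0 < \<eta>" "\<eta> < w" "2 * \<eta> \<le> \<delta>"
    using w(1) \<delta> unfolding \<eta>_def by linarith+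
  have "cmod y \<le> B * (2 * pi) * exp (- (2 * \<eta>) * (real j - p * real k))"
    if i: "i \<in> X" and y: "osc_integral (A i) (E i) j k y" for i j k y
  proof -
    obtain \<Psi> where \<Psi>: "\<And>z. z \<in> strip w \<Longrightarrow> (\<Psi> has_field_derivative G i z) (at z)"
      by (rule strip_primitive[OF holomorphic_on_subset[OF G(3)[OF i] sub(3)]]) (rule that)
    \<comment> \<open>The continuation of \<open>E i\<close>, by
      \<open>phase_eq_exp\<close>.\<close>
    define \<Phi> where "\<Phi> = (\<lambda>z. E i 0 * exp (\<i> * (\<Psi> z - \<Psi> 0)))"
    have E\<Phi>: "\<Phi> (of_real t) = E i t" for t
    proof -
      have \<Psi>t: "((\<lambda>t. \<Psi> (of_real t)) has_vector_derivative of_real (g i t)) (at t)" for t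
        using has_vector_derivative_real_field[OF \<Psi>[OF of_real_in_strip[OF w(1)]], of t]
        by (simp only: G(5)[OF i])
      have "E i t = E i 0 * exp (\<i> * (\<Psi> (of_real t) - \<Psi> (of_real 0)))"
        by (intro phase_eq_exp[OF E(1)[OF i] _ \<Psi>t] E(4)[OF i])
      then show ?thesis
        unfolding \<Phi>_def by (simp only: of_real_0)
    qed
    define H where "H = (\<lambda>z. h i z * (\<Phi> z ^ k * exp (\<i> * (2 * of_nat j * z))))"
    have "\<Psi> holomorphic_on strip w"
      using \<Psi> by (auto simp: holomorphic_on_open[OF open_strip])
    then have Hhol: "H holomorphic_on strip w"
      unfolding H_def \<Phi>_def
      by (intro holomorphic_intros) (auto intro: holomorphic_on_subset[OF h(3)[OF i] sub(1)])
    have shift: "z + 2 * of_real pi \<in> strip w" if "z \<in> strip w" for z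
      using that by (simp add: strip_def)
    have exp_shift: "exp (\<i> * (2 * of_nat j * (z + 2 * of_real pi))) = exp (\<i> * (2 * of_nat j * z))" for z
    proof -
      have "exp (\<i> * (2 * of_nat j * (z + 2 * of_real pi))) =
          exp (\<i> * (2 * of_nat j * z)) * exp (of_nat (2 * j) * (2 * of_real pi * \<i>))"
        by (simp add: exp_add[symmetric] algebra_simps)
      also have "exp (of_nat (2 * j) * (2 * of_real pi * \<i>)) = 1"
        unfolding exp_of_nat_mult by simp
      finally show ?thesis by simp
    qed
    \<comment> \<open>Periodicity is known on the real axis and propagates to the strip by the
      identity theorem.\<close>
    have Hper: "H (z + 2 * of_real pi) = H z" if "z \<in> strip w" for z
    proof -
      have "H (z + 2 * of_real pi) - H z = 0"
      proof (rule analytic_continuation[of "\<lambda>z. H (z + 2 * of_real pi) - H z" "strip w" "range of_real" 0])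
        show "(\<lambda>z. H (z + 2 * of_real pi) - H z) holomorphic_on strip w"
        proof -
          have "(H \<circ> (\<lambda>z. z + 2 * of_real pi)) holomorphic_on strip w"
            by (rule holomorphic_on_compose_gen[OF _ Hhol]) (auto intro!: holomorphic_intros shift)
          then show ?thesis
            unfolding o_def by (intro holomorphic_on_diff Hhol)
        qed
        show "connected (strip w)" by (simp add: convex_connected convex_strip)
        show "(0::complex) islimpt range of_real"
        proof (unfold islimpt_approachable, intro allI impI)
          fix r :: real assume "r > 0"
          then show "\<exists>x'\<in>range of_real. x' \<noteq> (0::complex) \<and> dist x' 0 < r"
            by (intro bexI[of _ "of_real (r / 2)"] conjI rangeI) auto
        qed
        show "H (u + 2 * of_real pi) - H u = 0" if "u \<in> range of_real" for u
        proof -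
          obtain t where t: "u = of_real t" using \<open>u \<in> range of_real\<close> by auto
          have "u + 2 * of_real pi = of_real (t + 2 * pi)" by (simp add: t)
          then have "h i (u + 2 * of_real pi) = h i u" "\<Phi> (u + 2 * of_real pi) = \<Phi> u"
            by (simp_all only: h(5)[OF i] E\<Phi> t per[OF i] E(3)[OF i])
          then show ?thesis by (simp add: H_def exp_shift)
        qed
      qed (use that w(1) of_real_in_strip[OF w(1)] of_real_in_strip[OF w(1), of 0] open_strip in auto)
      then show ?thesis by simp
    qed
    obtain P where P: "\<And>z. z \<in> strip w \<Longrightarrow> (P has_field_derivative H z) (at z)"
      using strip_primitive[OF Hhol] by blast
    \<comment> \<open>This takes the place of Cauchy's theorem on a rectangle: the integral of H
      over a horizontal period is an increment of the primitive, and periodicity of H makes this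
      increment the same at every height.\<close>
    have "\<exists>c. \<forall>z\<in>strip w. P (z + 2 * of_real pi) - P z = c"
    proof (rule has_field_derivative_zero_constant[OF convex_strip])
      fix z assume z: "z \<in> strip w"
      have "((\<lambda>z. P (z + 2 * of_real pi)) has_field_derivative H (z + 2 * of_real pi)) (at z)"
        using P[OF shift[OF z]] by (simp add: DERIV_shift)
      from DERIV_diff[OF this P[OF z]]
      show "((\<lambda>z. P (z + 2 * of_real pi) - P z) has_field_derivative 0) (at z within strip w)"
        by (simp add: Hper[OF z] has_field_derivative_at_within)
    qed
    then obtain c where c: "\<And>z. z \<in> strip w \<Longrightarrow> P (z + 2 * of_real pi) - P z = c" by blast
    have "((\<lambda>t. H (of_real t)) has_integral (P (of_real (pi / 4 + 2 * pi)) - P (of_real (pi / 4))))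
        {pi / 4..pi / 4 + 2 * pi}"
      by (rule fundamental_theorem_of_calculus)
         (auto intro!: has_vector_derivative_real_field P of_real_in_strip w(1))
    moreover have "H (of_real t) = of_real (A i t) * (E i t ^ k * exp (\<i> * of_real (2 * real j * t)))" for t
      by (simp add: H_def E\<Phi> h(5)[OF i])
    ultimately have "y = P (of_real (pi / 4 + 2 * pi)) - P (of_real (pi / 4))"
      using y[unfolded osc_integral_def] has_integral_unique by auto
    also have "\<dots> = c"
      using c[OF of_real_in_strip[OF w(1)], of "pi / 4"] by simp
    also have "c = P (\<i> * of_real \<eta> + 2 * of_real pi) - P (\<i> * of_real \<eta>)"
      using c[of "\<i> * of_real \<eta>"] \<eta> by (simp add: strip_def)
    also have "cmod \<dots> \<le> (B * exp (- (2 * \<eta>) * (real j - p * real k))) *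
        cmod ((\<i> * of_real \<eta> + 2 * of_real pi) - \<i> * of_real \<eta>)"
    proof (rule field_differentiable_bound[of "{z. Im z = \<eta>}" P H])
      have "{z. Im z = \<eta>} = {z. inner \<i> z = \<eta>}" by (auto simp: inner_complex_def)
      then show "convex {z. Im z = \<eta>}" by (simp only: convex_hyperplane)
      fix z assume z: "z \<in> {z. Im z = \<eta>}"
      then have zw: "z \<in> strip w" using \<eta> by (simp add: strip_def)
      show "(P has_field_derivative H z) (at z within {z. Im z = \<eta>})"
        using P[OF zw] by (rule has_field_derivative_at_within)
      have "cmod (\<Psi> z - \<Psi> (of_real (Re z))) \<le> 2 * p * cmod (z - of_real (Re z))"
        by (rule field_differentiable_bound[OF convex_strip has_field_derivative_at_within[OF \<Psi>] Gp[OF i]])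
           (use zw of_real_in_strip[OF w(1)] in auto)
      also have "cmod (z - of_real (Re z)) = \<eta>"
        using z \<eta>(1) by (simp add: cmod_def)
      finally have \<Psi>b: "cmod (\<i> * (\<Psi> z - \<Psi> (of_real (Re z)))) \<le> 2 * p * \<eta>"
        by (simp add: norm_mult)
      have "E i (Re z) = E i 0 * exp (\<i> * (\<Psi> (of_real (Re z)) - \<Psi> 0))"
        using E\<Phi>[of "Re z"] by (simp add: \<Phi>_def)
      then have "\<Phi> z = E i (Re z) * exp (\<i> * (\<Psi> z - \<Psi> (of_real (Re z))))"
        by (simp add: \<Phi>_def mult.assoc exp_add[symmetric] algebra_simps)
      then have "cmod (\<Phi> z) \<le> exp (2 * p * \<eta>)"
        using norm_exp[of "\<i> * (\<Psi> z - \<Psi> (of_real (Re z)))"] \<Psi>b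
        by (simp only: norm_mult E(2)[OF i] mult_1) (meson exp_le_cancel_iff order_trans)
      then have "cmod (\<Phi> z) ^ k \<le> exp (2 * p * \<eta>) ^ k"
        by (intro power_mono) auto
      moreover have "cmod (exp (\<i> * (2 * of_nat j * z))) = exp (- (2 * \<eta> * real j))"
        using z by (simp add: mult.commute mult.left_commute)
      ultimately have "cmod (H z) \<le> B * (exp (2 * p * \<eta>) ^ k * exp (- (2 * \<eta> * real j)))"
        unfolding H_def norm_mult norm_power
        by (intro mult_mono h(4)[OF i]) (use sub zw h(2) in auto)
      also have "\<dots> = B * exp (- (2 * \<eta>) * (real j - p * real k))"
        by (simp add: exp_of_nat_mult[symmetric] exp_add[symmetric] algebra_simps)
      finally show "cmod (H z) \<le> B * exp (- (2 * \<eta>) * (real j - p * real k))" .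
    qed auto
    finally show ?thesis by (simp add: mult_ac)
  qed
  then show ?thesis
    using \<eta> h(2) by (intro exI[of _ "B * (2 * pi)"] exI[of _ "2 * \<eta>"] conjI) auto
qed

section \<open>One notion of regularity for both distortion conditions\<close>

definition regular_family :: "dcond \<Rightarrow> 'i set \<Rightarrow> ('i \<Rightarrow> real \<Rightarrow> real) \<Rightarrow> bool" where
  "regular_family D X f = (case D of DD r \<Rightarrow> smooth_family r X f | AD \<delta> \<Rightarrow> analytic_family X f)"

lemma regular_family_cong:
  assumes "regular_family D X f" "\<And>i t. i \<in> X \<Longrightarrow> f i t = g i t"
  shows "regular_family D X g"
  using assms smooth_family_cong analytic_family_cong
  by (cases D) (fastforce simp: regular_family_def)+

lemma regular_family_const:
  assumes "\<And>i. i \<in> X \<Longrightarrow> \<bar>c i\<bar> \<le> B"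
  shows "regular_family D X (\<lambda>i t. c i)"
  using smooth_family_const[OF assms] analytic_family_const[OF assms]
  by (cases D) (auto simp: regular_family_def)

lemma regular_family_add:
  assumes "regular_family D X f" "regular_family D X g"
  shows "regular_family D X (\<lambda>i t. f i t + g i t)"
  using assms smooth_family_add analytic_family_add
  by (cases D) (auto simp: regular_family_def)

lemma regular_family_mult:
  assumes "regular_family D X f" "regular_family D X g"
  shows "regular_family D X (\<lambda>i t. f i t * g i t)"
  using assms smooth_family_mult analytic_family_mult
  by (cases D) (auto simp: regular_family_def)

lemma regular_family_inverse_sqrt:
  assumes "regular_family D X f" "c > 0" "\<And>i t. i \<in> X \<Longrightarrow> c \<le> f i t"
  shows "regular_family D X (\<lambda>i t. 1 / sqrt (f i t))"
  using assms(1) smooth_family_inverse_sqrt[OF _ assms(2,3)] analytic_family_inverse_sqrt[OF _ assms(2,3)]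
  by (cases D) (auto simp: regular_family_def)

lemma regular_family_Un:
  assumes "regular_family D X f" "regular_family D Y f"
  shows "regular_family D (X \<union> Y) f"
  using assms smooth_family_Un analytic_family_Un
  by (cases D) (auto simp: regular_family_def)

lemma analytic_family_subset: "analytic_family X f \<Longrightarrow> Y \<subseteq> X \<Longrightarrow> analytic_family Y f"
  unfolding analytic_family_def by (meson subsetD)

lemma regular_family_subset:
  assumes "regular_family D X f" "Y \<subseteq> X"
  shows "regular_family D Y f"
  using assms smooth_family_subset analytic_family_subset
  by (cases D) (auto simp: regular_family_def)

lemma regular_family_sin: "regular_family D X (\<lambda>i. sin)"
  using smooth_family_sin_cos analytic_family_sin
  by (cases D) (auto simp: regular_family_def)

lemma regular_family_cos: "regular_family D X (\<lambda>i. cos)"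
  using smooth_family_sin_cos analytic_family_cos
  by (cases D) (auto simp: regular_family_def)

text \<open>Validity enters because a smooth family of order 0 is merely bounded.\<close>

lemma regular_family_continuous:
  assumes "regular_family D X f" "dcond_valid D" "i \<in> X"
  shows "continuous_on UNIV (f i)"
proof (cases D)
  case (DD r)
  then obtain n where "r = Suc n"
    using assms(2) by (cases r) (auto simp: dcond_valid_def)
  with DD assms show ?thesis by (simp add: regular_family_def)
next
  case (AD \<delta>)
  with assms analytic_family_continuous show ?thesis by (auto simp: regular_family_def)
qed

text \<open>The total phase has derivative 2 * j + k * g = 2 * j * m with m = 1 + k * g / (2 * j).
  Since k / j is at most 1 / p and |g| at most 2 * q, m is at least 1 - q / p, so 2 * j plays the
  role of \<open>N\<close> in \<open>nonstationary_phase\<close>.\<close>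

lemma smooth_oscillation:
  fixes A g :: "'i \<Rightarrow> real \<Rightarrow> real" and E :: "'i \<Rightarrow> real \<Rightarrow> complex"
  assumes "smooth_family r X A" "smooth_family r X g"
    and ph: "phase_family X g E q" and p: "p > q" "p > 0"
    and A_per: "\<And>i t. i \<in> X \<Longrightarrow> A i (t + 2 * pi) = A i t"
  shows "\<exists>C>0. \<forall>i\<in>X. \<forall>j k. \<forall>y. k = 0 \<or> real j / real k > p \<longrightarrow>
    osc_integral (A i) (E i) j k y \<longrightarrow> cmod y \<le> C * (1 + \<bar>real j - p * real k\<bar>) powr (- real r)"
proof -
  note gq = phase_familyD(4)[OF ph] and E = phase_familyD(1-3,6)[OF ph]
    and per = A_per phase_familyD(5)[OF ph]
  define Y where "Y = {(i, j, k::nat). i \<in> X \<and> 0 < (j::nat) \<and> (k = 0 \<or> real j / real k > p)}"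
  define c where "c = (\<lambda>(i::'i, j, k). real k / (2 * real j))"
  define m where "m = (\<lambda>y t. 1 + c y * g (fst y) t)"
  define F where "F = (\<lambda>(i, j, k) t. E i t ^ k * exp (\<i> * of_real (2 * real j * t)))"
  have pk: "p * real k \<le> real j" if "k = 0 \<or> real j / real k > p" for j k
    using that p(2) by (cases "k = 0") (auto simp: field_simps)
  have c: "0 \<le> c y" "c y \<le> 1 / (2 * p)" if yY: "y \<in> Y" for y
  proof -
    obtain i j k where y: "y = (i, j, k)" "j > 0" "p * real k \<le> real j"
      using yY pk by (auto simp: Y_def)
    then show "0 \<le> c y" "c y \<le> 1 / (2 * p)"
      using p(2) by (auto simp: c_def field_simps)
  qed
  have "smooth_family r Y (\<lambda>y. A (fst y))"
    by (rule smooth_family_reindex[OF assms(1)]) (auto simp: Y_def)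
  moreover have "smooth_family r Y m"
    unfolding m_def
  proof (intro smooth_family_add smooth_family_mult smooth_family_reindex[OF assms(2)])
    show "smooth_family r Y (\<lambda>i t. 1)" by (rule smooth_family_const[of _ _ 1]) auto
    show "smooth_family r Y (\<lambda>i t. c i)" by (rule smooth_family_const[of _ _ "1 / (2 * p)"]) (use c in auto)
  qed (auto simp: Y_def)
  moreover have "1 - q / p > 0" using p by simp
  moreover have "1 - q / p \<le> m y t" if y: "y \<in> Y" for y t
  proof -
    have "fst y \<in> X" using y by (auto simp: Y_def)
    have "\<bar>c y * g (fst y) t\<bar> \<le> 1 / (2 * p) * (2 * q)"
      unfolding abs_mult using c[OF y] gq[OF \<open>fst y \<in> X\<close>, of t] p(2)
      by (intro mult_mono) auto
    also have "\<dots> = q / p" by simp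
    finally show ?thesis by (simp add: m_def abs_le_iff)
  qed
  moreover have "(case y of (i, j, k) \<Rightarrow> 2 * real j) > 0" if "y \<in> Y" for y
    using that by (auto simp: Y_def)
  moreover have "continuous_on UNIV (F y)" "\<And>t. cmod (F y t) = 1" "\<And>t. F y (t + 2 * pi) = F y t"
    if yY: "y \<in> Y" for y
  proof -
    obtain i j k where y: "y = (i, j, k)" "i \<in> X" using yY by (auto simp: Y_def)
    show "continuous_on UNIV (F y)"
      unfolding F_def y using E(1)[OF y(2)] by (auto intro!: continuous_intros)
    fix t
    show "cmod (F y t) = 1" by (simp add: F_def y norm_mult norm_power E(2)[OF y(2)])
    have "exp (\<i> * of_real (2 * real j * (t + 2 * pi))) =
        exp (\<i> * of_real (2 * real j * t)) * exp (of_nat (2 * j) * (2 * of_real pi * \<i>))"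
      by (simp add: exp_add[symmetric] algebra_simps)
    also have "exp (of_nat (2 * j) * (2 * of_real pi * \<i>)) = 1"
      unfolding exp_of_nat_mult by simp
    finally show "F y (t + 2 * pi) = F y t"
      by (simp add: F_def y E(3)[OF y(2)])
  qed
  moreover have "(F y has_vector_derivative \<i> * of_real ((case y of (i, j, k) \<Rightarrow> 2 * real j) * m y t) * F y t) (at t)"
    if yY: "y \<in> Y" and t: "sin (2 * t) \<noteq> 0" for y t
  proof -
    obtain i j k where y: "y = (i, j, k)" "i \<in> X" "j > 0" using yY by (auto simp: Y_def)
    define a where "a = \<i> * of_real (2 * real j)"
    have e: "((\<lambda>t. exp (\<i> * of_real (2 * real j * t))) has_vector_derivative a * exp (\<i> * of_real (2 * real j * t))) (at t)"
    proof -
      have "((\<lambda>z. exp (a * z)) has_field_derivative a * exp (a * of_real t)) (at (of_real t))"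
        by (auto intro!: derivative_eq_intros)
      from has_vector_derivative_real_field[OF this] show ?thesis
        by (simp add: a_def mult.assoc)
    qed
    have pw: "((\<lambda>t. E i t ^ k) has_vector_derivative (of_nat k * (\<i> * of_real (g i t))) * E i t ^ k) (at t)"
    proof -
      have "((\<lambda>z. z ^ k) has_field_derivative of_nat k * E i t ^ (k - 1)) (at (E i t))"
        by (auto intro!: derivative_eq_intros)
      from field_vector_diff_chain_at[OF E(4)[OF y(2) t] this]
      have "((\<lambda>t. E i t ^ k) has_vector_derivative \<i> * of_real (g i t) * E i t * (of_nat k * E i t ^ (k - 1))) (at t)"
        by (simp add: o_def)
      moreover have "\<i> * of_real (g i t) * E i t * (of_nat k * E i t ^ (k - 1)) =
          (of_nat k * (\<i> * of_real (g i t))) * E i t ^ k"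
        by (cases k) (auto simp: algebra_simps)
      ultimately show ?thesis by (simp only:)
    qed
    have "(F y has_vector_derivative E i t ^ k * (a * exp (\<i> * of_real (2 * real j * t))) +
        (of_nat k * (\<i> * of_real (g i t))) * E i t ^ k * exp (\<i> * of_real (2 * real j * t))) (at t)"
      unfolding F_def y case_prod_conv by (rule has_vector_derivative_mult[OF pw e])
    moreover have "E i t ^ k * (a * exp (\<i> * of_real (2 * real j * t))) +
        (of_nat k * (\<i> * of_real (g i t))) * E i t ^ k * exp (\<i> * of_real (2 * real j * t)) =
        \<i> * of_real ((case y of (i, j, k) \<Rightarrow> 2 * real j) * m y t) * F y t"
      using y(3) by (simp add: F_def y m_def c_def a_def field_simps)
    ultimately show ?thesis by (simp only:)
  qed
  ultimately have "\<exists>C. \<forall>y\<in>Y. \<forall>s. ((\<lambda>t. of_real (A (fst y) t) * F y t) has_integral s)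
      {pi / 4..pi / 4 + 2 * pi} \<longrightarrow> cmod s \<le> C / (case y of (i, j, k) \<Rightarrow> 2 * real j) ^ r"
    by (rule nonstationary_phase) (auto simp: per Y_def m_def)
  then obtain C where C: "\<And>i j k s. (i, j, k) \<in> Y \<Longrightarrow> ((\<lambda>t. of_real (A i t) * F (i, j, k) t) has_integral s)
      {pi / 4..pi / 4 + 2 * pi} \<Longrightarrow> cmod s \<le> C / (2 * real j) ^ r"
    by fastforce
  obtain B where B: "B > 0" "\<And>i t. i \<in> X \<Longrightarrow> \<bar>A i t\<bar> \<le> B"
    using smooth_family_bounded[OF assms(1)] by metis
  define C' where "C' = max C (B * (2 * pi))"
  have "C' > 0" using B by (auto simp: C'_def less_max_iff_disj)
  have "cmod y \<le> C' * (1 + \<bar>real j - p * real k\<bar>) powr (- real r)"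
    if i: "i \<in> X" and jk: "k = 0 \<or> real j / real k > p"
    and y: "osc_integral (A i) (E i) j k y" for i j k y
  proof (cases "j = 0")
    case True
    \<comment> \<open>For k > 0 the condition would read 0 > p. With j = k = 0 the right-hand side
      is just the constant \<open>C'\<close>.\<close>
    then have "k = 0" using jk p(2) by auto
    have "cmod y \<le> B * measure lborel {pi / 4..pi / 4 + 2 * pi}"
      by (rule has_integral_bound_real[OF _ finite.emptyI y[unfolded osc_integral_def]])
         (use B i in \<open>auto simp: norm_mult norm_power E(2)\<close>)
    then have "cmod y \<le> C'" by (simp add: C'_def)
    then show ?thesis using True \<open>k = 0\<close> by simp
  next
    case False
    then have "cmod y \<le> C / (2 * real j) ^ r"
      using C[of i j k y] i jk y by (simp add: Y_def F_def osc_integral_def)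
    also have "\<dots> \<le> C' / (2 * real j) ^ r"
      by (intro divide_right_mono) (auto simp: C'_def)
    \<comment> \<open>Here 0 <= j - p * k <= j and j >= 1, so the denominator 2 * j is large enough
      to replace it by 1 + |j - p * k| without a new constant.\<close>
    also have "\<dots> \<le> C' / (1 + \<bar>real j - p * real k\<bar>) ^ r"
    proof (intro divide_left_mono power_mono mult_pos_pos)
      have "p * real k \<ge> 0" using p(2) by simp
      with pk[OF jk] have "\<bar>real j - p * real k\<bar> \<le> real j" by linarith
      then show "1 + \<bar>real j - p * real k\<bar> \<le> 2 * real j"
        using False by linarith
    qed (use False \<open>C' > 0\<close> in auto)
    also have "\<dots> = C' * (1 + \<bar>real j - p * real k\<bar>) powr (- real r)"
      by (simp add: powr_minus powr_realpow add_pos_nonneg divide_inverse)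
    finally show ?thesis .
  qed
  with \<open>C' > 0\<close> show ?thesis by blast
qed

lemma regular_oscillation:
  fixes A g :: "'i \<Rightarrow> real \<Rightarrow> real" and E :: "'i \<Rightarrow> real \<Rightarrow> complex"
  assumes "dcond_valid D" "regular_family D X A" "regular_family D X g"
    and ph: "phase_family X g E q" and p: "p > q" "p > 0"
    and A_per: "\<And>i t. i \<in> X \<Longrightarrow> A i (t + 2 * pi) = A i t"
  shows "\<exists>K\<in>kappa D. \<forall>i\<in>X. \<forall>j k. \<forall>y. k = 0 \<or> real j / real k > p \<longrightarrow>
    osc_integral (A i) (E i) j k y \<longrightarrow> cmod y \<le> K \<bar>real j - p * real k\<bar>"
proof (cases D)
  case (DD r)
  have reg: "smooth_family r X A" "smooth_family r X g"
    using assms(2,3) by (simp_all add: DD regular_family_def)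
  obtain C where "C > 0" and C: "\<forall>i\<in>X. \<forall>j k. \<forall>y. k = 0 \<or> real j / real k > p \<longrightarrow>
    osc_integral (A i) (E i) j k y \<longrightarrow> cmod y \<le> C * (1 + \<bar>real j - p * real k\<bar>) powr (- real r)"
    by (atomize_elim, rule smooth_oscillation[OF reg ph p A_per])
  have K: "(\<lambda>x. C * (1 + x) powr (- real r)) \<in> kappa D"
    using \<open>C > 0\<close> by (auto simp: kappa_def DD)
  show ?thesis by (rule bexI[OF _ K]) (rule C)
next
  case (AD \<delta>)
  have reg: "analytic_family X A" "analytic_family X g" "\<delta> > 0"
    using assms(1-3) by (simp_all add: AD regular_family_def dcond_valid_def)
  obtain C \<zeta> where "C > 0" "0 < \<zeta>" "\<zeta> \<le> \<delta>" and C: "\<forall>i\<in>X. \<forall>j k. \<forall>y.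
    osc_integral (A i) (E i) j k y \<longrightarrow> cmod y \<le> C * exp (- \<zeta> * (real j - p * real k))"
    by (atomize_elim, rule analytic_oscillation[OF reg(1,2) ph p(1) reg(3) A_per])
  have K: "(\<lambda>x. C * exp (- \<zeta> * x)) \<in> kappa D"
    using \<open>C > 0\<close> \<open>0 < \<zeta>\<close> \<open>\<zeta> \<le> \<delta>\<close> by (auto simp: kappa_def AD)
  have eq: "\<bar>real j - p * real k\<bar> = real j - p * real k" if "k = 0 \<or> real j / real k > p" for j k
    using that by (cases "k = 0") (auto simp: field_simps)
  show ?thesis
  proof (rule bexI[OF _ K], intro ballI allI impI)
    fix i j k y
    assume "i \<in> X" "k = 0 \<or> real j / real k > p"
      "osc_integral (A i) (E i) j k y"
    then show "cmod y \<le> C * exp (- \<zeta> * \<bar>real j - p * real k\<bar>)"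
      unfolding eq[OF \<open>k = 0 \<or> real j / real k > p\<close>] using C by blast
  qed
qed

subsection \<open>Taylor quotients and regularity of the branches\<close>

lemma MVT_within_interval:
  fixes u u' :: "real \<Rightarrow> real"
  assumes "\<And>z. z \<in> {a..b} \<Longrightarrow> (u has_real_derivative u' z) (at z within {a..b})" "x \<in> {a..b}" "y \<in> {a..b}"
  shows "\<exists>\<xi>\<in>{min x y..max x y}. u y - u x = (y - x) * u' \<xi>"
proof -
  have *: "\<exists>\<xi>\<in>{x..y}. u y - u x = (y - x) * u' \<xi>" if "x \<le> y" "x \<in> {a..b}" "y \<in> {a..b}" for x y
  proof -
    have "\<exists>\<xi>\<in>{x..y}. u y - u x = u' \<xi> * (y - x)"
    proof (rule mvt_very_simple[OF that(1)])
      fix z assume "x \<le> z" "z \<le> y"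
      then show "(u has_derivative (*) (u' z)) (at z within {x..y})"
        using assms(1)[of z] that(2,3) unfolding has_field_derivative_def
        by (auto intro: has_derivative_subset)
    qed
    then show ?thesis by (simp add: mult.commute)
  qed
  show ?thesis
  proof (cases "x \<le> y")
    case True
    with *[OF True assms(2,3)] show ?thesis by (simp add: min_def max_def)
  next
    case False
    then obtain \<xi> where "\<xi> \<in> {y..x}" "u x - u y = (x - y) * u' \<xi>"
      using *[of y x] assms(2,3) by auto
    with False show ?thesis
      by (intro bexI[of _ \<xi>]) (auto simp: algebra_simps)
  qed
qed

text \<open>If \<open>d m\<close> is the m-th derivative of u, this is the n-th derivative in x of
  the difference quotient (u e - u x) / (e - x): n! times a Taylor remainder expanded at x, over (e
  - x) ^ (n + 1). For continuous derivatives it is the integral over s in [0, 1] of the (n + 1)-st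
  derivative at x + s * (e - x), weighted by (1 - s) ^ n, which explains the value at x = e. The
  closed form avoids integrating a top derivative that may be discontinuous.\<close>

definition taylor_quotient :: "(nat \<Rightarrow> real \<Rightarrow> real) \<Rightarrow> real \<Rightarrow> nat \<Rightarrow> real \<Rightarrow> real" where
  "taylor_quotient d e n x = (if x = e then d (Suc n) e / (real n + 1)
     else fact n * (d 0 e - (\<Sum>m\<le>n. d m x * (e - x) ^ m / fact m)) / (e - x) ^ Suc n)"

text \<open>The sum telescopes: differentiating the power in one term cancels what differentiating
  the coefficient of the previous term produced.\<close>

lemma taylor_sum_deriv:
  assumes "\<And>m. m \<le> n \<Longrightarrow> (d m has_real_derivative d (Suc m) x) (at x within S)"
  shows "((\<lambda>x. \<Sum>m\<le>n. d m x * (e - x) ^ m / fact m) has_real_derivative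
    d (Suc n) x * (e - x) ^ n / fact n) (at x within S)"
  using assms
proof (induction n)
  case 0
  then show ?case by simp
next
  case (Suc n)
  have "((\<lambda>x. d (Suc n) x * (e - x) ^ Suc n / fact (Suc n)) has_real_derivative
      (d (Suc (Suc n)) x * (e - x) ^ Suc n + (real (Suc n) * (e - x) ^ n * (0 - 1)) * d (Suc n) x) / fact (Suc n))
      (at x within S)"
    by (intro DERIV_cdivide DERIV_mult' DERIV_power_Suc DERIV_diff DERIV_const DERIV_ident Suc.prems
        derivative_eq_intros) (auto intro!: Suc.prems derivative_eq_intros)
  moreover have "(d (Suc (Suc n)) x * (e - x) ^ Suc n + (real (Suc n) * (e - x) ^ n * (0 - 1)) * d (Suc n) x) / fact (Suc n)
      = d (Suc (Suc n)) x * (e - x) ^ Suc n / fact (Suc n) - d (Suc n) x * (e - x) ^ n / fact n"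
  proof -
    have "real (Suc n) * y / fact (Suc n) = y / fact n" for y :: real
      by (simp add: fact_Suc)
    from this[of "(e - x) ^ n * d (Suc n) x"] show ?thesis
      by (simp add: diff_divide_distrib mult_ac del: fact_Suc of_nat_Suc)
  qed
  ultimately have "((\<lambda>x. d (Suc n) x * (e - x) ^ Suc n / fact (Suc n)) has_real_derivative
      d (Suc (Suc n)) x * (e - x) ^ Suc n / fact (Suc n) - d (Suc n) x * (e - x) ^ n / fact n) (at x within S)"
    by (simp only:)
  from DERIV_add[OF Suc.IH this] Suc.prems show ?case by simp
qed

text \<open>As a function of x the remainder vanishes at e, and by telescoping its derivative
  consists of the top term alone. The mean value theorem bounds the remainder, and the factor n! of
  the quotient cancels the 1 / n! of that term.\<close>

lemma taylor_quotient_bound: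
  assumes d: "\<And>m x. m \<le> n \<Longrightarrow> x \<in> {-1..1} \<Longrightarrow> (d m has_real_derivative d (Suc m) x) (at x within {-1..1})"
    and K: "\<And>x. x \<in> {-1..1} \<Longrightarrow> \<bar>d (Suc n) x\<bar> \<le> K" and "e \<in> {-1..1}" "x \<in> {-1..1}"
  shows "\<bar>taylor_quotient d e n x\<bar> \<le> K"
proof (cases "x = e")
  case True
  have "\<bar>d (Suc n) e\<bar> / (real n + 1) \<le> \<bar>d (Suc n) e\<bar> / 1"
    by (intro divide_left_mono) auto
  also have "\<dots> \<le> K" using K[OF assms(3)] by simp
  finally show ?thesis using True by (simp add: taylor_quotient_def)
next
  case False
  define N where "N = (\<lambda>x. d 0 e - (\<Sum>m\<le>n. d m x * (e - x) ^ m / fact m))"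
  have "(N has_real_derivative - (d (Suc n) z * (e - z) ^ n / fact n)) (at z within {-1..1})"
    if z: "z \<in> {-1..1}" for z
  proof -
    have "((\<lambda>x. \<Sum>m\<le>n. d m x * (e - x) ^ m / fact m) has_real_derivative
        d (Suc n) z * (e - z) ^ n / fact n) (at z within {-1..1})"
      by (rule taylor_sum_deriv) (use d z in auto)
    from DERIV_diff[OF DERIV_const[of "d 0 e"] this] show ?thesis
      unfolding N_def by simp
  qed
  from MVT_within_interval[OF this assms(4,3)] obtain \<xi> where \<xi>: "\<xi> \<in> {min x e..max x e}"
    "N e - N x = (e - x) * - (d (Suc n) \<xi> * (e - \<xi>) ^ n / fact n)" by blast
  have "(\<Sum>m\<le>n. d m e * (e - e) ^ m / fact m) = (\<Sum>m\<le>n. if m = 0 then d 0 e else 0)"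
    by (rule sum.cong) (auto simp: power_0_left)
  also have "\<dots> = d 0 e" by simp
  finally have "N e = 0" by (simp add: N_def)
  with \<xi>(2) have Nx: "N x = (e - x) * (d (Suc n) \<xi> * (e - \<xi>) ^ n / fact n)" by simp
  have "\<bar>e - \<xi>\<bar> \<le> \<bar>e - x\<bar>" "\<xi> \<in> {-1..1}" using \<xi>(1) assms(3,4) by auto
  then have "\<bar>d (Suc n) \<xi>\<bar> * \<bar>e - \<xi>\<bar> ^ n \<le> K * \<bar>e - x\<bar> ^ n"
    using K[of \<xi>] by (intro mult_mono power_mono) auto
  then have "\<bar>e - x\<bar> * (\<bar>d (Suc n) \<xi>\<bar> * \<bar>e - \<xi>\<bar> ^ n) \<le> \<bar>e - x\<bar> * (K * \<bar>e - x\<bar> ^ n)"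
    by (intro mult_left_mono) auto
  then have "fact n * \<bar>N x\<bar> \<le> K * \<bar>e - x\<bar> ^ Suc n"
    unfolding Nx by (simp add: abs_mult power_abs mult_ac)
  moreover have "taylor_quotient d e n x = fact n * N x / (e - x) ^ Suc n"
    using False by (simp add: taylor_quotient_def N_def)
  ultimately show ?thesis
    using False by (simp add: abs_mult power_abs[symmetric] pos_divide_le_eq)
qed

text \<open>In the application e is 1 or -1, so x = e never lies in the open interval on which
  \<open>smooth_family_compose_cos\<close> asks for derivatives.\<close>

lemma taylor_quotient_deriv:
  assumes "\<And>m. m \<le> n \<Longrightarrow> (d m has_real_derivative d (Suc m) x) (at x)" "x \<noteq> e"
  shows "(taylor_quotient d e n has_real_derivative taylor_quotient d e (Suc n) x) (at x)"
proof -
  define R where "R = (\<lambda>n x. \<Sum>m\<le>n. d m x * (e - x) ^ m / fact m)"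
  define u where "u = e - x"
  have u: "u \<noteq> 0" using assms(2) by (simp add: u_def)
  have R: "(R n has_real_derivative d (Suc n) x * u ^ n / fact n) (at x)"
    unfolding R_def u_def by (rule taylor_sum_deriv) (use assms(1) in auto)
  have den: "((\<lambda>x. (e - x) ^ Suc n) has_real_derivative - (real (Suc n) * u ^ n)) (at x)"
    unfolding u_def by (rule derivative_eq_intros refl)+ auto
  have num: "((\<lambda>x. fact n * (d 0 e - R n x)) has_real_derivative - (d (Suc n) x * u ^ n)) (at x)"
    using DERIV_cmult[OF DERIV_diff[OF DERIV_const R], of "fact n"] by simp
  have "((\<lambda>x. fact n * (d 0 e - R n x) / (e - x) ^ Suc n) has_real_derivative
      (- (d (Suc n) x * u ^ n) * u ^ Suc n - fact n * (d 0 e - R n x) * - (real (Suc n) * u ^ n)) / (u ^ Suc n * u ^ Suc n)) (at x)"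
    using DERIV_divide[OF num den] u unfolding u_def by simp
  also have "(- (d (Suc n) x * u ^ n) * u ^ Suc n - fact n * (d 0 e - R n x) * - (real (Suc n) * u ^ n)) / (u ^ Suc n * u ^ Suc n)
     = fact (Suc n) * (d 0 e - R (Suc n) x) / u ^ Suc (Suc n)"
  proof -
    have "R (Suc n) x = R n x + d (Suc n) x * u ^ Suc n / fact (Suc n)"
      by (simp add: R_def u_def)
    then have "fact (Suc n) * (d 0 e - R (Suc n) x) = fact (Suc n) * (d 0 e - R n x) - d (Suc n) x * u ^ Suc n"
      by (simp add: right_diff_distrib distrib_left del: fact_Suc power_Suc)
    then have eq1: "fact (Suc n) * (d 0 e - R (Suc n) x) = real (Suc n) * (fact n * (d 0 e - R n x)) - d (Suc n) x * (u ^ n * u)"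
      by (simp only: fact_Suc power_Suc2 mult.assoc)
    have "(- (a * w) * (w * u) - b * - (c * w)) / (w * u * (w * u)) = (c * b - a * (w * u)) / (w * u * u)"
      if "w \<noteq> 0" for a b c w
    proof -
      have "- (a * w) * (w * u) - b * - (c * w) = w * (c * b - a * (w * u))" by (simp add: algebra_simps)
      then show ?thesis using that u by (simp add: mult.assoc)
    qed
    from this[of "u ^ n" "d (Suc n) x" "fact n * (d 0 e - R n x)" "real (Suc n)"] u
    show ?thesis unfolding eq1 power_Suc2 by simp
  qed
  also have "\<dots> = taylor_quotient d e (Suc n) x"
    using assms(2) by (simp add: taylor_quotient_def R_def u_def del: fact_Suc power_Suc)
  finally have *: "((\<lambda>x. fact n * (d 0 e - R n x) / (e - x) ^ Suc n) has_real_derivative taylor_quotient d e (Suc n) x) (at x)" .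
  show ?thesis
    by (rule has_field_derivative_transform_within_open[OF *, of "- {e}"])
       (use assms(2) in \<open>auto simp: taylor_quotient_def R_def\<close>)
qed

text \<open>Integration by parts in the integral form of the quotient. Read near e it gives
  continuity there: the last summand is a vanishing factor times a bounded quotient.\<close>

lemma taylor_quotient_recursion:
  "taylor_quotient d e n x = d (Suc n) x / (real n + 1) + (e - x) / (real n + 1) * taylor_quotient d e (Suc n) x"
proof (cases "x = e")
  case False
  define u where "u = e - x"
  define R where "R = (\<Sum>m\<le>n. d m x * u ^ m / fact m)"
  have u: "u \<noteq> 0" using False by (simp add: u_def)
  have "fact (Suc n) * (d 0 e - (R + d (Suc n) x * u ^ Suc n / fact (Suc n))) =
      fact (Suc n) * (d 0 e - R) - d (Suc n) x * u ^ Suc n"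
    by (simp add: right_diff_distrib distrib_left del: fact_Suc power_Suc)
  also have "fact (Suc n) * (d 0 e - R) = (real n + 1) * (fact n * (d 0 e - R))"
    by simp
  finally have eq1: "fact (Suc n) * (d 0 e - (R + d (Suc n) x * u ^ Suc n / fact (Suc n))) =
      (real n + 1) * (fact n * (d 0 e - R)) - d (Suc n) x * u ^ Suc n" .
  have "a / w = b / c + u / c * ((c * a - b * w) / (w * u))" if "w \<noteq> 0" "c \<noteq> 0" for a b c w
    using that u by (simp add: field_simps)
  from this[of "u ^ Suc n" "real n + 1" "fact n * (d 0 e - R)" "d (Suc n) x"] u
  have "fact n * (d 0 e - R) / u ^ Suc n = d (Suc n) x / (real n + 1) + u / (real n + 1) *
      (fact (Suc n) * (d 0 e - (R + d (Suc n) x * u ^ Suc n / fact (Suc n))) / u ^ Suc (Suc n))"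
    unfolding eq1 power_Suc2[of u "Suc n"] by (simp del: power_Suc)
  moreover have "(\<Sum>m\<le>Suc n. d m x * (e - x) ^ m / fact m) = R + d (Suc n) x * u ^ Suc n / fact (Suc n)"
    by (simp add: R_def u_def)
  ultimately show ?thesis
    using False unfolding taylor_quotient_def by (simp only: if_False u_def[symmetric] R_def[symmetric])
qed (simp add: taylor_quotient_def)

lemma taylor_quotient_continuous:
  assumes d: "\<And>m x. m \<le> Suc n \<Longrightarrow> x \<in> {-1..1} \<Longrightarrow> (d m has_real_derivative d (Suc m) x) (at x within {-1..1})"
    and K: "\<And>x. x \<in> {-1..1} \<Longrightarrow> \<bar>d (Suc (Suc n)) x\<bar> \<le> K" and e: "e \<in> {-1..1}"
  shows "continuous_on {-1..1} (taylor_quotient d e n)"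
  unfolding continuous_on_eq_continuous_within
proof
  fix x assume x: "x \<in> {-1..1::real}"
  have dc: "continuous_on {-1..1} (d m)" if "m \<le> Suc n" for m
    using d[OF that] DERIV_continuous_on by blast
  show "continuous (at x within {-1..1}) (taylor_quotient d e n)"
  proof (cases "x = e")
    case True
    have "((\<lambda>y. (e - y) / (real n + 1) * taylor_quotient d e (Suc n) y) \<longlongrightarrow> 0) (at e within {-1..1})"
    proof (rule Lim_null_comparison[where g = "\<lambda>y. \<bar>e - y\<bar> / (real n + 1) * K"])
      show "\<forall>\<^sub>F y in at e within {-1..1}. norm ((e - y) / (real n + 1) * taylor_quotient d e (Suc n) y) \<le> \<bar>e - y\<bar> / (real n + 1) * K"
        unfolding eventually_at_filter
      proof (rule always_eventually, intro allI impI)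
        fix y :: real assume "y \<noteq> e" "y \<in> {-1..1}"
        have "\<bar>taylor_quotient d e (Suc n) y\<bar> \<le> K"
          by (rule taylor_quotient_bound) (use d K e \<open>y \<in> _\<close> in auto)
        then show "norm ((e - y) / (real n + 1) * taylor_quotient d e (Suc n) y) \<le> \<bar>e - y\<bar> / (real n + 1) * K"
          by (simp add: abs_mult abs_divide divide_right_mono mult_left_mono)
      qed
      show "((\<lambda>y. \<bar>e - y\<bar> / (real n + 1) * K) \<longlongrightarrow> 0) (at e within {-1..1})"
        by (rule tendsto_eq_intros refl | simp)+
    qed
    moreover have "((\<lambda>y. d (Suc n) y / (real n + 1)) \<longlongrightarrow> d (Suc n) e / (real n + 1)) (at e within {-1..1})"
      using dc[of "Suc n"] e by (intro tendsto_intros) (auto simp: continuous_on_def)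
    ultimately have "((\<lambda>y. d (Suc n) y / (real n + 1) + (e - y) / (real n + 1) * taylor_quotient d e (Suc n) y)
        \<longlongrightarrow> d (Suc n) e / (real n + 1) + 0) (at e within {-1..1})"
      by (intro tendsto_add)
    then show ?thesis
      unfolding True continuous_within taylor_quotient_recursion[symmetric]
      by (simp add: taylor_quotient_def[of d e n e])
  next
    case False
    have "continuous (at x within {-1..1}) (\<lambda>x. fact n * (d 0 e - (\<Sum>m\<le>n. d m x * (e - x) ^ m / fact m)) / (e - x) ^ Suc n)"
      using False x dc unfolding continuous_on_eq_continuous_within
      by (intro continuous_intros) auto
    moreover have "\<forall>\<^sub>F y in at x within {-1..1}. fact n * (d 0 e - (\<Sum>m\<le>n. d m y * (e - y) ^ m / fact m)) / (e - y) ^ Suc n = taylor_quotient d e n y"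
    proof -
      have "\<forall>\<^sub>F y in at x within {-1..1}. y \<in> - {e}"
        by (rule eventually_at_topological[THEN iffD2]) (use False in \<open>auto intro!: exI[of _ "- {e}"]\<close>)
      then show ?thesis
        by (rule eventually_mono) (auto simp: taylor_quotient_def)
    qed
    ultimately show ?thesis
      unfolding continuous_within using False
      by (simp add: taylor_quotient_def[of d e n x] tendsto_cong)
  qed
qed

text \<open>The difference quotient costs one derivative of \<open>v\<close>, as does v' itself, so
  the r + 1 derivatives controlled by \<open>DD r\<close> give order r for both families. Dividing
  by \<open>len\<close> turns the distortion bounds into bounds independent of the branch.\<close>

lemma smooth_branch_families:
  assumes Dv: "\<And>i. i \<in> I \<Longrightarrow> has_derivs_on (r + 1) (v i) (Dv i) {-1..1}"
    and bnd: "\<And>i n x. i \<in> I \<Longrightarrow> n \<le> r \<Longrightarrow> x \<in> {-1..1} \<Longrightarrow> \<bar>Dv i (Suc n) x\<bar> \<le> K * len i"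
    and len: "\<And>i. i \<in> I \<Longrightarrow> len i > 0" and e: "e \<in> {-1, 1}"
  shows "smooth_family r I (\<lambda>i t. Dv i 1 (cos (2 * t)) / len i)"
    and "smooth_family r I (\<lambda>i t. (if cos (2 * t) = e then Dv i 1 e
           else (v i e - v i (cos (2 * t))) / (e - cos (2 * t))) / len i)"
proof -
  have d: "(Dv i m has_real_derivative Dv i (Suc m) x) (at x within {-1..1})"
    if "i \<in> I" "m \<le> r" "x \<in> {-1..1}" for i m x
    using Dv[OF that(1)] that by (auto simp: has_derivs_on_def)
  have d': "(Dv i m has_real_derivative Dv i (Suc m) x) (at x)"
    if "i \<in> I" "m \<le> r" "x \<in> {-1<..<1}" for i m x
  proof -
    have "at x within {-1..1} = at x"
      by (rule at_within_interior) (use that(3) in \<open>simp add: interior_atLeastAtMost_real\<close>)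
    then show ?thesis using d[of i m x] that by simp
  qed
  have dc: "continuous_on {-1..1} (Dv i m)" if "i \<in> I" "m \<le> r" for i m
    using d[OF that] DERIV_continuous_on by blast
  have D0: "Dv i 0 x = v i x" if "i \<in> I" "x \<in> {-1..1}" for i x
    using Dv[OF that(1)] that by (auto simp: has_derivs_on_def)
  have "smooth_family r I (\<lambda>i t. (\<lambda>m i x. Dv i (Suc m) x / len i) 0 i (cos (2 * t)))"
  proof (rule smooth_family_compose_cos)
    fix m assume m: "m < r"
    show "\<forall>i\<in>I. continuous_on {-1..1} (\<lambda>x. Dv i (Suc m) x / len i)"
    proof
      fix i assume i: "i \<in> I"
      show "continuous_on {-1..1} (\<lambda>x. Dv i (Suc m) x / len i)"
        by (intro continuous_intros dc[OF i]) (use m len[OF i] in auto)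
    qed
    fix i x assume "i \<in> I" "x \<in> {-1<..<1::real}"
    then show "((\<lambda>x. Dv i (Suc m) x / len i) has_real_derivative Dv i (Suc (Suc m)) x / len i) (at x)"
      by (intro DERIV_cdivide d') (use m in auto)
  next
    fix m assume m: "m \<le> r"
    show "\<exists>B. \<forall>i\<in>I. \<forall>x\<in>{-1..1}. \<bar>Dv i (Suc m) x / len i\<bar> \<le> B"
    proof (intro exI[of _ K] ballI)
      fix i x assume "i \<in> I" "x \<in> {-1..1::real}"
      then show "\<bar>Dv i (Suc m) x / len i\<bar> \<le> K"
        using bnd[of i m x] m len[of i] by (simp add: abs_divide pos_divide_le_eq)
    qed
  qed
  then show "smooth_family r I (\<lambda>i t. Dv i 1 (cos (2 * t)) / len i)" by simp
  have e': "e \<in> {-1..1}" using e by auto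
  have "smooth_family r I (\<lambda>i t. (\<lambda>m i x. taylor_quotient (Dv i) e m x / len i) 0 i (cos (2 * t)))"
  proof (rule smooth_family_compose_cos)
    fix m assume m: "m < r"
    show "\<forall>i\<in>I. continuous_on {-1..1} (\<lambda>x. taylor_quotient (Dv i) e m x / len i)"
    proof
      fix i assume i: "i \<in> I"
      have "continuous_on {-1..1} (taylor_quotient (Dv i) e m)"
        by (rule taylor_quotient_continuous[OF _ _ e']) (use d[OF i] bnd[OF i, of "Suc m"] m in auto)
      then show "continuous_on {-1..1} (\<lambda>x. taylor_quotient (Dv i) e m x / len i)"
        using len[OF i] by (intro continuous_intros) auto
    qed
    fix i x assume i: "i \<in> I" and x: "x \<in> {-1<..<1::real}"
    have "(taylor_quotient (Dv i) e m has_real_derivative taylor_quotient (Dv i) e (Suc m) x) (at x)"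
      by (rule taylor_quotient_deriv) (use d'[OF i _ x] m x e in auto)
    then show "((\<lambda>x. taylor_quotient (Dv i) e m x / len i) has_real_derivative taylor_quotient (Dv i) e (Suc m) x / len i) (at x)"
      by (rule DERIV_cdivide)
  next
    fix m assume m: "m \<le> r"
    show "\<exists>B. \<forall>i\<in>I. \<forall>x\<in>{-1..1}. \<bar>taylor_quotient (Dv i) e m x / len i\<bar> \<le> B"
    proof (intro exI[of _ K] ballI)
      fix i x assume i: "i \<in> I" and x: "x \<in> {-1..1::real}"
      have "\<bar>taylor_quotient (Dv i) e m x\<bar> \<le> K * len i"
        by (rule taylor_quotient_bound[OF _ _ e' x]) (use d[OF i] bnd[OF i m] m in auto)
      then show "\<bar>taylor_quotient (Dv i) e m x / len i\<bar> \<le> K"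
        using len[OF i] by (simp add: abs_divide pos_divide_le_eq)
    qed
  qed
  then show "smooth_family r I (\<lambda>i t. (if cos (2 * t) = e then Dv i 1 e
           else (v i e - v i (cos (2 * t))) / (e - cos (2 * t))) / len i)"
    by (rule smooth_family_cong) (use D0[OF _ e'] in \<open>auto simp: taylor_quotient_def D0\<close>)
qed

section \<open>Bernstein ellipses and holomorphic branches\<close>

definition bernstein_interior :: "real \<Rightarrow> complex set" where
  "bernstein_interior \<delta> = {z. (Re z / cosh \<delta>)\<^sup>2 + (Im z / sinh \<delta>)\<^sup>2 < 1}"

lemma open_bernstein_interior: "\<delta> > 0 \<Longrightarrow> open (bernstein_interior \<delta>)"
  unfolding bernstein_interior_def by (intro open_Collect_less continuous_intros) auto

lemma convex_bernstein_interior: "convex (bernstein_interior \<delta>)"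
proof -
  define f where "f = (\<lambda>z. Complex (Re z / cosh \<delta>) (Im z / sinh \<delta>))"
  have "linear f"
    by (rule linearI) (auto simp: f_def complex_eq_iff add_divide_distrib)
  moreover have "bernstein_interior \<delta> = f -` ball 0 1"
    by (auto simp: bernstein_interior_def f_def cmod_def)
  ultimately show ?thesis
    by (simp add: convex_linear_vimage)
qed

lemma norm_le_cosh:
  assumes "\<delta> > 0" "z \<in> bernstein_interior \<delta>"
  shows "cmod z \<le> cosh \<delta>"
proof -
  have s: "0 < sinh \<delta>" "sinh \<delta> < cosh \<delta>" "0 < cosh \<delta>"
    using assms(1) by (auto simp: sinh_less_cosh_real)
  have "(Re z / cosh \<delta>)\<^sup>2 + (Im z / cosh \<delta>)\<^sup>2 \<le> (Re z / cosh \<delta>)\<^sup>2 + (Im z / sinh \<delta>)\<^sup>2"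
    using s unfolding power_divide by (intro add_left_mono divide_left_mono power_mono) auto
  also have "\<dots> \<le> 1" using assms(2) by (simp add: bernstein_interior_def)
  finally have "(Re z)\<^sup>2 + (Im z)\<^sup>2 \<le> (cosh \<delta>)\<^sup>2"
    using s by (simp add: power_divide add_divide_distrib[symmetric] pos_divide_le_eq)
  then show ?thesis
    using s unfolding cmod_def by (simp add: real_le_lsqrt)
qed

text \<open>Cosine takes the line Im w = y into the ellipse with semi-axes cosh y and |sinh y|, and
  these grow with |y|. The angle here is w = 2 * z, which halves the admissible width.\<close>

lemma cos_strip_in_bernstein:
  assumes "z \<in> strip (\<delta> / 2)"
  shows "cos (2 * z) \<in> bernstein_interior \<delta>"
proof -
  define x y where "x = Re (2 * z)" and "y = Im (2 * z)"
  have y: "\<bar>y\<bar> < \<delta>" using assms by (simp add: strip_def y_def)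
  have re: "Re (cos (2 * z)) = cos x * cosh y" "Im (cos (2 * z)) = - (sin x * sinh y)"
    unfolding Re_cos Im_cos x_def[symmetric] y_def[symmetric] by (simp_all add: cosh_field_def sinh_field_def field_simps)
  have s: "0 < sinh \<delta>" "0 < cosh \<delta>" using y by auto
  have a: "(cosh y)\<^sup>2 < (cosh \<delta>)\<^sup>2"
    using y cosh_real_strict_mono[of "\<bar>y\<bar>" \<delta>] by (intro power_strict_mono) auto
  then have b: "(sinh y)\<^sup>2 < (sinh \<delta>)\<^sup>2" by (simp add: sinh_square_eq)
  have "(cos x)\<^sup>2 * ((cosh y)\<^sup>2 / (cosh \<delta>)\<^sup>2) + (sin x)\<^sup>2 * ((sinh y)\<^sup>2 / (sinh \<delta>)\<^sup>2) < 1"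
  proof -
    \<comment> \<open>The left-hand side is a convex combination, with weights (cos x)^2 and (sin
      x)^2, of two ratios below 1.\<close>
    define M where "M = max ((cosh y)\<^sup>2 / (cosh \<delta>)\<^sup>2) ((sinh y)\<^sup>2 / (sinh \<delta>)\<^sup>2)"
    have "M < 1" using a b s by (simp add: M_def)
    have "(cos x)\<^sup>2 * ((cosh y)\<^sup>2 / (cosh \<delta>)\<^sup>2) + (sin x)\<^sup>2 * ((sinh y)\<^sup>2 / (sinh \<delta>)\<^sup>2) \<le> (cos x)\<^sup>2 * M + (sin x)\<^sup>2 * M"
      unfolding M_def by (intro add_mono mult_left_mono max.cobounded1 max.cobounded2) auto
    also have "\<dots> = M" unfolding distrib_right[symmetric] by simp
    finally show ?thesis using \<open>M < 1\<close> by simp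
  qed
  then show ?thesis
    by (simp add: bernstein_interior_def re power_divide power_mult_distrib)
qed

text \<open>A primitive h of f' / f takes the place of a logarithm of f: the quotient of f by exp h
  is constant on the convex set, and h is Lipschitz with constant C.\<close>

lemma distortion_bound:
  assumes "open S" "convex S" "f holomorphic_on S" "\<And>z. z \<in> S \<Longrightarrow> f z \<noteq> 0"
    "\<And>z. z \<in> S \<Longrightarrow> cmod (deriv f z / f z) \<le> C" "z \<in> S" "w \<in> S"
  shows "cmod (f z) \<le> cmod (f w) * exp (C * cmod (z - w))"
proof -
  have "(\<lambda>z. deriv f z / f z) holomorphic_on S"
    using assms(1,3,4) by (intro holomorphic_intros) auto
  then obtain h where h: "\<And>z. z \<in> S \<Longrightarrow> (h has_field_derivative deriv f z / f z) (at z within S)"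
    using holomorphic_convex_primitive'[OF assms(2,1)] by blast
  have "\<exists>c. \<forall>z\<in>S. f z * exp (- h z) = c"
  proof (rule has_field_derivative_zero_constant[OF assms(2)])
    fix u assume u: "u \<in> S"
    have "(f has_field_derivative deriv f u) (at u within S)"
      using holomorphic_derivI[OF assms(3,1) u] by (rule has_field_derivative_at_within)
    then have "((\<lambda>z. f z * exp (- h z)) has_field_derivative
        deriv f u * exp (- h u) + f u * (exp (- h u) * - (deriv f u / f u))) (at u within S)"
      using h[OF u] by (auto intro!: derivative_eq_intros)
    then show "((\<lambda>z. f z * exp (- h z)) has_field_derivative 0) (at u within S)"
      using assms(4)[OF u] by simp
  qed
  then have "f z * exp (- h z) = f w * exp (- h w)" using assms(6,7) by metis
  then have "f z = f w * exp (h z - h w)"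
    by (simp add: exp_minus exp_diff field_simps)
  moreover have "cmod (h z - h w) \<le> C * cmod (z - w)"
    by (rule field_differentiable_bound[OF assms(2) h assms(5)]) (use assms(6,7) in auto)
  then have "cmod (exp (h z - h w)) \<le> exp (C * cmod (z - w))"
    using norm_exp[of "h z - h w"] by (meson exp_le_cancel_iff order_trans)
  ultimately show ?thesis by (simp add: norm_mult mult_left_mono del: norm_exp_eq_Re)
qed

text \<open>Distortion compares the derivative of \<open>g i\<close> anywhere in the ellipse with
  its value at 0, which is real and at most B * len in modulus; the distance to 0 is at most cosh
  \<delta>. The difference quotient inherits the bound by the mean value inequality on the convex
  ellipse.\<close>

lemma analytic_branch_families:
  assumes \<delta>: "\<delta> > 0"
    and g: "\<And>i. i \<in> I \<Longrightarrow> g i holomorphic_on bernstein_interior \<delta>"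
      "\<And>i x. i \<in> I \<Longrightarrow> x \<in> {-1..1} \<Longrightarrow> g i (of_real x) = of_real (v i x)"
      "\<And>i z. i \<in> I \<Longrightarrow> z \<in> bernstein_interior \<delta> \<Longrightarrow> deriv (g i) z \<noteq> 0"
      "\<And>i z. i \<in> I \<Longrightarrow> z \<in> bernstein_interior \<delta> \<Longrightarrow> cmod (deriv (deriv (g i)) z / deriv (g i) z) \<le> C"
    and v: "\<And>i x. i \<in> I \<Longrightarrow> x \<in> {-1..1} \<Longrightarrow> (v i has_real_derivative dv i x) (at x within {-1..1})"
      "\<And>i x. i \<in> I \<Longrightarrow> x \<in> {-1..1} \<Longrightarrow> \<bar>dv i x\<bar> \<le> B * len i"
    and len: "\<And>i. i \<in> I \<Longrightarrow> len i > 0" and e: "e \<in> {-1, 1}"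
  shows "analytic_family I (\<lambda>i t. dv i (cos (2 * t)) / len i)"
    and "analytic_family I (\<lambda>i t. (if cos (2 * t) = e then dv i e
           else (v i e - v i (cos (2 * t))) / (e - cos (2 * t))) / len i)"
proof -
  let ?W = "bernstein_interior \<delta>"
  note W = open_bernstein_interior[OF \<delta>] convex_bernstein_interior[of \<delta>]
  have real_W: "complex_of_real x \<in> ?W" if "x \<in> {-1..1}" for x
  proof -
    have "x\<^sup>2 \<le> 1" using that by (simp add: abs_square_le_1 abs_le_iff)
    moreover have "1 < (cosh \<delta>)\<^sup>2"
      using \<delta> cosh_real_strict_mono[of 0 \<delta>] by (intro one_less_power) auto
    ultimately show ?thesis
      by (simp add: bernstein_interior_def power_divide)
  qed
  have dg: "deriv (g i) (of_real x) = of_real (dv i x)" if i: "i \<in> I" and x: "x \<in> {-1..1}" for i x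
  proof -
    have "((\<lambda>x. g i (of_real x)) has_vector_derivative deriv (g i) (of_real x)) (at x within {-1..1})"
      by (intro has_vector_derivative_real_field holomorphic_derivI[OF g(1)[OF i] W(1)] real_W x)
    moreover have "((\<lambda>x. g i (of_real x)) has_vector_derivative of_real (dv i x)) (at x within {-1..1})"
      by (rule has_vector_derivative_transform[OF x g(2)[OF i]])
         (use v(1)[OF i x] in \<open>auto intro: has_vector_derivative_of_real\<close>)
    ultimately show ?thesis
      using vector_derivative_unique_within_closed_interval[of "-1" 1 x] x by auto
  qed
  define K where "K = B * exp (\<bar>C\<bar> * cosh \<delta>)"
  have K: "cmod (deriv (g i) z) \<le> K * len i" if i: "i \<in> I" and z: "z \<in> ?W" for i z
  proof -
    have "cmod (deriv (g i) z) \<le> cmod (deriv (g i) 0) * exp (C * cmod (z - 0))"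
      by (rule distortion_bound[OF W holomorphic_deriv[OF g(1)[OF i] W(1)] g(3)[OF i] g(4)[OF i] z])
         (use real_W[of 0] in auto)
    also have "\<dots> \<le> (B * len i) * exp (\<bar>C\<bar> * cosh \<delta>)"
    proof (intro mult_mono)
      show "cmod (deriv (g i) 0) \<le> B * len i"
        using dg[OF i, of 0] v(2)[OF i, of 0] by simp
      have "C * cmod z \<le> \<bar>C\<bar> * cosh \<delta>"
        using norm_le_cosh[OF \<delta> z] by (intro mult_mono) auto
      then show "exp (C * cmod (z - 0)) \<le> exp (\<bar>C\<bar> * cosh \<delta>)" by simp
      show "0 \<le> B * len i" using v(2)[OF i, of 0] by simp
    qed auto
    finally show ?thesis by (simp add: K_def mult_ac)
  qed
  have cosW: "cos (2 * z) \<in> ?W" if "z \<in> strip (\<delta> / 2)" for z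
    using that by (rule cos_strip_in_bernstein)
  have cosR: "cos (2 * complex_of_real t) = of_real (cos (2 * t))" for t
    by (simp add: cos_of_real[symmetric])
  have comp: "(\<lambda>z. h (cos (2 * z))) holomorphic_on strip (\<delta> / 2)" if "h holomorphic_on ?W" for h
    using holomorphic_on_compose_gen[OF _ that, of "\<lambda>z. cos (2 * z)" "strip (\<delta> / 2)"] cosW
    by (auto simp: o_def image_subset_iff intro!: holomorphic_intros)
  show "analytic_family I (\<lambda>i t. dv i (cos (2 * t)) / len i)"
  proof (rule analytic_familyI[of "\<delta> / 2" I "\<lambda>i z. deriv (g i) (cos (2 * z)) / of_real (len i)" K])
    fix i assume i: "i \<in> I"
    show "(\<lambda>z. deriv (g i) (cos (2 * z)) / of_real (len i)) holomorphic_on strip (\<delta> / 2)"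
      using len[OF i] by (intro holomorphic_on_divide comp holomorphic_deriv[OF g(1)[OF i] W(1)] holomorphic_on_const) auto
    show "cmod (deriv (g i) (cos (2 * z)) / of_real (len i)) \<le> K" if "z \<in> strip (\<delta> / 2)" for z
      using K[OF i cosW[OF that]] len[OF i] by (simp add: norm_divide pos_divide_le_eq)
    show "deriv (g i) (cos (2 * of_real t)) / of_real (len i) = of_real (dv i (cos (2 * t)) / len i)" for t
      unfolding cosR by (subst dg[OF i]) auto
  qed (use \<delta> in auto)
  \<comment> \<open>Since cosh \<delta> > 1, the points 1 and -1 lie inside the ellipse, so the
    singularity at e is removable.\<close>
  define q where "q = (\<lambda>i z. if z = of_real e then deriv (g i) (of_real e) else (g i z - g i (of_real e)) / (z - of_real e))"
  have e': "e \<in> {-1..1}" using e by auto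
  show "analytic_family I (\<lambda>i t. (if cos (2 * t) = e then dv i e
           else (v i e - v i (cos (2 * t))) / (e - cos (2 * t))) / len i)"
  proof (rule analytic_familyI[of "\<delta> / 2" I "\<lambda>i z. q i (cos (2 * z)) / of_real (len i)" K])
    fix i assume i: "i \<in> I"
    have "q i holomorphic_on ?W"
      unfolding q_def by (rule pole_lemma_open[OF g(1)[OF i] W(1)])
    then show "(\<lambda>z. q i (cos (2 * z)) / of_real (len i)) holomorphic_on strip (\<delta> / 2)"
      using len[OF i] by (intro holomorphic_on_divide comp holomorphic_on_const) auto
    show "cmod (q i (cos (2 * z)) / of_real (len i)) \<le> K" if z: "z \<in> strip (\<delta> / 2)" for z
    proof -
      have "cmod (q i w) \<le> K * len i" if w: "w \<in> ?W" for w
      proof (cases "w = of_real e")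
        case True
        then show ?thesis using K[OF i w] by (simp add: q_def)
      next
        case False
        have "cmod (g i w - g i (of_real e)) \<le> K * len i * cmod (w - of_real e)"
          by (rule field_differentiable_bound[OF W(2) _ K[OF i] w real_W[OF e']])
             (auto intro: has_field_derivative_at_within holomorphic_derivI[OF g(1)[OF i] W(1)])
        then show ?thesis
          using False by (simp add: q_def norm_divide pos_divide_le_eq)
      qed
      from this[OF cosW[OF z]] show ?thesis
        using len[OF i] by (simp add: norm_divide pos_divide_le_eq)
    qed
    show "q i (cos (2 * of_real t)) / of_real (len i) = of_real ((if cos (2 * t) = e then dv i e
           else (v i e - v i (cos (2 * t))) / (e - cos (2 * t))) / len i)" for t
    proof -
      have "(v i (cos (2 * t)) - v i e) / (cos (2 * t) - e) = (v i e - v i (cos (2 * t))) / (e - cos (2 * t))"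
        by (metis minus_diff_eq minus_divide_divide)
      moreover have "g i (of_real (cos (2 * t))) = of_real (v i (cos (2 * t)))" by (rule g(2)[OF i]) auto
      ultimately show ?thesis
        unfolding cosR q_def of_real_eq_iff dg[OF i e'] g(2)[OF i e']
        by (simp only: of_real_diff[symmetric] of_real_divide[symmetric] if_distrib[of complex_of_real, symmetric] split: if_split)
    qed
  qed (use \<delta> in auto)
qed

subsection \<open>The unimodular phase of a branch\<close>

text \<open>The zeros of sin (2 * t) have empty interior, so their complement is dense, and a closed
  condition on a continuous function extends from it.\<close>

lemma le_if_le_off_sin_double_zeros:
  fixes f :: "real \<Rightarrow> real"
  assumes "continuous_on UNIV f" "\<And>t. sin (2 * t) \<noteq> 0 \<Longrightarrow> f t \<le> c"
  shows "f t \<le> c"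
proof -
  have "interior {t::real. sin (2 * t) = 0} = {}"
  proof (rule ccontr)
    assume "interior {t::real. sin (2 * t) = 0} \<noteq> {}"
    then obtain x where "x \<in> interior {t::real. sin (2 * t) = 0}" by blast
    then obtain e where e: "e > 0" "cball x e \<subseteq> {t::real. sin (2 * t) = 0}"
      by (meson mem_interior_cball)
    then have "{x..x+e} \<subseteq> {t \<in> {x..x+e}. sin (2 * t) = 0}"
      by (auto simp: cball_def dist_real_def subset_iff)
    then have "finite {x..x+e}"
      using finite_sin_double_zeros[of x "x + e"] finite_subset by blast
    with e(1) show False by (simp add: infinite_Icc)
  qed
  then have "closure {t::real. sin (2 * t) \<noteq> 0} = UNIV"
    by (simp add: closure_interior Compl_eq)
  then show ?thesis
    using continuous_le_on_closure[of "{t. sin (2 * t) \<noteq> 0}" f t c] assms by auto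
qed

text \<open>Meant for the factor of g that depends on how a branch touches the endpoints: the index
  set is split according to the function chosen, and the pieces are reunited.\<close>

lemma regular_family_finite_range:
  assumes "finite H" "\<And>h. h \<in> H \<Longrightarrow> regular_family D X (\<lambda>i. h)" "\<And>i. i \<in> X \<Longrightarrow> f i \<in> H"
  shows "regular_family D X f"
  using assms
proof (induction H arbitrary: X rule: finite_induct)
  case empty
  show ?case
    by (rule regular_family_cong[OF regular_family_const[of X "\<lambda>_. 0" 0]]) (use empty.prems in auto)
next
  case (insert h H)
  have "regular_family D {i \<in> X. f i \<in> H} f"
    by (rule insert.IH; (rule regular_family_subset[OF insert.prems(1)])?) auto
  moreover have "regular_family D {i \<in> X. f i = h} f"
    by (rule regular_family_cong[OF regular_family_subset[OF insert.prems(1)[of h]]]) auto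
  ultimately have "regular_family D ({i \<in> X. f i \<in> H} \<union> {i \<in> X. f i = h}) f"
    by (rule regular_family_Un)
  moreover have "{i \<in> X. f i \<in> H} \<union> {i \<in> X. f i = h} = X"
    using insert.prems(2) by auto
  ultimately show ?case by simp
qed

text \<open>Formally one differentiates S^2 = 1 - V^2 and divides by 2 * S. As differentiability of
  S is not given, S is identified near t with a root of 1 - V^2 whose sign is fixed by
  continuity.\<close>

lemma has_real_derivative_circle:
  fixes S V :: "real \<Rightarrow> real"
  assumes "continuous_on UNIV S" "\<And>t. (S t)\<^sup>2 = 1 - (V t)\<^sup>2" "S t \<noteq> 0"
    and "(V has_real_derivative - (g * S t)) (at t)"
  shows "(S has_real_derivative g * V t) (at t)"
proof -
  define s where "s = sgn (S t)"
  have s: "s * s = 1" "\<bar>s\<bar> = 1" "s * \<bar>S t\<bar> = S t" using assms(3) by (auto simp: s_def sgn_if)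
  have sq: "sqrt (1 - (V u)\<^sup>2) = \<bar>S u\<bar>" for u
    using assms(2)[of u] real_sqrt_abs[of "S u"] by simp
  have pos: "1 - (V t)\<^sup>2 > 0" using assms(2)[of t] assms(3) by (metis zero_less_power2)
  have "((\<lambda>u. s * sqrt (1 - (V u)\<^sup>2)) has_real_derivative
      s * (- (2 * V t * - (g * S t)) * (inverse (sqrt (1 - (V t)\<^sup>2)) / 2))) (at t)"
    using pos by (auto intro!: derivative_eq_intros assms(4))
  also have "s * (- (2 * V t * - (g * S t)) * (inverse (sqrt (1 - (V t)\<^sup>2)) / 2)) = g * V t"
    using s assms(3) unfolding sq by (auto simp: field_simps abs_if split: if_splits)
  finally have d: "((\<lambda>u. s * sqrt (1 - (V u)\<^sup>2)) has_real_derivative g * V t) (at t)" .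
  have op: "open {u. s * S u > 0}"
    using assms(1) by (intro open_Collect_less continuous_intros)
  show ?thesis
  proof (rule has_field_derivative_transform_within_open[OF d op])
    show "t \<in> {u. s * S u > 0}"
      using assms(3) by (auto simp: s_def sgn_if)
    show "s * sqrt (1 - (V u)\<^sup>2) = S u" if "u \<in> {u. s * S u > 0}" for u
      using that assms(3) unfolding sq by (auto simp: s_def sgn_if split: if_splits)
  qed
qed

text \<open>The phase and its conjugate may come with different exponential rates; for x >= 0 the
  smaller rate serves both.\<close>

lemma kappa_add:
  assumes "K1 \<in> kappa D" "K2 \<in> kappa D"
  shows "\<exists>K\<in>kappa D. \<forall>x\<ge>0. K1 x + K2 x \<le> K x"
proof (cases D)
  case (DD r)
  then obtain C1 C2 where C: "C1 > 0" "C2 > 0" "K1 = (\<lambda>x. C1 * (1 + x) powr (- real r))"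
    "K2 = (\<lambda>x. C2 * (1 + x) powr (- real r))"
    using assms by (auto simp: kappa_def)
  have K: "(\<lambda>x. (C1 + C2) * (1 + x) powr (- real r)) \<in> kappa D"
    unfolding kappa_def DD dcond.case mem_Collect_eq by (rule exI[of _ "C1 + C2"]) (use C(1,2) in simp)
  have "K1 x + K2 x \<le> (C1 + C2) * (1 + x) powr (- real r)" for x
    unfolding C(3,4) by (simp add: distrib_right)
  then show ?thesis by (intro bexI[OF _ K]) simp
next
  case (AD \<delta>)
  then obtain C1 C2 z1 z2 where C: "C1 > 0" "C2 > 0" "K1 = (\<lambda>x. C1 * exp (- z1 * x))"
    "K2 = (\<lambda>x. C2 * exp (- z2 * x))" "0 < z1" "0 < z2" "z1 \<le> \<delta>" "z2 \<le> \<delta>"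
    using assms by (auto simp: kappa_def)
  define z where "z = min z1 z2"
  have K: "(\<lambda>x. (C1 + C2) * exp (- z * x)) \<in> kappa D"
    unfolding kappa_def AD dcond.case mem_Collect_eq
    by (rule exI[of _ "C1 + C2"], intro conjI exI[of _ z]) (use C(1,2,5-8) in \<open>simp_all add: z_def min.coboundedI1\<close>)
  have "K1 x + K2 x \<le> (C1 + C2) * exp (- z * x)" if "x \<ge> 0" for x
  proof -
    have "exp (- z1 * x) \<le> exp (- z * x)" "exp (- z2 * x) \<le> exp (- z * x)"
      using mult_right_mono[OF min.cobounded1 that] mult_right_mono[OF min.cobounded2 that]
      by (simp_all add: z_def)
    then show ?thesis
      unfolding C(3,4) distrib_right using C(1,2) by (intro add_mono mult_left_mono) simp_all
  qed
  then show ?thesis by (intro bexI[OF _ K]) simp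
qed

lemma cos_double_open:
  fixes t :: real
  assumes "sin (2 * t) \<noteq> 0"
  shows "cos (2 * t) \<in> {-1<..<1}"
proof -
  have "(cos (2 * t))\<^sup>2 < 1"
    using assms sin_cos_squared_add[of "2 * t"] by (smt (verit) zero_less_power2)
  then show ?thesis
    by (auto simp: abs_square_less_1 abs_less_iff)
qed

text \<open>What the phase has to know about f. \<open>B\<close> bounds v' from below in terms of
  the branch length, and \<open>q\<close> will be 1 / \<lambda>. \<open>gap\<close> is the \<Xi>
  condition in usable form: 1 - \<sigma> * v x is the distance of v x from \<sigma>, and d will be
  the distance of the whole image from an endpoint \<sigma> that it does not reach. The distortion
  condition enters through the regularity of v' and of the difference quotients at 1 and -1.\<close>

locale branch_family =
  fixes D :: dcond and I :: "'i set" and v dv :: "'i \<Rightarrow> real \<Rightarrow> real"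
    and len :: "'i \<Rightarrow> real" and B M q :: real
  assumes valid: "dcond_valid D"
    and BM: "B > 0" "M > 0"
    and len_pos: "i \<in> I \<Longrightarrow> len i > 0"
    and deriv_v: "i \<in> I \<Longrightarrow> x \<in> {-1..1} \<Longrightarrow> (v i has_real_derivative dv i x) (at x within {-1..1})"
    and dv_lower: "i \<in> I \<Longrightarrow> x \<in> {-1..1} \<Longrightarrow> len i / B \<le> \<bar>dv i x\<bar>"
    and v_range: "i \<in> I \<Longrightarrow> x \<in> {-1..1} \<Longrightarrow> \<bar>v i x\<bar> \<le> 1"
    and gap: "i \<in> I \<Longrightarrow> \<sigma> \<in> {-1, 1} \<Longrightarrow> v i 1 \<noteq> \<sigma> \<Longrightarrow> v i (-1) \<noteq> \<sigma> \<Longrightarrow>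
      \<exists>d>0. len i \<le> M * d \<and> (\<forall>x\<in>{-1..1}. d \<le> 1 - \<sigma> * v i x \<and> 1 - \<sigma> * v i x \<le> d + len i)"
    and regular_dv: "regular_family D I (\<lambda>i t. dv i (cos (2 * t)) / len i)"
    and regular_quotient: "e \<in> {-1, 1} \<Longrightarrow> regular_family D I
      (\<lambda>i t. (if cos (2 * t) = e then dv i e else (v i e - v i (cos (2 * t))) / (e - cos (2 * t))) / len i)"
    and expansion: "i \<in> I \<Longrightarrow> x \<in> {-1<..<1} \<Longrightarrow> sqrt (1 - x\<^sup>2) * \<bar>dv i x\<bar> \<le> q * sqrt (1 - (v i x)\<^sup>2)"
begin

definition quot :: "real \<Rightarrow> 'i \<Rightarrow> real \<Rightarrow> real" where
  "quot e i t = (if cos (2 * t) = e then dv i e else (v i e - v i (cos (2 * t))) / (e - cos (2 * t))) / len i"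

lemma deriv_v_interior:
  assumes "i \<in> I" "x \<in> {-1<..<1}"
  shows "(v i has_real_derivative dv i x) (at x)"
proof -
  have "(v i has_real_derivative dv i x) (at x within {-1..1})"
    using assms by (intro deriv_v) auto
  moreover have "at x within {-1..1} = at x"
    by (rule at_within_interior) (use assms(2) in \<open>simp add: interior_atLeastAtMost_real\<close>)
  ultimately show ?thesis by simp
qed

lemma continuous_v: "i \<in> I \<Longrightarrow> continuous_on {-1..1} (v i)"
  using deriv_v DERIV_continuous_on by blast

text \<open>Since 1 - cos (2 * t) = 2 * sin t * sin t, the increment of v from the point 1 is the
  difference quotient there times a regular factor.\<close>

lemma regular_v: "regular_family D I (\<lambda>i t. (v i (cos (2 * t)) - v i 1) / len i)"
proof (rule regular_family_cong)
  have "regular_family D I (quot 1)"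
    using regular_quotient[of 1] by (simp add: quot_def[abs_def])
  then show "regular_family D I (\<lambda>i t. - 2 * quot 1 i t * (sin t * sin t))"
    by (intro regular_family_mult regular_family_sin regular_family_const[of _ _ 2]) auto
  show "- 2 * quot 1 i t * (sin t * sin t) = (v i (cos (2 * t)) - v i 1) / len i" if "i \<in> I" for i t
  proof (cases "cos (2 * t) = 1")
    case True
    then show ?thesis by (simp add: cos_double_sin power2_eq_square)
  next
    case False
    have "- 2 * (y / d / l) * s = - y / l" if "d = 2 * s" "d \<noteq> 0" for y d l s :: real
      using that by simp
    from this[of "1 - cos (2 * t)" "sin t * sin t" "v i 1 - v i (cos (2 * t))" "len i"] show ?thesis
      using False by (simp add: quot_def cos_double_sin power2_eq_square)
  qed
qed

text \<open>By the mean value theorem the quotient is v' / \<open>len\<close> at an intermediate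
  point, hence at least 1 / B in modulus; its sign is forced by 1 - \<sigma> * v >= 0. This works
  off the zeros of sin (2 * t), and continuity covers the rest.\<close>

lemma touching_quotient:
  assumes "i \<in> I" "\<sigma> \<in> {-1, 1}" "e \<in> {-1, 1}" "v i e = \<sigma>"
  shows "1 / B \<le> \<sigma> * e * quot e i t"
    and "1 - \<sigma> * v i (cos (2 * t)) = len i * (\<sigma> * e * quot e i t) * (1 - e * cos (2 * t))"
proof -
  have sq: "\<sigma> * \<sigma> = 1" "e * e = 1" using assms(2,3) by auto
  show eq: "1 - \<sigma> * v i (cos (2 * t)) = len i * (\<sigma> * e * quot e i t) * (1 - e * cos (2 * t))" for t
  proof (cases "cos (2 * t) = e")
    case True
    then show ?thesis using sq assms(4) by simp
  next
    case False
    have "1 - e * cos (2 * t) = e * (e - cos (2 * t))" "1 - \<sigma> * v i (cos (2 * t)) = \<sigma> * (v i e - v i (cos (2 * t)))"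
      using sq assms(4) by (simp_all add: algebra_simps)
    moreover have "\<sigma> * y = l * (\<sigma> * e * (y / d / l)) * (e * d)" if "d \<noteq> 0" "l \<noteq> 0" for d y l :: real
      using that assms(2,3) by auto
    ultimately show ?thesis
      using False len_pos[OF assms(1)] sq by (simp add: quot_def)
  qed
  have off: "1 / B \<le> \<sigma> * e * quot e i t" if t: "sin (2 * t) \<noteq> 0" for t
  proof -
    define x where "x = cos (2 * t)"
    have x: "x \<in> {-1<..<1}" using cos_double_open[OF t] by (simp add: x_def)
    then have ne: "x \<noteq> e" using assms(3) by auto
    have "1 - e * x > 0" using x assms(3) by auto
    moreover have "1 - \<sigma> * v i x \<ge> 0"
      using v_range[OF assms(1), of x] x assms(2) by (auto simp: abs_le_iff)
    ultimately have "len i * (\<sigma> * e * quot e i t) \<ge> 0"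
      using eq[of t] zero_le_mult_iff[of "len i * (\<sigma> * e * quot e i t)" "1 - e * x"]
      unfolding x_def[symmetric] by simp
    then have nn: "\<sigma> * e * quot e i t \<ge> 0"
      using len_pos[OF assms(1)] by (simp add: zero_le_mult_iff)
    have "\<exists>\<xi>\<in>{min x e..max x e}. v i e - v i x = (e - x) * dv i \<xi>"
      by (rule MVT_within_interval[OF deriv_v[OF assms(1)]]) (use x assms(3) in auto)
    then obtain \<xi> where "\<xi> \<in> {min x e..max x e}" and \<xi>2: "v i e - v i x = (e - x) * dv i \<xi>"
      by blast
    then have "\<xi> \<in> {-1..1}"
      using x assms(3) by auto
    moreover have "(v i e - v i x) / (e - x) = dv i \<xi>"
      using ne unfolding \<xi>2 by simp
    ultimately have \<xi>: "\<xi> \<in> {-1..1}" "(v i e - v i x) / (e - x) = dv i \<xi>" .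
    have "\<bar>\<sigma> * e * quot e i t\<bar> = \<bar>dv i \<xi>\<bar> / len i"
      using ne \<xi>(2) len_pos[OF assms(1)] assms(2,3) by (auto simp: quot_def x_def abs_mult)
    also have "\<dots> \<ge> 1 / B"
      using dv_lower[OF assms(1) \<xi>(1)] len_pos[OF assms(1)] BM by (simp add: field_simps)
    finally show ?thesis using nn by simp
  qed
  have "continuous_on UNIV (quot e i)"
    using regular_family_continuous[OF regular_quotient valid, OF assms(3,1)]
    by (simp add: quot_def[abs_def])
  then have "continuous_on UNIV (\<lambda>t. - (\<sigma> * e * quot e i t))"
    by (intro continuous_intros)
  then have "- (\<sigma> * e * quot e i t) \<le> - (1 / B)"
    by (rule le_if_le_off_sin_double_zeros) (use off in auto)
  then show "1 / B \<le> \<sigma> * e * quot e i t" by simp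
qed

text \<open>\<open>d\<close> is the scale of the distance to \<sigma>: it will be the branch length
  when v touches \<sigma> and the gap otherwise. \<tau> is a signed root of the vanishing factor,
  from 1 - cos (2 * t) = 2 * (sin t)^2 and 1 + cos (2 * t) = 2 * (cos t)^2, and records at which end
  of [-1, 1] the value \<sigma> is taken.\<close>

definition endpoint_factor ::
    "real \<Rightarrow> real \<Rightarrow> ('i \<Rightarrow> real \<Rightarrow> real) \<Rightarrow> ('i \<Rightarrow> real) \<Rightarrow> ('i \<Rightarrow> real \<Rightarrow> real) \<Rightarrow> 'i \<Rightarrow> bool" where
  "endpoint_factor \<sigma> c \<rho> d \<tau> i \<longleftrightarrow> d i > 0 \<and> len i \<le> max 1 M * d i \<and>
    (\<forall>t. c \<le> \<rho> i t \<and> \<rho> i (t + 2 * pi) = \<rho> i t \<and> 1 - \<sigma> * v i (cos (2 * t)) = d i * \<rho> i t * (\<tau> i t)\<^sup>2) \<and>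
    (\<tau> i = (\<lambda>_. 1) \<or> v i 1 = \<sigma> \<and> \<tau> i = (\<lambda>t. sqrt 2 * sin t) \<or>
       v i (-1) = \<sigma> \<and> \<tau> i = (\<lambda>t. sqrt 2 * cos t))"

lemma factor_at_endpoint:
  assumes \<sigma>: "\<sigma> \<in> {-1, 1}"
  shows "\<exists>c \<rho> d \<tau>. c > 0 \<and> regular_family D I \<rho> \<and> (\<forall>i\<in>I. endpoint_factor \<sigma> c \<rho> d \<tau> i)"
proof -
  have "\<forall>i\<in>{i \<in> I. v i 1 \<noteq> \<sigma> \<and> v i (-1) \<noteq> \<sigma>}. \<exists>d. d > 0 \<and> len i \<le> M * d \<and>
      (\<forall>x\<in>{-1..1}. d \<le> 1 - \<sigma> * v i x \<and> 1 - \<sigma> * v i x \<le> d + len i)"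
    using gap \<sigma> by blast
  from bchoice[OF this] obtain d where
    d: "\<And>i. i \<in> I \<Longrightarrow> v i 1 \<noteq> \<sigma> \<Longrightarrow> v i (-1) \<noteq> \<sigma> \<Longrightarrow> d i > 0 \<and> len i \<le> M * d i \<and>
      (\<forall>x\<in>{-1..1}. d i \<le> 1 - \<sigma> * v i x \<and> 1 - \<sigma> * v i x \<le> d i + len i)"
    by auto
  define T1 where "T1 = {i \<in> I. v i 1 = \<sigma>}"
  define T2 where "T2 = {i \<in> I. v i 1 \<noteq> \<sigma> \<and> v i (-1) = \<sigma>}"
  define N where "N = {i \<in> I. v i 1 \<noteq> \<sigma> \<and> v i (-1) \<noteq> \<sigma>}"
  define \<rho> where "\<rho> = (\<lambda>i t. if v i 1 = \<sigma> then \<sigma> * quot 1 i t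
     else if v i (-1) = \<sigma> then \<sigma> * (-1) * quot (-1) i t else (1 - \<sigma> * v i (cos (2 * t))) / d i)"
  define d' where "d' = (\<lambda>i. if v i 1 = \<sigma> \<or> v i (-1) = \<sigma> then len i else d i)"
  define \<tau> where "\<tau> = (\<lambda>i (t::real). if v i 1 = \<sigma> then sqrt 2 * sin t
     else if v i (-1) = \<sigma> then sqrt 2 * cos t else 1)"
  \<comment> \<open>Lower bound of \<rho>: 1 / B for touching branches, and 1 for the others, where
    1 - \<sigma> * v >= d.\<close>
  define c where "c = min 1 (1 / B)"
  have regq: "regular_family D I (quot e)" if "e \<in> {-1, 1}" for e
    using regular_quotient[OF that] by (simp add: quot_def[abs_def])
  have "regular_family D T1 \<rho>"
  proof (rule regular_family_cong)
    show "regular_family D T1 (\<lambda>i t. \<sigma> * quot 1 i t)"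
      by (intro regular_family_mult regular_family_const[of _ _ 1] regular_family_subset[OF regq])
         (use \<sigma> in \<open>auto simp: T1_def\<close>)
  qed (auto simp: \<rho>_def T1_def)
  moreover have "regular_family D T2 \<rho>"
  proof (rule regular_family_cong)
    show "regular_family D T2 (\<lambda>i t. \<sigma> * (-1) * quot (-1) i t)"
      by (intro regular_family_mult regular_family_const[of _ _ 1] regular_family_subset[OF regq])
         (use \<sigma> in \<open>auto simp: T2_def\<close>)
  qed (auto simp: \<rho>_def T2_def)
  moreover have "regular_family D N \<rho>"
  proof (rule regular_family_cong)
    have N: "d i > 0" "len i \<le> M * d i" "d i \<le> 1 - \<sigma> * v i 1" "1 - \<sigma> * v i 1 \<le> d i + len i" if "i \<in> N" for i
      using d[of i] that by (auto simp: N_def)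
    \<comment> \<open>An affine image of the family in \<open>regular_v\<close>; its coefficients
      are bounded because len <= M * d.\<close>
    show "regular_family D N (\<lambda>i t. (1 - \<sigma> * v i 1) / d i +
        - \<sigma> * (len i / d i) * ((v i (cos (2 * t)) - v i 1) / len i))"
    proof (intro regular_family_add regular_family_mult regular_family_subset[OF regular_v])
      show "regular_family D N (\<lambda>i t. (1 - \<sigma> * v i 1) / d i)"
      proof (rule regular_family_const[of _ _ "1 + M"])
        fix i assume i: "i \<in> N"
        have "0 \<le> 1 - \<sigma> * v i 1" "1 - \<sigma> * v i 1 \<le> (1 + M) * d i"
          using N[OF i] by (auto simp: algebra_simps)
        then show "\<bar>(1 - \<sigma> * v i 1) / d i\<bar> \<le> 1 + M"
          using N(1)[OF i] by (simp add: abs_divide pos_divide_le_eq)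
      qed
      show "regular_family D N (\<lambda>i t. - \<sigma>)"
        by (rule regular_family_const[of _ _ 1]) (use \<sigma> in auto)
      show "regular_family D N (\<lambda>i t. len i / d i)"
      proof (rule regular_family_const[of _ _ M])
        fix i assume i: "i \<in> N"
        then have "len i > 0" using len_pos by (auto simp: N_def)
        then show "\<bar>len i / d i\<bar> \<le> M"
          using N(1,2)[OF i] by (simp add: abs_divide pos_divide_le_eq)
      qed
    qed (auto simp: N_def)
    show "(1 - \<sigma> * v i 1) / d i + - \<sigma> * (len i / d i) * ((v i (cos (2 * t)) - v i 1) / len i) = \<rho> i t"
      if i: "i \<in> N" for i t
    proof -
      have "len i > 0" using len_pos i by (auto simp: N_def)
      then have "- \<sigma> * (len i / d i) * ((v i (cos (2 * t)) - v i 1) / len i) = - \<sigma> * (v i (cos (2 * t)) - v i 1) / d i"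
        by simp
      then show ?thesis
        using i by (simp add: \<rho>_def N_def add_divide_distrib[symmetric] algebra_simps)
    qed
  qed
  ultimately have "regular_family D (T1 \<union> (T2 \<union> N)) \<rho>"
    by (intro regular_family_Un)
  moreover have "T1 \<union> (T2 \<union> N) = I"
    by (auto simp: T1_def T2_def N_def)
  ultimately have reg: "regular_family D I \<rho>" by simp
  have cos_per: "cos (2 * (t + 2 * pi)) = cos (2 * t)" for t :: real
    by (simp add: cos_add distrib_left)
  have main: "endpoint_factor \<sigma> c \<rho> d' \<tau> i" if i: "i \<in> I" for i
  proof -
    note pos = len_pos[OF i]
    have per: "\<rho> i (t + 2 * pi) = \<rho> i t" for t
      unfolding \<rho>_def quot_def cos_per by (rule refl)
    have len1: "len i \<le> max 1 M * len i"
      using pos mult_right_mono[of 1 "max 1 M" "len i"] by simp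
    consider "v i 1 = \<sigma>" | "v i 1 \<noteq> \<sigma>" "v i (-1) = \<sigma>" | "v i 1 \<noteq> \<sigma>" "v i (-1) \<noteq> \<sigma>" by blast
    then show ?thesis
    proof cases
      case 1
      have "c \<le> \<rho> i t" "1 - \<sigma> * v i (cos (2 * t)) = d' i * \<rho> i t * (\<tau> i t)\<^sup>2" for t
        using touching_quotient[OF i \<sigma> _ 1, of t] 1
        by (auto simp: \<rho>_def c_def d'_def \<tau>_def power_mult_distrib cos_double_sin min.coboundedI2)
      then show ?thesis using 1 pos per len1 by (auto simp: endpoint_factor_def d'_def \<tau>_def)
    next
      case 2
      have "c \<le> \<rho> i t" "1 - \<sigma> * v i (cos (2 * t)) = d' i * \<rho> i t * (\<tau> i t)\<^sup>2" for t
        using touching_quotient[OF i \<sigma> _ 2(2), of t] 2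
        by (auto simp: \<rho>_def c_def d'_def \<tau>_def power_mult_distrib cos_double_cos min.coboundedI2)
      then show ?thesis using 2 pos per len1 by (auto simp: endpoint_factor_def d'_def \<tau>_def)
    next
      case 3
      note d3 = d[OF i 3]
      have "1 \<le> \<rho> i t" for t
        using d3 3 by (auto simp: \<rho>_def pos_le_divide_eq)
      then have "c \<le> \<rho> i t" for t
        unfolding c_def by (meson min.coboundedI1)
      moreover have "1 - \<sigma> * v i (cos (2 * t)) = d' i * \<rho> i t * (\<tau> i t)\<^sup>2" for t
        using 3 d3 by (simp add: \<rho>_def d'_def \<tau>_def)
      moreover have "len i \<le> max 1 M * d i"
      proof -
        have "len i \<le> M * d i" using d3 by simp
        also have "\<dots> \<le> max 1 M * d i" using d3 by (intro mult_right_mono) auto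
        finally show ?thesis .
      qed
      ultimately show ?thesis using 3 d3 per by (simp add: endpoint_factor_def d'_def \<tau>_def)
    qed
  qed
  have "c > 0" using BM by (simp add: c_def)
  show ?thesis
    by (rule exI[of _ c], rule exI[of _ \<rho>], rule exI[of _ d'], rule exI[of _ \<tau>],
        rule conjI[OF \<open>c > 0\<close> conjI[OF reg]], rule ballI, rule main)
qed

lemma phase_exists:
  "\<exists>E g. regular_family D I g \<and> phase_family I g E q \<and> (\<forall>i\<in>I. \<forall>t. Re (E i t) = v i (cos (2 * t)))"
proof -
  obtain d1 \<rho>1 \<tau>1 c1 where c1: "c1 > 0" and r1: "regular_family D I \<rho>1"
    and f1': "\<forall>i\<in>I. endpoint_factor 1 c1 \<rho>1 d1 \<tau>1 i"
    by (atomize_elim, rule factor_at_endpoint) simp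
  note f1 = bspec[OF f1', unfolded endpoint_factor_def]
  obtain d2 \<rho>2 \<tau>2 c2 where c2: "c2 > 0" and r2: "regular_family D I \<rho>2"
    and f2': "\<forall>i\<in>I. endpoint_factor (-1) c2 \<rho>2 d2 \<tau>2 i"
    by (atomize_elim, rule factor_at_endpoint) simp
  note f2 = bspec[OF f2', unfolded endpoint_factor_def]
  \<comment> \<open>The possible cofactors of \<tau>1 * \<tau>2 in sin (2 * t) = 2 * sin t * cos t.
    One of them always fits, because v cannot take both values 1 and -1 at the same point, so sin t
    and cos t each occur at most once in the product.\<close>
  define H where "H = {\<lambda>t. 2 * (sin t * cos t), \<lambda>t. sqrt 2 * cos t, \<lambda>t. sqrt 2 * sin t, \<lambda>t. 1 :: real}"
  have "\<forall>i\<in>I. \<exists>h. h \<in> H \<and> (\<forall>t. \<tau>1 i t * \<tau>2 i t * h t = sin (2 * t))"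
  proof
    fix i assume i: "i \<in> I"
    have sin2: "sin (2 * t) = 2 * (sin t * cos t)" "sqrt 2 * (sqrt 2 * y) = 2 * y" for t y :: real
      by (auto simp: sin_double mult.assoc[symmetric])
    show "\<exists>h. h \<in> H \<and> (\<forall>t. \<tau>1 i t * \<tau>2 i t * h t = sin (2 * t))"
      using f1[OF i] f2[OF i] unfolding H_def Bex_def[symmetric] bex_simps(5) sin2
      by (elim conjE disjE) (auto simp: sin2 mult_ac)
  qed
  from bchoice[OF this] obtain \<tau>' where \<tau>': "\<And>i. i \<in> I \<Longrightarrow> \<tau>' i \<in> H"
    "\<And>i t. i \<in> I \<Longrightarrow> \<tau>1 i t * \<tau>2 i t * \<tau>' i t = sin (2 * t)"
    by auto
  have reg\<tau>': "regular_family D I \<tau>'"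
  proof (rule regular_family_finite_range[OF _ _ \<tau>'(1)])
    show "finite H" by (simp add: H_def)
    show "regular_family D I (\<lambda>i. h)" if "h \<in> H" for h
    proof -
      have "regular_family D I (\<lambda>i t. 2 * (sin t * cos t))" "regular_family D I (\<lambda>i t. sqrt 2 * cos t)"
        "regular_family D I (\<lambda>i t. sqrt 2 * sin t)" "regular_family D I (\<lambda>i t. 1)"
        by (intro regular_family_mult regular_family_sin regular_family_cos regular_family_const[of _ _ 2];
            simp add: real_le_lsqrt)+
      with that show ?thesis by (auto simp: H_def)
    qed
  qed
  define a where "a = (\<lambda>i t. dv i (cos (2 * t)) / len i)"
  \<comment> \<open>Bounded by max 1 M: \<open>len\<close> is at most this multiple of
    \<open>d1\<close> and of \<open>d2\<close>, hence of their geometric mean.\<close>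
  define \<gamma> where "\<gamma> = (\<lambda>i. len i / sqrt (d1 i * d2 i))"
  define g where "g = (\<lambda>i t. 2 * \<gamma> i * a i t * (1 / sqrt (\<rho>1 i t)) * (1 / sqrt (\<rho>2 i t)) * \<tau>' i t)"
  define V where "V = (\<lambda>i t. v i (cos (2 * t)))"
  \<comment> \<open>The factors \<tau> keep their signs, so S may change sign at its zeros; the
    nonnegative root of 1 - V^2 would have corners there.\<close>
  define S where "S = (\<lambda>i t. sqrt (d1 i * d2 i) * (sqrt (\<rho>1 i t) * sqrt (\<rho>2 i t)) * (\<tau>1 i t * \<tau>2 i t))"
  have regg: "regular_family D I g"
    unfolding g_def
  proof (intro regular_family_mult reg\<tau>' regular_family_inverse_sqrt[OF r1 c1] regular_family_inverse_sqrt[OF r2 c2])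
    show "regular_family D I (\<lambda>i t. 2)" by (rule regular_family_const[of _ _ 2]) auto
    show "regular_family D I a" unfolding a_def by (rule regular_dv)
    show "regular_family D I (\<lambda>i t. \<gamma> i)"
    proof (rule regular_family_const[of _ _ "max 1 M"])
      fix i assume i: "i \<in> I"
      have d: "d1 i > 0" "d2 i > 0" "len i \<le> max 1 M * d1 i" "len i \<le> max 1 M * d2 i" "len i > 0"
        using f1[OF i] f2[OF i] len_pos[OF i] by auto
      have "len i * len i \<le> (max 1 M * d1 i) * (max 1 M * d2 i)"
        using d by (intro mult_mono) auto
      also have "\<dots> = (max 1 M)\<^sup>2 * (d1 i * d2 i)" by (simp add: power2_eq_square mult_ac)
      finally have "sqrt ((len i)\<^sup>2) \<le> sqrt ((max 1 M)\<^sup>2 * (d1 i * d2 i))"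
        by (intro real_sqrt_le_mono) (simp add: power2_eq_square)
      then have "len i \<le> max 1 M * sqrt (d1 i * d2 i)"
        using d(5) by (simp add: real_sqrt_mult)
      moreover have "sqrt (d1 i * d2 i) > 0" using d by simp
      ultimately have "\<gamma> i \<le> max 1 M" unfolding \<gamma>_def by (simp only: pos_divide_le_eq)
      moreover have "\<gamma> i \<ge> 0" using d by (simp add: \<gamma>_def)
      ultimately show "\<bar>\<gamma> i\<bar> \<le> max 1 M" by simp
    qed
  qed (use f1 f2 in auto)
  have cos_per: "cos (2 * (t + 2 * pi)) = cos (2 * t)" for t :: real
    by (simp add: cos_add distrib_left)
  define E where "E = (\<lambda>i t. Complex (V i t) (S i t))"
  have "continuous_on UNIV (E i) \<and> (\<forall>t.
     cmod (E i t) = 1 \<and> E i (t + 2 * pi) = E i t \<and> Re (E i t) = v i (cos (2 * t)) \<and>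
     \<bar>g i t\<bar> \<le> 2 * q \<and> g i (t + 2 * pi) = g i t \<and>
     (sin (2 * t) \<noteq> 0 \<longrightarrow> (E i has_vector_derivative \<i> * of_real (g i t) * E i t) (at t)))" if i: "i \<in> I" for i
  proof -
    have d: "d1 i > 0" "d2 i > 0" "len i > 0" and \<rho>: "\<rho>1 i t > 0" "\<rho>2 i t > 0" for t
      using f1[OF i] f2[OF i] len_pos[OF i] c1 c2 by (auto intro: less_le_trans)
    have \<tau>c: "continuous_on UNIV (\<tau>1 i)" "continuous_on UNIV (\<tau>2 i)"
      using f1[OF i] f2[OF i] by (auto intro!: continuous_intros)
    have \<tau>per: "\<tau>1 i (t + 2 * pi) = \<tau>1 i t" "\<tau>2 i (t + 2 * pi) = \<tau>2 i t" for t
      using f1[OF i] f2[OF i] by auto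
    have \<tau>'per: "\<tau>' i (t + 2 * pi) = \<tau>' i t" for t
      using \<tau>'(1)[OF i] by (auto simp: H_def)
    have Vc: "continuous_on UNIV (V i)"
      unfolding V_def by (rule continuous_on_compose2[OF continuous_v[OF i]]) (auto intro!: continuous_intros)
    have Sc: "continuous_on UNIV (S i)"
      unfolding S_def
      by (intro continuous_intros \<tau>c regular_family_continuous[OF r1 valid i] regular_family_continuous[OF r2 valid i])
    have S2: "(S i t)\<^sup>2 = 1 - (V i t)\<^sup>2" for t
    proof -
      have "(S i t)\<^sup>2 = (d1 i * \<rho>1 i t * (\<tau>1 i t)\<^sup>2) * (d2 i * \<rho>2 i t * (\<tau>2 i t)\<^sup>2)"
      proof -
        have "(sqrt (d1 i * d2 i))\<^sup>2 = d1 i * d2 i" "(sqrt (\<rho>1 i t))\<^sup>2 = \<rho>1 i t" "(sqrt (\<rho>2 i t))\<^sup>2 = \<rho>2 i t"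
          using d \<rho>[of t] by (auto intro!: real_sqrt_pow2)
        then show ?thesis
          unfolding S_def power_mult_distrib by (simp only: mult_ac)
      qed
      also have "\<dots> = (1 - 1 * V i t) * (1 - (-1) * V i t)"
        using f1[OF i] f2[OF i] by (simp only: V_def)
      also have "\<dots> = 1 - (V i t)\<^sup>2" by (simp add: power2_eq_square algebra_simps)
      finally show ?thesis .
    qed
    \<comment> \<open>The relation g = 2 * sin (2 * t) * v' / S multiplied out, so that it makes
      sense at the zeros of S too.\<close>
    have gS: "g i t * S i t = 2 * sin (2 * t) * dv i (cos (2 * t))" for t
    proof -
      have nz: "sqrt (d1 i * d2 i) \<noteq> 0" "sqrt (\<rho>1 i t) \<noteq> 0" "sqrt (\<rho>2 i t) \<noteq> 0" "len i \<noteq> 0"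
        using d \<rho>[of t] by auto
      have "2 * (l / s) * (y / l) * (1 / r) * (1 / r') * w * (s * (r * r') * (u * u')) = 2 * (u * u' * w) * y"
        if "s \<noteq> 0" "r \<noteq> 0" "r' \<noteq> 0" "l \<noteq> 0" for l s y r r' w u u' :: real
        using that by (simp add: field_simps)
      from this[OF nz] have "g i t * S i t = 2 * (\<tau>1 i t * \<tau>2 i t * \<tau>' i t) * dv i (cos (2 * t))"
        unfolding g_def S_def \<gamma>_def a_def .
      then show ?thesis by (simp only: \<tau>'(2)[OF i])
    qed
    have Snz: "S i t \<noteq> 0" if "sin (2 * t) \<noteq> 0" for t
      using \<tau>'(2)[OF i, of t] that d \<rho>[of t] by (auto simp: S_def)
    have Vd: "(V i has_real_derivative - (g i t * S i t)) (at t)" if "sin (2 * t) \<noteq> 0" for t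
    proof -
      have "((\<lambda>t. cos (2 * t)) has_real_derivative - (2 * sin (2 * t))) (at t)"
        by (auto intro!: derivative_eq_intros)
      from DERIV_chain2[OF deriv_v_interior[OF i cos_double_open[OF that]] this]
      show ?thesis unfolding V_def gS by (simp add: mult_ac)
    qed
    have Sd: "(S i has_real_derivative g i t * V i t) (at t)" if "sin (2 * t) \<noteq> 0" for t
      by (rule has_real_derivative_circle[OF Sc S2 Snz[OF that] Vd[OF that]])
    have Ed: "(E i has_vector_derivative \<i> * of_real (g i t) * E i t) (at t)" if t: "sin (2 * t) \<noteq> 0" for t
    proof -
      have "E i = (\<lambda>t. of_real (V i t) + \<i> * of_real (S i t))"
        by (auto simp: E_def complex_eq_iff)
      moreover have "((\<lambda>t. of_real (V i t) + \<i> * of_real (S i t)) has_vector_derivative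
          of_real (- (g i t * S i t)) + \<i> * of_real (g i t * V i t)) (at t)"
        by (intro has_vector_derivative_add has_vector_derivative_mult_right has_vector_derivative_of_real Vd Sd t)
      moreover have "of_real (- (g i t * S i t)) + \<i> * of_real (g i t * V i t) = \<i> * of_real (g i t) * E i t"
        by (simp add: E_def complex_eq_iff)
      ultimately show ?thesis by (simp only:)
    qed
    \<comment> \<open>With x = cos (2 * t) the roots in \<open>expansion\<close> become |sin (2 *
      t)| and |S|, and |S| cancels where sin (2 * t) is nonzero.\<close>
    have gb: "\<bar>g i t\<bar> \<le> 2 * q" if t: "sin (2 * t) \<noteq> 0" for t
    proof -
      have sq: "sqrt (1 - (V i t)\<^sup>2) = \<bar>S i t\<bar>" "sqrt (1 - (cos (2 * t))\<^sup>2) = \<bar>sin (2 * t)\<bar>"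
        using S2[of t] sin_squared_eq[of "2 * t"] by (metis real_sqrt_abs)+
      have "\<bar>g i t\<bar> * \<bar>S i t\<bar> = 2 * (\<bar>sin (2 * t)\<bar> * \<bar>dv i (cos (2 * t))\<bar>)"
        unfolding abs_mult[symmetric] gS by (simp add: abs_mult)
      also have "\<dots> \<le> 2 * (q * \<bar>S i t\<bar>)"
        using expansion[OF i cos_double_open[OF t]] sq unfolding V_def by simp
      finally have "\<bar>g i t\<bar> * \<bar>S i t\<bar> \<le> 2 * q * \<bar>S i t\<bar>" by simp
      then show ?thesis using Snz[OF t] by (simp add: mult_le_cancel_right)
    qed
    have gball: "\<bar>g i t\<bar> \<le> 2 * q" for t
    proof (rule le_if_le_off_sin_double_zeros[OF _ gb])
      show "continuous_on UNIV (\<lambda>t. \<bar>g i t\<bar>)"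
        by (intro continuous_intros regular_family_continuous[OF regg valid i])
    qed
    have gper: "g i (t + 2 * pi) = g i t" for t
      using f1[OF i] f2[OF i] unfolding g_def a_def cos_per \<tau>'per by simp
    have Eper: "E i (t + 2 * pi) = E i t" for t
      using f1[OF i] f2[OF i] unfolding E_def V_def S_def cos_per \<tau>per by simp
    have "continuous_on UNIV (E i)"
      unfolding E_def Complex_eq using Vc Sc by (intro continuous_intros)
    moreover have "cmod (E i t) = 1" for t
      using S2[of t] by (simp add: E_def cmod_def)
    moreover have "Re (E i t) = v i (cos (2 * t))" for t
      by (simp add: E_def V_def)
    ultimately show ?thesis
      using Ed gball gper Eper by simp
  qed
  with regg show ?thesis
    by (intro exI[of _ E] exI[of _ g]) (simp add: phase_family_def)
qed

text \<open>The point z may lie on the lower half circle, since S changes sign; its argument is then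
  minus the arccosine, and cosine is even.\<close>

lemma cheb_eq_Re_power:
  assumes "cmod z = 1"
  shows "cheb k (Re z) = Re (z ^ k)"
proof -
  have R: "\<bar>Re z\<bar> \<le> 1" using abs_Re_le_cmod[of z] assms by simp
  define \<phi> where "\<phi> = arccos (Re z)"
  have c: "cos \<phi> = Re z" using R by (simp add: \<phi>_def abs_le_iff)
  have "(Im z)\<^sup>2 = (sin \<phi>)\<^sup>2"
    using assms c by (simp add: cmod_def sin_squared_eq)
  then have "Im z = sin \<phi> \<or> Im z = - sin \<phi>" by (simp add: power2_eq_iff)
  then have "z = cis \<phi> \<or> z = cis (- \<phi>)"
    using c by (auto simp: complex_eq_iff)
  then show ?thesis
    unfolding cheb_def \<phi>_def[symmetric] by (elim disjE) (simp_all add: Complex.DeMoivre)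
qed

text \<open>\<open>cheb k\<close> of v is half the sum of E ^ k and its conjugate, and the conjugate
  of E is a phase with -g in place of g. Both integrals keep the factor exp (2 * i * j * t): the sum
  of conjugates is real, so taking the real part produces the cosine. Normalising v' brings the
  factor \<open>len\<close> out of the bound.\<close>

lemma branch_integral_decay:
  assumes "p > q" "p > 0"
  shows "\<exists>K\<in>kappa D. \<forall>i\<in>I. \<forall>j k. \<forall>y. k = 0 \<or> real j / real k > p \<longrightarrow>
    ((\<lambda>t. dv i (cos (2 * t)) * cheb k (v i (cos (2 * t))) * cos (2 * real j * t)) has_integral y)
      {pi / 4..pi / 4 + 2 * pi} \<longrightarrow> \<bar>y\<bar> \<le> len i * K \<bar>real j - p * real k\<bar>"
proof -
  obtain E g where g: "regular_family D I g"
    and ph: "phase_family I g E q" and ReE: "\<And>i t. i \<in> I \<Longrightarrow> Re (E i t) = v i (cos (2 * t))"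
    using phase_exists by blast
  note E = phase_familyD[OF ph]
  define A where "A = (\<lambda>i t. dv i (cos (2 * t)) / len i)"
  have A: "regular_family D I A" unfolding A_def by (rule regular_dv)
  have cos_per: "cos (2 * (t + 2 * pi)) = cos (2 * t)" for t :: real
    by (simp add: cos_add distrib_left)
  have Aper: "A i (t + 2 * pi) = A i t" for i t
    unfolding A_def cos_per by (rule refl)
  have "\<exists>K\<in>kappa D. \<forall>i\<in>I. \<forall>j k. \<forall>y. k = 0 \<or> real j / real k > p \<longrightarrow>
    osc_integral (A i) (E i) j k y \<longrightarrow> cmod y \<le> K \<bar>real j - p * real k\<bar>"
    by (rule regular_oscillation[OF valid A g ph]) (use assms ph Aper in auto)
  then obtain K1 where K1: "K1 \<in> kappa D" "\<forall>i\<in>I. \<forall>j k. \<forall>y. k = 0 \<or> real j / real k > p \<longrightarrow>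
    osc_integral (A i) (E i) j k y \<longrightarrow> cmod y \<le> K1 \<bar>real j - p * real k\<bar>"
    by (elim bexE)
  have g': "regular_family D I (\<lambda>i t. - 1 * g i t)"
    by (intro regular_family_mult g regular_family_const[of _ _ 1]) auto
  have E': "((\<lambda>t. cnj (E i t)) has_vector_derivative \<i> * of_real (- 1 * g i t) * cnj (E i t)) (at t)"
    if "i \<in> I" "sin (2 * t) \<noteq> 0" for i t
  proof -
    have "(E i has_vector_derivative \<i> * of_real (g i t) * E i t) (at t)" using E(6)[OF that] .
    then have "((\<lambda>t. cnj (E i t)) has_vector_derivative cnj (\<i> * of_real (g i t) * E i t)) (at t)"
      by (rule has_vector_derivative_cnj)
    then show ?thesis by simp
  qed
  have "\<exists>K\<in>kappa D. \<forall>i\<in>I. \<forall>j k. \<forall>y. k = 0 \<or> real j / real k > p \<longrightarrow>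
    osc_integral (A i) (\<lambda>t. cnj (E i t)) j k y \<longrightarrow> cmod y \<le> K \<bar>real j - p * real k\<bar>"
  proof (rule regular_oscillation[OF valid A g'])
    show "phase_family I (\<lambda>i t. - 1 * g i t) (\<lambda>i t. cnj (E i t)) q"
      unfolding phase_family_def using E E' by (auto intro!: continuous_intros)
  qed (use assms Aper in auto)
  then obtain K2 where K2: "K2 \<in> kappa D" "\<forall>i\<in>I. \<forall>j k. \<forall>y. k = 0 \<or> real j / real k > p \<longrightarrow>
    osc_integral (A i) (\<lambda>t. cnj (E i t)) j k y \<longrightarrow> cmod y \<le> K2 \<bar>real j - p * real k\<bar>"
    by (elim bexE)
  obtain K where K: "K \<in> kappa D" "\<And>x. x \<ge> 0 \<Longrightarrow> K1 x + K2 x \<le> K x"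
    using kappa_add[OF K1(1) K2(1)] by blast
  have "\<bar>y\<bar> \<le> len i * K \<bar>real j - p * real k\<bar>"
    if i: "i \<in> I" and jk: "k = 0 \<or> real j / real k > p"
      and y: "((\<lambda>t. dv i (cos (2 * t)) * cheb k (v i (cos (2 * t))) * cos (2 * real j * t)) has_integral y)
      {pi / 4..pi / 4 + 2 * pi}" for i j k y
  proof -
    define F1 where "F1 = (\<lambda>t. of_real (A i t) * (E i t ^ k * exp (\<i> * of_real (2 * real j * t))))"
    define F2 where "F2 = (\<lambda>t. of_real (A i t) * (cnj (E i t) ^ k * exp (\<i> * of_real (2 * real j * t))))"
    have Ac: "continuous_on UNIV (A i)" "continuous_on UNIV (E i)"
      using regular_family_continuous[OF A valid i] E(1)[OF i] by auto
    have "F1 integrable_on {pi / 4..pi / 4 + 2 * pi}" "F2 integrable_on {pi / 4..pi / 4 + 2 * pi}"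
      unfolding F1_def F2_def
      by (intro integrable_continuous_real continuous_intros continuous_on_subset[OF Ac(1)] continuous_on_subset[OF Ac(2)]; simp)+
    then obtain y1 y2 where y12: "(F1 has_integral y1) {pi / 4..pi / 4 + 2 * pi}"
      "(F2 has_integral y2) {pi / 4..pi / 4 + 2 * pi}" by (auto simp: integrable_on_def)
    have b: "cmod y1 \<le> K1 \<bar>real j - p * real k\<bar>" "cmod y2 \<le> K2 \<bar>real j - p * real k\<bar>"
      by (rule K1(2)[unfolded osc_integral_def, rule_format, OF i jk y12(1)[unfolded F1_def]],
          rule K2(2)[unfolded osc_integral_def, rule_format, OF i jk y12(2)[unfolded F2_def]])
    have eq: "dv i (cos (2 * t)) * cheb k (v i (cos (2 * t))) * cos (2 * real j * t) = Re (of_real (len i / 2) * (F1 t + F2 t))" for t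
    proof -
      have "cheb k (v i (cos (2 * t))) = Re (E i t ^ k)"
        using cheb_eq_Re_power[OF E(2)[OF i], of k t] by (simp only: ReE[OF i])
      moreover have "exp (\<i> * of_real (2 * real j * t)) = cis (2 * real j * t)"
        by (simp add: cis_conv_exp)
      then have "F1 t + F2 t = of_real (A i t) * ((E i t ^ k + cnj (E i t ^ k)) * cis (2 * real j * t))"
        unfolding F1_def F2_def complex_cnj_power by (simp only: distrib_left distrib_right)
      then have "Re (F1 t + F2 t) = A i t * (2 * Re (E i t ^ k) * cos (2 * real j * t))"
        unfolding complex_add_cnj by (simp)
      moreover have "dv i (cos (2 * t)) = len i * A i t"
        using len_pos[OF i] by (simp add: A_def)
      moreover have "Re (of_real (len i / 2) * (F1 t + F2 t)) = len i / 2 * Re (F1 t + F2 t)"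
        by (simp only: scaleR_conv_of_real[symmetric] scaleR_complex.sel)
      ultimately show ?thesis by simp
    qed
    have "((\<lambda>t. Re (of_real (len i / 2) * (F1 t + F2 t))) has_integral Re (of_real (len i / 2) * (y1 + y2)))
       {pi / 4..pi / 4 + 2 * pi}"
      by (intro has_integral_Re has_integral_mult_right has_integral_add y12)
    then have "y = Re (of_real (len i / 2) * (y1 + y2))"
      using y unfolding eq by (rule has_integral_unique[rotated])
    then have "\<bar>y\<bar> \<le> cmod (of_real (len i / 2) * (y1 + y2))"
      using abs_Re_le_cmod by metis
    also have "\<dots> \<le> len i / 2 * (cmod y1 + cmod y2)"
      using len_pos[OF i] norm_triangle_ineq[of y1 y2] by (simp add: norm_mult)
    also have "\<dots> \<le> len i * (K1 \<bar>real j - p * real k\<bar> + K2 \<bar>real j - p * real k\<bar>)"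
    proof -
      have "cmod y1 + cmod y2 \<le> K1 \<bar>real j - p * real k\<bar> + K2 \<bar>real j - p * real k\<bar>" "0 \<le> cmod y1 + cmod y2"
        using b by auto
      then show ?thesis using len_pos[OF i] by (intro mult_mono) auto
    qed
    also have "\<dots> \<le> len i * K \<bar>real j - p * real k\<bar>"
      using K(2) len_pos[OF i] by (intro mult_left_mono) auto
    finally show ?thesis .
  qed
  with K(1) show ?thesis by blast
qed

end

subsection \<open>Summation over the branches\<close>

text \<open>The Jacobian 2 * sin (2 * t) of x = cos (2 * t) cancels the singular weight, which gives
  integrability as well as the value.\<close>

lemma chebyshev_weight_integral:
  assumes h: "continuous_on {-1..1} h"
  shows "set_integrable lborel {-1<..<1} (\<lambda>x. h x / sqrt (1 - x\<^sup>2) :: real)"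
    and "(LBINT x:{-1<..<1}. h x / sqrt (1 - x\<^sup>2)) = integral {0..pi / 2} (\<lambda>t. 2 * h (cos (2 * t)))"
proof -
  let ?S = "{0<..<pi / 2}" and ?f = "\<lambda>x. h x / sqrt (1 - x\<^sup>2)"
  have img: "(\<lambda>t. cos (2 * t)) ` ?S = {-1<..<1}"
  proof
    show "(\<lambda>t. cos (2 * t)) ` ?S \<subseteq> {-1<..<1}"
    proof clarify
      fix t :: real assume "t \<in> ?S"
      then have "sin (2 * t) > 0" by (intro sin_gt_zero) auto
      then show "cos (2 * t) \<in> {-1<..<1}" using cos_double_open by fastforce
    qed
    show "{-1<..<1} \<subseteq> (\<lambda>t. cos (2 * t)) ` ?S"
    proof
      fix x :: real assume x: "x \<in> {-1<..<1}"
      then have "x = cos (2 * (arccos x / 2))" "arccos x / 2 \<in> ?S"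
        using arccos_lt_bounded[of x] by auto
      then show "x \<in> (\<lambda>t. cos (2 * t)) ` ?S" by blast
    qed
  qed
  have inj: "inj_on (\<lambda>t. cos (2 * t)) ?S"
  proof (rule inj_onI)
    fix s t assume "s \<in> ?S" "t \<in> ?S" "cos (2 * s) = cos (2 * t)"
    then show "s = t" using cos_inj_pi[of "2 * s" "2 * t"] by auto
  qed
  have eq: "\<bar>- (2 * sin (2 * t))\<bar> * ?f (cos (2 * t)) = 2 * h (cos (2 * t))" if "t \<in> ?S" for t
  proof -
    have "sin (2 * t) > 0" using that by (intro sin_gt_zero) auto
    moreover have "sqrt (1 - (cos (2 * t))\<^sup>2) = \<bar>sin (2 * t)\<bar>"
      using sin_squared_eq[of "2 * t"] by (metis real_sqrt_abs)
    ultimately show ?thesis by simp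
  qed
  have cont: "continuous_on {0..pi / 2} (\<lambda>t. 2 * h (cos (2 * t)))"
    by (intro continuous_intros continuous_on_compose2[OF h]) auto
  have "(\<lambda>t. 2 * h (cos (2 * t))) absolutely_integrable_on {0..pi / 2}"
    by (rule absolutely_integrable_continuous_real[OF cont])
  then have "(\<lambda>t. 2 * h (cos (2 * t))) absolutely_integrable_on ?S"
    by (rule set_integrable_subset) auto
  moreover have "integral ?S (\<lambda>t. 2 * h (cos (2 * t))) = integral {0..pi / 2} (\<lambda>t. 2 * h (cos (2 * t)))"
    by (simp add: integral_open_interval_real)
  moreover have "(\<lambda>t. \<bar>- (2 * sin (2 * t))\<bar> * ?f (cos (2 * t))) absolutely_integrable_on ?S \<longleftrightarrow>
      (\<lambda>t. 2 * h (cos (2 * t))) absolutely_integrable_on ?S"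
    by (intro set_integrable_cong refl eq) auto
  moreover have "integral ?S (\<lambda>t. \<bar>- (2 * sin (2 * t))\<bar> * ?f (cos (2 * t))) = integral ?S (\<lambda>t. 2 * h (cos (2 * t)))"
    by (intro integral_cong eq)
  ultimately have lhs: "(\<lambda>t. \<bar>- (2 * sin (2 * t))\<bar> * ?f (cos (2 * t))) absolutely_integrable_on ?S \<and>
      integral ?S (\<lambda>t. \<bar>- (2 * sin (2 * t))\<bar> * ?f (cos (2 * t))) = integral {0..pi / 2} (\<lambda>t. 2 * h (cos (2 * t)))"
    by (simp only:)
  have "?f absolutely_integrable_on ((\<lambda>t. cos (2 * t)) ` ?S) \<and>
      integral ((\<lambda>t. cos (2 * t)) ` ?S) ?f = integral {0..pi / 2} (\<lambda>t. 2 * h (cos (2 * t)))"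
    by (rule has_absolute_integral_change_of_variables_1'[THEN iffD1, OF _ _ inj lhs])
       (auto intro!: derivative_eq_intros)
  then have f: "set_integrable lebesgue {-1<..<1} ?f"
    "integral {-1<..<1} ?f = integral {0..pi / 2} (\<lambda>t. 2 * h (cos (2 * t)))"
    unfolding img by auto
  \<comment> \<open>The change of variables is a statement about Lebesgue measure; Borel
    measurability brings it back to \<open>lborel\<close>.\<close>
  have "continuous_on {-1<..<1} ?f"
    by (intro continuous_intros continuous_on_subset[OF h]) (auto simp: power2_eq_1_iff)
  then have "(\<lambda>x. indicator {-1<..<1} x *\<^sub>R ?f x) \<in> borel_measurable borel"
    by (rule borel_measurable_continuous_on_indicator[rotated]) auto
  then have "set_integrable lborel {-1<..<1} ?f"
    using f(1) unfolding set_integrable_def by (subst (asm) integrable_completion) auto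
  then show "set_integrable lborel {-1<..<1} ?f" .
  from set_borel_integral_eq_integral(2)[OF this] f(2)
  show "(LBINT x:{-1<..<1}. ?f x) = integral {0..pi / 2} (\<lambda>t. 2 * h (cos (2 * t)))" by simp
qed

text \<open>The interval covers two periods of length pi, and each period counts [0, pi / 2] twice
  by the reflection t -> pi - t. In terms of a primitive F both symmetries say that a combination of
  values of F has derivative zero.\<close>

lemma integral_quarter_period:
  fixes P :: "real \<Rightarrow> real"
  assumes "continuous_on UNIV P" "\<And>t. P (t + pi) = P t" "\<And>t. P (- t) = P t"
  shows "integral {pi / 4..pi / 4 + 2 * pi} P = 4 * integral {0..pi / 2} P"
proof -
  have "\<exists>F. \<forall>x. (F has_vector_derivative P x) (at x)"
    using einterval_antiderivative[of "-\<infinity>" "\<infinity>" P] assms(1) by (auto simp: continuous_on_eq_continuous_at)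
  then obtain F where F: "\<And>x. (F has_real_derivative P x) (at x)"
    by (auto simp: has_real_derivative_iff_has_vector_derivative)
  have I: "integral {a..b} P = F b - F a" if "a \<le> b" for a b
    by (intro integral_unique fundamental_theorem_of_calculus that)
       (use F in \<open>auto simp: has_real_derivative_iff_has_vector_derivative[symmetric] intro: has_field_derivative_at_within\<close>)
  have "((\<lambda>t. F (t + pi) - F t) has_real_derivative 0) (at t)" for t
    using DERIV_diff[OF F[of "t + pi", unfolded DERIV_shift] F[of t]] assms(2) by simp
  then have c: "F (s + pi) - F s = F (t + pi) - F t" for s t
    using DERIV_isconst_all[of "\<lambda>t. F (t + pi) - F t" s t] by blast
  have "((\<lambda>t. F (pi - t) + F t) has_real_derivative 0) (at t)" for t
  proof -
    have "((\<lambda>t. pi - t) has_real_derivative -1) (at t)" by (auto intro!: derivative_eq_intros)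
    from DERIV_chain2[OF F this] have "((\<lambda>t. F (pi - t)) has_real_derivative - P (pi - t)) (at t)" by simp
    moreover have "P (pi - t) = P t" using assms(2)[of "- t"] assms(3)[of t] by (simp add: add.commute)
    ultimately show ?thesis using DERIV_add[OF _ F[of t]] by fastforce
  qed
  then have "F (pi - 0) + F 0 = F (pi - pi / 2) + F (pi / 2)"
    using DERIV_isconst_all[of "\<lambda>t. F (pi - t) + F t" 0 "pi / 2"] by blast
  then have d: "F pi - F 0 = 2 * (F (pi / 2) - F 0)" by simp
  have "pi / 4 + 2 * pi = (pi / 4 + pi) + pi" by simp
  then have "integral {pi / 4..pi / 4 + 2 * pi} P = (F ((pi / 4 + pi) + pi) - F (pi / 4 + pi)) + (F (pi / 4 + pi) - F (pi / 4))"
    using I[of "pi / 4" "pi / 4 + 2 * pi"] by simp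
  also have "\<dots> = 2 * (F pi - F 0)"
    using c[of "pi / 4 + pi" 0] c[of "pi / 4" 0] by simp
  finally show ?thesis using d I[of 0 "pi / 2"] by simp
qed

text \<open>Domination by L i * w justifies integration term by term. The separate bound on the
  individual integrals, where cancellation counts, is then summed against the L i.\<close>

lemma set_integral_infsum_bound:
  fixes G :: "'i \<Rightarrow> real \<Rightarrow> real"
  assumes "countable I" and S: "S \<in> sets lborel"
    and G: "\<And>i. i \<in> I \<Longrightarrow> set_integrable lborel S (G i)"
      "\<And>i x. i \<in> I \<Longrightarrow> x \<in> S \<Longrightarrow> \<bar>G i x\<bar> \<le> L i * w x"
      "\<And>i. i \<in> I \<Longrightarrow> \<bar>LBINT x:S. G i x\<bar> \<le> L i * K"
    and w: "set_integrable lborel S w"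
    and L: "\<And>i. i \<in> I \<Longrightarrow> 0 \<le> L i" "\<And>F. finite F \<Longrightarrow> F \<subseteq> I \<Longrightarrow> sum L F \<le> T"
    and K: "0 \<le> K"
  shows "\<bar>LBINT x:S. (\<Sum>\<^sub>\<infinity>i\<in>I. G i x)\<bar> \<le> T * K"
proof -
  define J where "J = to_nat_on I ` I"
  define \<phi> where "\<phi> = from_nat_into I"
  have \<phi>: "\<phi> n \<in> I" "to_nat_on I (\<phi> n) = n" if "n \<in> J" for n
    using that assms(1) by (auto simp: J_def \<phi>_def)
  have \<phi>2: "\<phi> (to_nat_on I i) = i" if "i \<in> I" for i
    using that assms(1) by (simp add: \<phi>_def)
  have bij: "bij_betw (to_nat_on I) I J"
    using inj_on_to_nat_on[OF assms(1)] by (simp add: J_def bij_betw_def)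
  \<comment> \<open>The members of I are enumerated by natural numbers, with 0 outside the range J,
    so that the theorem on series of integrable functions covers finite and infinite I
    alike.\<close>
  define c where "c = (\<lambda>n x. if n \<in> J then indicator S x * G (\<phi> n) x else 0)"
  define l where "l = (\<lambda>n. if n \<in> J then L (\<phi> n) else 0)"
  have l0: "l n \<ge> 0" for n using L(1) \<phi> by (simp add: l_def)
  have lT: "sum l {..<n} \<le> T" for n
  proof -
    have "sum l {..<n} = sum l ({..<n} \<inter> J)"
      by (rule sum.mono_neutral_right) (auto simp: l_def)
    also have "\<dots> = sum L (\<phi> ` ({..<n} \<inter> J))"
      by (subst sum.reindex) (auto simp: l_def intro!: inj_onI dest: \<phi>(2), metis \<phi>(2))
    also have "\<dots> \<le> T" by (rule L(2)) (use \<phi> in auto)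
    finally show ?thesis .
  qed
  have lsum: "summable l" by (rule summableI_nonneg_bounded[OF l0 lT])
  have lle: "suminf l \<le> T" by (rule suminf_le_const[OF lsum lT])
  have ci: "integrable lborel (c n)" for n
  proof (cases "n \<in> J")
    case True
    then show ?thesis using G(1)[OF \<phi>(1)[OF True]] by (simp add: c_def set_integrable_def)
  qed (simp add: c_def)
  have cb: "\<bar>c n x\<bar> \<le> l n * (indicator S x * \<bar>w x\<bar>)" for n x
  proof (cases "n \<in> J \<and> x \<in> S")
    case True
    then have "\<bar>G (\<phi> n) x\<bar> \<le> L (\<phi> n) * w x" using G(2) \<phi> by blast
    also have "\<dots> \<le> L (\<phi> n) * \<bar>w x\<bar>" using L(1) \<phi> True by (intro mult_left_mono) auto
    finally show ?thesis using True by (simp add: c_def l_def)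
  qed (auto simp: c_def l_def indicator_def)
  have wi: "integrable lborel (\<lambda>x. indicator S x * \<bar>w x\<bar>)"
    using integrable_abs[OF w[unfolded set_integrable_def]] by (simp add: abs_mult)
  have csum: "summable (\<lambda>n. norm (c n x))" for x
    by (rule summable_comparison_test'[OF summable_mult2[OF lsum]]) (use cb in auto)
  have isum: "summable (\<lambda>n. LINT x|lborel. norm (c n x))"
  proof (rule summable_comparison_test'[OF summable_mult2[OF lsum]])
    fix n :: nat
    have "(LINT x|lborel. norm (c n x)) \<le> (LINT x|lborel. l n * (indicator S x * \<bar>w x\<bar>))"
      by (rule integral_mono) (use ci wi cb in auto)
    then show "norm (LINT x|lborel. norm (c n x)) \<le> l n * (LINT x|lborel. indicator S x * \<bar>w x\<bar>)"
      by simp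
  qed
  \<comment> \<open>Absolute convergence at each x identifies the unordered sum over I with the
    series.\<close>
  have pt: "indicator S x *\<^sub>R (\<Sum>\<^sub>\<infinity>i\<in>I. G i x) = (\<Sum>n. c n x)" for x
  proof -
    have "(\<lambda>n. c n x) summable_on UNIV"
      by (rule norm_summable_imp_summable_on[OF csum])
    then have "(\<Sum>n. c n x) = infsum (\<lambda>n. c n x) UNIV"
      using has_sum_imp_sums[OF has_sum_infsum] sums_unique by metis
    also have "\<dots> = infsum (\<lambda>n. c n x) J"
      by (rule infsum_cong_neutral) (auto simp: c_def)
    also have "\<dots> = infsum (\<lambda>i. c (to_nat_on I i) x) I"
      by (rule infsum_reindex_bij_betw[OF bij, symmetric])
    also have "\<dots> = infsum (\<lambda>i. indicator S x * G i x) I"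
      by (rule infsum_cong) (simp add: c_def J_def \<phi>2)
    also have "\<dots> = indicator S x * infsum (\<lambda>i. G i x) I"
      by (rule infsum_cmult_right')
    finally show ?thesis by simp
  qed
  have cK: "\<bar>LINT x|lborel. c n x\<bar> \<le> l n * K" for n
  proof (cases "n \<in> J")
    case True
    then show ?thesis using G(3)[OF \<phi>(1)[OF True]] by (simp add: c_def l_def set_lebesgue_integral_def)
  qed (simp add: c_def l_def)
  have "(LBINT x:S. (\<Sum>\<^sub>\<infinity>i\<in>I. G i x)) = (LINT x|lborel. (\<Sum>n. c n x))"
    unfolding set_lebesgue_integral_def pt ..
  also have "\<dots> = (\<Sum>n. LINT x|lborel. c n x)"
    by (rule integral_suminf[OF ci _ isum]) (use csum in auto)
  finally have "\<bar>LBINT x:S. (\<Sum>\<^sub>\<infinity>i\<in>I. G i x)\<bar> = \<bar>\<Sum>n. LINT x|lborel. c n x\<bar>" by simp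
  also have "\<dots> \<le> (\<Sum>n. l n * K)"
    by (rule norm_suminf_le[where f = "\<lambda>n. LINT x|lborel. c n x", unfolded real_norm_def])
       (use cK summable_mult2[OF lsum] in auto)
  also have "\<dots> = suminf l * K" by (rule suminf_mult2[OF lsum, symmetric])
  also have "\<dots> \<le> T * K" using lle K by (rule mult_right_mono)
  finally show ?thesis .
qed

lemma kappa_scale:
  assumes "K \<in> kappa D" "c > 0"
  shows "(\<lambda>x. c * K x) \<in> kappa D"
proof (cases D)
  case (DD r)
  then obtain C where "C > 0" "K = (\<lambda>x. C * (1 + x) powr (- real r))"
    using assms(1) by (auto simp: kappa_def)
  with assms(2) show ?thesis
    unfolding kappa_def DD dcond.case mem_Collect_eq by (intro exI[of _ "c * C"]) (simp add: mult.assoc)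
next
  case (AD \<delta>)
  then obtain C z where "C > 0" "0 < z" "z \<le> \<delta>" "K = (\<lambda>x. C * exp (- z * x))"
    using assms(1) by (auto simp: kappa_def)
  with assms(2) show ?thesis
    unfolding kappa_def AD dcond.case mem_Collect_eq by (intro exI[of _ "c * C"] exI[of _ z] conjI) (simp_all add: mult.assoc)
qed

lemma kappa_nonneg: "K \<in> kappa D \<Longrightarrow> x \<ge> 0 \<Longrightarrow> K x \<ge> 0"
  by (cases D) (auto simp: kappa_def)

lemma cheb_le_1: "\<bar>cheb k x\<bar> \<le> 1"
  by (simp add: cheb_def)

lemma continuous_on_cheb: "continuous_on {-1..1} (cheb k)"
  unfolding cheb_def by (intro continuous_intros) auto

lemma cheb_cos_double: "t \<in> {0..pi / 2} \<Longrightarrow> cheb j (cos (2 * t)) = cos (2 * real j * t)"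
  by (simp add: cheb_def arccos_cos mult_ac)

section \<open>Distortion and geometry of the inverse branches\<close>

lemma real_distortion:
  fixes h h' :: "real \<Rightarrow> real"
  assumes h: "\<And>x. x \<in> {-1..1} \<Longrightarrow> (h has_real_derivative h' x) (at x within {-1..1})"
    and nz: "\<And>x. x \<in> {-1..1} \<Longrightarrow> h x \<noteq> 0" and C: "\<And>x. x \<in> {-1..1} \<Longrightarrow> \<bar>h' x / h x\<bar> \<le> C"
  shows "\<exists>s\<in>{-1, 1}. \<forall>x\<in>{-1..1}. s * h x > 0"
    and "x \<in> {-1..1} \<Longrightarrow> y \<in> {-1..1} \<Longrightarrow> \<bar>h x\<bar> \<le> exp (2 * C) * \<bar>h y\<bar>"
proof -
  have conn: "connected (h ` {-1..1})"
    by (intro connected_continuous_image DERIV_continuous_on[OF h]) auto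
  have no: False if "x \<in> {-1..1}" "y \<in> {-1..1}" "h x < 0" "h y > 0" for x y
  proof -
    have "0 \<in> h ` {-1..1}"
      by (rule connectedD_interval[OF conn imageI[OF that(1)] imageI[OF that(2)]]) (use that in simp_all)
    then show False using nz by auto
  qed
  define s :: real where "s = (if h 0 > 0 then 1 else -1)"
  have s: "s \<in> {-1, 1}" by (auto simp: s_def)
  have pos: "s * h x > 0" if "x \<in> {-1..1}" for x
    using no[OF that, of 0] no[OF _ that, of 0] nz[OF that] nz[of 0]
    by (cases "h x < 0"; cases "h 0 < 0") (auto simp: s_def not_less)
  with s show "\<exists>s\<in>{-1, 1}. \<forall>x\<in>{-1..1}. s * h x > 0" by blast
  assume x: "x \<in> {-1..1}" and y: "y \<in> {-1..1}"
  \<comment> \<open>The logarithm of s * h is Lipschitz with constant C, and [-1, 1] has length 2,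
    whence the factor exp (2 * C).\<close>
  have d: "((\<lambda>x. ln (s * h x)) has_real_derivative h' z / h z) (at z within {-1..1})" if "z \<in> {-1..1}" for z
  proof -
    have "((\<lambda>x. ln (s * h x)) has_real_derivative (s * h' z) / (s * h z)) (at z within {-1..1})"
      using pos[OF that] h[OF that] by (auto intro!: derivative_eq_intros simp: field_simps)
    then show ?thesis using s by auto
  qed
  have "norm (ln (s * h x) - ln (s * h y)) \<le> C * norm (x - y)"
    by (rule field_differentiable_bound[of "{-1..1}"]) (use d C x y in auto)
  also have "\<dots> \<le> C * 2"
    using x y order_trans[OF abs_ge_zero C[OF x]] by (intro mult_left_mono) auto
  finally have "ln (s * h x) \<le> 2 * C + ln (s * h y)" by simp
  then have "exp (ln (s * h x)) \<le> exp (2 * C + ln (s * h y))" by simp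
  then have "s * h x \<le> exp (2 * C) * (s * h y)"
    using pos[OF x] pos[OF y] by (simp add: exp_add)
  then show "\<bar>h x\<bar> \<le> exp (2 * C) * \<bar>h y\<bar>"
    using s pos[OF x] pos[OF y] by auto
qed

text \<open>The sign of the derivative makes s * u strictly increasing, so the extreme values are
  taken at -1 and 1, in an order that depends on s. The last claim compares the branch length with
  the derivative at one point; distortion later extends the comparison to all points.\<close>

lemma inverse_branch_endpoints:
  fixes u du fh :: "real \<Rightarrow> real"
  assumes ab: "a < b" and bij: "bij_betw fh {a..b} {-1..1}"
    and u: "\<And>y. y \<in> {-1..1} \<Longrightarrow> u y \<in> {a..b}" "\<And>y. y \<in> {-1..1} \<Longrightarrow> fh (u y) = y"
    and du: "\<And>x. x \<in> {-1..1} \<Longrightarrow> (u has_real_derivative du x) (at x within {-1..1})"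
    and s: "s \<in> {-1, 1}" "\<And>x. x \<in> {-1..1} \<Longrightarrow> s * du x > 0"
  shows "{u (-1), u 1} = {a, b}" and "\<And>x. x \<in> {-1<..<1} \<Longrightarrow> u x \<in> {a<..<b}"
    and "\<And>z. z \<in> {a<..<b} \<Longrightarrow> fh z \<in> {-1<..<1} \<and> u (fh z) = z"
    and "\<exists>\<xi>\<in>{-1..1}. b - a = 2 * \<bar>du \<xi>\<bar>"
proof -
  have mono: "s * u x < s * u y" if xy: "x \<in> {-1..1}" "y \<in> {-1..1}" "x < y" for x y
  proof -
    obtain \<xi> where \<xi>: "\<xi> \<in> {min x y..max x y}" "u y - u x = (y - x) * du \<xi>"
      using MVT_within_interval[OF du xy(1,2)] by blast
    then have "\<xi> \<in> {-1..1}" using xy by auto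
    then have "(y - x) * (s * du \<xi>) > 0" using s(2) xy(3) by simp
    moreover have "s * u y - s * u x = (y - x) * (s * du \<xi>)"
      unfolding right_diff_distrib[symmetric] \<xi>(2) by (rule mult.left_commute)
    ultimately show ?thesis by simp
  qed
  have inv: "fh z \<in> {-1..1} \<and> u (fh z) = z" if "z \<in> {a..b}" for z
  proof -
    have "fh z \<in> {-1..1}" using bij that by (auto simp: bij_betw_def)
    moreover have "inj_on fh {a..b}" using bij by (simp add: bij_betw_def)
    ultimately show ?thesis using u that by (metis inj_onD)
  qed
  have le: "s * u (-1) \<le> s * z" "s * z \<le> s * u 1" if "z \<in> {a..b}" for z
  proof -
    have z: "fh z \<in> {-1..1}" "u (fh z) = z" using inv[OF that] by auto
    show "s * u (-1) \<le> s * z" using mono[of "-1" "fh z"] z by (cases "fh z = -1") (auto simp: less_imp_le)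
    show "s * z \<le> s * u 1" using mono[of "fh z" 1] z by (cases "fh z = 1") (auto simp: less_imp_le)
  qed
  have e: "u (-1) \<in> {a..b}" "u 1 \<in> {a..b}" using u(1) by auto
  have ends: "s = 1 \<and> u (-1) = a \<and> u 1 = b \<or> s = -1 \<and> u (-1) = b \<and> u 1 = a"
  proof (cases "s = 1")
    case True
    then show ?thesis using le(1)[of a] le(2)[of b] e ab by simp
  next
    case False
    then have "s = -1" using s(1) by simp
    then show ?thesis using le(1)[of b] le(2)[of a] e ab by simp
  qed
  then show "{u (-1), u 1} = {a, b}" by auto
  show op: "u x \<in> {a<..<b}" if "x \<in> {-1<..<1}" for x
    using mono[of "-1" x] mono[of x 1] that ends by auto
  show "fh z \<in> {-1<..<1} \<and> u (fh z) = z" if z: "z \<in> {a<..<b}" for z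
  proof -
    have i: "fh z \<in> {-1..1}" "u (fh z) = z" using inv[of z] z by auto
    then have "fh z \<noteq> -1" "fh z \<noteq> 1" using ends z by auto
    then show ?thesis using i by auto
  qed
  obtain \<xi> where \<xi>: "\<xi> \<in> {min (-1) 1..max (-1) 1}" "u 1 - u (-1) = (1 - -1) * du \<xi>"
    using MVT_within_interval[OF du, of "-1" 1] by auto
  then show "\<exists>\<xi>\<in>{-1..1}. b - a = 2 * \<bar>du \<xi>\<bar>"
    using ends s(2)[of \<xi>] by (intro bexI[of _ \<xi>]) auto
qed

lemma sum_branch_lengths:
  assumes "finite F" "\<And>i. i \<in> F \<Longrightarrow> -1 \<le> a i \<and> a i < b i \<and> b i \<le> 1"
    and "\<And>i j. i \<in> F \<Longrightarrow> j \<in> F \<Longrightarrow> i \<noteq> j \<Longrightarrow> branch a b i \<inter> branch a b j = {}"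
  shows "(\<Sum>i\<in>F. b i - a i) \<le> 2"
proof -
  have "(\<Sum>i\<in>F. b i - a i) = (\<Sum>i\<in>F. measure lborel (branch a b i))"
    by (rule sum.cong) (use assms(2) in \<open>auto simp: branch_def less_imp_le\<close>)
  also have "\<dots> = measure lborel (\<Union>i\<in>F. branch a b i)"
    by (rule measure_finite_Union[symmetric])
       (use assms in \<open>auto simp: branch_def disjoint_family_on_def less_imp_le\<close>)
  also have "\<dots> \<le> measure lborel {-1..1::real}"
  proof (rule measure_mono_fmeasurable)
    show "(\<Union>i\<in>F. branch a b i) \<subseteq> {-1..1}"
    proof (rule UN_least)
      fix i assume "i \<in> F"
      from assms(2)[OF this] show "branch a b i \<subseteq> {-1..1}" by (auto simp: branch_def)
    qed
    show "(\<Union>i\<in>F. branch a b i) \<in> sets lborel"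
      by (intro sets.finite_UN assms(1)) (simp add: branch_def)
    show "{-1..1::real} \<in> fmeasurable lborel"
      by (rule fmeasurableI) simp_all
  qed
  finally show ?thesis by simp
qed

text \<open>Distance to a set equals distance to its closure, which contains both endpoints. Thus
  the \<Xi> bound may be read with the distance to either endpoint.\<close>

lemma infdist_branch:
  assumes "a i < b i" "\<sigma> \<notin> {a i..b i}"
  shows "infdist \<sigma> (branch a b i) > 0" "infdist \<sigma> (branch a b i) \<le> \<bar>\<sigma> - a i\<bar>" "infdist \<sigma> (branch a b i) \<le> \<bar>\<sigma> - b i\<bar>"
proof -
  have cl: "closure (branch a b i) = {a i..b i}"
    using assms(1) by (simp add: branch_def closure_greaterThanLessThan)
  have "branch a b i \<noteq> {}" using assms(1) dense by (auto simp: branch_def)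
  then have "infdist \<sigma> (branch a b i) \<noteq> 0"
    using in_closure_iff_infdist_zero[of "branch a b i" \<sigma>] assms(2) unfolding cl by blast
  then show "infdist \<sigma> (branch a b i) > 0"
    using infdist_nonneg[of \<sigma> "branch a b i"] by linarith
  have "infdist \<sigma> (branch a b i) \<le> dist \<sigma> z" if z: "z \<in> {a i..b i}" for z
  proof (rule field_le_epsilon)
    fix \<epsilon> :: real assume "\<epsilon> > 0"
    then obtain y where y: "y \<in> branch a b i" "dist y z < \<epsilon>"
      using z unfolding cl[symmetric] closure_approachable by blast
    have "infdist \<sigma> (branch a b i) \<le> dist \<sigma> y" by (rule infdist_le[OF y(1)])
    also have "\<dots> \<le> dist \<sigma> z + dist y z" by (simp add: dist_triangle2 dist_commute)
    finally show "infdist \<sigma> (branch a b i) \<le> dist \<sigma> z + \<epsilon>" using y(2) by linarith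
  qed
  then show "infdist \<sigma> (branch a b i) \<le> \<bar>\<sigma> - a i\<bar>" "infdist \<sigma> (branch a b i) \<le> \<bar>\<sigma> - b i\<bar>"
    using assms(1) by (auto simp: dist_real_def)
qed

lemma deriv_inverse_branch:
  fixes u du fh f :: "real \<Rightarrow> real"
  assumes "C2_on fh {a..b}" "\<And>y. y \<in> {a<..<b} \<Longrightarrow> f y = fh y" "\<And>x. x \<in> {-1<..<1} \<Longrightarrow> u x \<in> {a<..<b} \<and> fh (u x) = x"
    and "(u has_real_derivative d) (at x)" and x: "x \<in> {-1<..<1}"
  shows "deriv f (u x) = 1 / d"
proof -
  obtain D where "has_derivs_on 2 fh D {a..b}"
    using assms(1) unfolding C2_on_def by blast
  then have D: "D 0 y = fh y" "(D 0 has_real_derivative D 1 y) (at y within {a..b})" if "y \<in> {a..b}" for y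
    using that by (auto simp: has_derivs_on_def dest: spec[of _ 0])
  define y where "y = u x"
  have y: "y \<in> {a<..<b}" using assms(3)[OF x] by (simp add: y_def)
  have "at y within {a..b} = at y"
    by (rule at_within_interior) (use y in \<open>simp add: interior_atLeastAtMost_real\<close>)
  then have "(D 0 has_real_derivative D 1 y) (at y)" using D(2)[of y] y by simp
  then have f: "(f has_real_derivative D 1 y) (at y)"
    by (rule has_field_derivative_transform_within_open[of _ _ _ "{a<..<b}"]) (use y D(1) assms(2) in auto)
  have "((\<lambda>x. f (u x)) has_real_derivative D 1 y * d) (at x)"
    by (rule DERIV_chain2[OF f[unfolded y_def] assms(4), folded y_def])
  then have "((\<lambda>x. x) has_real_derivative D 1 y * d) (at x)"
    by (rule has_field_derivative_transform_within_open[of _ _ _ "{-1<..<1}"]) (use x assms(2,3) in auto)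
  from DERIV_unique[OF this DERIV_ident] have "D 1 y * d = 1" .
  moreover from this have "d \<noteq> 0" by auto
  ultimately have "D 1 y = 1 / d" by (simp add: eq_divide_eq)
  with DERIV_imp_deriv[OF f] show ?thesis by (simp add: y_def)
qed

lemma has_derivs_on_step:
  assumes "has_derivs_on m g D S" "n < m" "x \<in> S"
  shows "(D n has_real_derivative D (Suc n) x) (at x within S)"
  using assms unfolding has_derivs_on_def by blast

lemma has_derivs_on_first:
  assumes "has_derivs_on m g D S" "0 < m" "x \<in> S"
  shows "(g has_real_derivative D 1 x) (at x within S)"
proof -
  have eq: "\<forall>x\<in>S. D 0 x = g x" using assms(1) unfolding has_derivs_on_def by blast
  have "(D 0 has_real_derivative D (Suc 0) x) (at x within S)"
    by (rule has_derivs_on_step[OF assms])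
  then have "(g has_real_derivative D (Suc 0) x) (at x within S)"
    by (rule has_field_derivative_transform_within[OF _ zero_less_one assms(3)]) (use eq in blast)
  then show ?thesis by (simp only: One_nat_def)
qed

lemma UNP_branch_family:
  assumes UNP: "UNP f I a b fhat v" and lam: "check_lambda f I a b > 0"
    and valid: "dcond_valid D" and sat: "satisfies_D D I v"
  obtains dv B M where "branch_family D I v dv (\<lambda>i. b i - a i) B M (1 / check_lambda f I a b)"
    and "\<And>i. i \<in> I \<Longrightarrow> continuous_on {-1..1} (dv i)"
    and "\<And>i. i \<in> I \<Longrightarrow> \<exists>s\<in>{-1, 1}. \<forall>x\<in>{-1..1}. s * dv i x > 0"
    and "\<And>i x. i \<in> I \<Longrightarrow> x \<in> {-1..1} \<Longrightarrow> \<bar>dv i x\<bar> \<le> B * (b i - a i)"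
    and "\<And>i x. i \<in> I \<Longrightarrow> x \<in> {-1<..<1} \<Longrightarrow> v i x \<in> branch a b i \<and> f (v i x) = x \<and> deriv f (v i x) = 1 / dv i x"
    and "\<And>i y. i \<in> I \<Longrightarrow> y \<in> branch a b i \<Longrightarrow> f y \<in> {-1<..<1} \<and> v i (f y) = y"
proof -
  have "\<forall>i\<in>I. -1 \<le> a i \<and> a i < b i \<and> b i \<le> 1"
    using UNP unfolding UNP_def by (elim conjE)
  then have ab: "-1 \<le> a i" "a i < b i" "b i \<le> 1" if "i \<in> I" for i
    using that by simp_all
  note U = UNP[unfolded UNP_def, THEN conjunct2, THEN conjunct2, THEN conjunct2, THEN conjunct2]
  have fh: "C2_on (fhat i) {a i..b i}" "bij_betw (fhat i) {a i..b i} {-1..1}"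
    "\<And>x. x \<in> branch a b i \<Longrightarrow> f x = fhat i x" "\<And>y. y \<in> {-1..1} \<Longrightarrow> v i y \<in> {a i..b i}"
    "\<And>y. y \<in> {-1..1} \<Longrightarrow> fhat i (v i y) = y" if "i \<in> I" for i
    using bspec[OF U[THEN conjunct1] that] by blast+
  from U[THEN conjunct2, THEN conjunct1] obtain C where "\<forall>i\<in>I. \<exists>D. has_derivs_on 2 (v i) D {-1..1} \<and> continuous_on {-1..1} (D 2) \<and>
        (\<forall>x\<in>{-1..1}. D 1 x \<noteq> 0 \<and> \<bar>D 2 x / D 1 x\<bar> \<le> C)"
    by (elim exE)
  from bchoice[OF this] obtain d where "\<forall>i\<in>I. has_derivs_on 2 (v i) (d i) {-1..1} \<and>
      continuous_on {-1..1} (d i 2) \<and> (\<forall>x\<in>{-1..1}. d i 1 x \<noteq> 0 \<and> \<bar>d i 2 x / d i 1 x\<bar> \<le> C)"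
    by (elim exE)
  then have d: "has_derivs_on 2 (v i) (d i) {-1..1}"
    "\<And>x. x \<in> {-1..1} \<Longrightarrow> d i 1 x \<noteq> 0 \<and> \<bar>d i 2 x / d i 1 x\<bar> \<le> C" if "i \<in> I" for i
    using that by blast+
  define dv where "dv = (\<lambda>i. d i 1)"
  have dv: "(v i has_real_derivative dv i x) (at x within {-1..1})" if "i \<in> I" "x \<in> {-1..1}" for i x
    unfolding dv_def by (rule has_derivs_on_first[OF d(1)[OF that(1)] _ that(2)]) simp
  have ddv: "(dv i has_real_derivative d i 2 x) (at x within {-1..1})" if "i \<in> I" "x \<in> {-1..1}" for i x
    using has_derivs_on_step[OF d(1)[OF that(1)] _ that(2), of 1] by (simp add: dv_def numeral_2_eq_2)
  have nz: "dv i x \<noteq> 0" "\<bar>d i 2 x / dv i x\<bar> \<le> C" if "i \<in> I" "x \<in> {-1..1}" for i x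
    using d(2)[OF that] by (auto simp: dv_def)
  have sign: "\<exists>s\<in>{-1, 1}. \<forall>x\<in>{-1..1}. s * dv i x > 0" if "i \<in> I" for i
    by (rule real_distortion(1)[OF ddv[OF that] nz[OF that]])
  have dist: "\<bar>dv i x\<bar> \<le> exp (2 * C) * \<bar>dv i y\<bar>" if "i \<in> I" "x \<in> {-1..1}" "y \<in> {-1..1}" for i x y
    by (rule real_distortion(2)[OF ddv[OF that(1)] nz[OF that(1)] that(2,3)])
  have ends: "{v i (-1), v i 1} = {a i, b i}" "\<And>x. x \<in> {-1<..<1} \<Longrightarrow> v i x \<in> {a i<..<b i}"
    "\<And>z. z \<in> {a i<..<b i} \<Longrightarrow> fhat i z \<in> {-1<..<1} \<and> v i (fhat i z) = z"
    "\<exists>\<xi>\<in>{-1..1}. b i - a i = 2 * \<bar>dv i \<xi>\<bar>" if i: "i \<in> I" for i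
  proof -
    obtain s where s: "s \<in> {-1, 1}" "\<And>x. x \<in> {-1..1} \<Longrightarrow> s * dv i x > 0" using sign[OF i] by blast
    note E = inverse_branch_endpoints[OF ab(2)[OF i] fh(2)[OF i] fh(4)[OF i] fh(5)[OF i] dv[OF i] s]
    show "{v i (-1), v i 1} = {a i, b i}"
      by (rule E(1))
    show "v i x \<in> {a i<..<b i}" if "x \<in> {-1<..<1}" for x
      by (rule E(2)) (use that in auto)
    show "fhat i z \<in> {-1<..<1} \<and> v i (fhat i z) = z" if "z \<in> {a i<..<b i}" for z
      by (rule E(3)) (use that in auto)
    show "\<exists>\<xi>\<in>{-1..1}. b i - a i = 2 * \<bar>dv i \<xi>\<bar>"
      by (rule E(4))
  qed
  \<comment> \<open>The length is 2 * |dv i \<xi>| for some \<xi>, and values of \<open>dv i\<close>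
    differ in modulus by at most the factor exp (2 * C).\<close>
  define B where "B = 2 * exp (2 * C)"
  have B: "B > 0" by (simp add: B_def)
  have lower: "(b i - a i) / B \<le> \<bar>dv i x\<bar>" and upper: "\<bar>dv i x\<bar> \<le> B * (b i - a i)"
    if i: "i \<in> I" and x: "x \<in> {-1..1}" for i x
  proof -
    obtain \<xi> where \<xi>: "\<xi> \<in> {-1..1}" "b i - a i = 2 * \<bar>dv i \<xi>\<bar>" using ends(4)[OF i] by blast
    have "b i - a i \<le> \<bar>dv i x\<bar> * B"
      using dist[OF i \<xi>(1) x] by (simp add: \<xi>(2) B_def mult_ac)
    then show "(b i - a i) / B \<le> \<bar>dv i x\<bar>" using B by (simp add: pos_divide_le_eq)
    have "B * (b i - a i) = 4 * (exp (2 * C) * \<bar>dv i \<xi>\<bar>)" by (simp add: \<xi>(2) B_def)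
    with dist[OF i x \<xi>(1)] show "\<bar>dv i x\<bar> \<le> B * (b i - a i)" by linarith
  qed
  have vf: "v i x \<in> branch a b i \<and> f (v i x) = x \<and> deriv f (v i x) = 1 / dv i x"
    if i: "i \<in> I" and x: "x \<in> {-1<..<1}" for i x
  proof -
    have "v i x \<in> branch a b i" using ends(2)[OF i x] by (simp add: branch_def)
    moreover have "f (v i x) = x" using fh(3)[OF i calculation] fh(5)[OF i, of x] x by simp
    moreover have "deriv f (v i x) = 1 / dv i x"
    proof (rule deriv_inverse_branch[OF fh(1)[OF i] _ _ _ x])
      have "at x within {-1..1} = at x"
        by (rule at_within_interior) (use x in \<open>simp add: interior_atLeastAtMost_real\<close>)
      then show "(v i has_real_derivative dv i x) (at x)" using dv[OF i, of x] x by simp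
      show "f y = fhat i y" if "y \<in> {a i<..<b i}" for y using fh(3)[OF i] that by (simp add: branch_def)
      show "v i y \<in> {a i<..<b i} \<and> fhat i (v i y) = y" if "y \<in> {-1<..<1}" for y
        using ends(2)[OF i that] fh(5)[OF i, of y] that by simp
    qed
    ultimately show ?thesis by blast
  qed
  from U[THEN conjunct2, THEN conjunct2] obtain \<Xi> where \<Xi>: "\<forall>i\<in>I. \<forall>\<sigma>\<in>{-1,1::real}. \<sigma> \<notin> {a i..b i} \<longrightarrow>
        (b i - a i) / infdist \<sigma> (branch a b i) \<le> \<Xi>"
    by (elim exE)
  \<comment> \<open>When every branch reaches both endpoints the condition is vacuous and \<Xi> is
    an arbitrary number; the maximum makes M positive.\<close>
  define M where "M = max 1 \<Xi>"
  have gap: "\<exists>d>0. b i - a i \<le> M * d \<and> (\<forall>x\<in>{-1..1}. d \<le> 1 - \<sigma> * v i x \<and> 1 - \<sigma> * v i x \<le> d + (b i - a i))"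
    if i: "i \<in> I" and \<sigma>: "\<sigma> \<in> {-1, 1}" and "v i 1 \<noteq> \<sigma>" "v i (-1) \<noteq> \<sigma>" for i \<sigma>
  proof -
    have ne: "a i \<noteq> \<sigma>" "b i \<noteq> \<sigma>" using ends(1)[OF i] that(3,4) by (metis insert_iff singletonD)+
    then have out: "\<sigma> \<notin> {a i..b i}" using \<sigma> ab[OF i] by auto
    define \<eta> where "\<eta> = infdist \<sigma> (branch a b i)"
    \<comment> \<open>The distance from \<sigma> to the end of the branch that faces it.\<close>
    define d where "d = (if \<sigma> = 1 then 1 - b i else 1 + a i)"
    have \<eta>: "0 < \<eta>" "\<eta> \<le> d" "0 < d"
      using infdist_branch[of a i b, OF ab(2)[OF i] out] \<sigma> ab[OF i] ne by (auto simp: \<eta>_def d_def)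
    have "b i - a i \<le> \<Xi> * \<eta>"
      using \<Xi>[rule_format, OF i \<sigma> out] \<eta>(1) by (simp add: \<eta>_def pos_divide_le_eq)
    also have "\<dots> \<le> M * d"
      using \<eta> by (intro mult_mono) (auto simp: M_def)
    finally have "b i - a i \<le> M * d" .
    moreover have "d \<le> 1 - \<sigma> * v i x \<and> 1 - \<sigma> * v i x \<le> d + (b i - a i)" if "x \<in> {-1..1}" for x
      using fh(4)[OF i that] \<sigma> by (auto simp: d_def)
    ultimately show ?thesis using \<eta>(3) by blast
  qed
  have expansion: "sqrt (1 - x\<^sup>2) * \<bar>dv i x\<bar> \<le> 1 / check_lambda f I a b * sqrt (1 - (v i x)\<^sup>2)"
    if i: "i \<in> I" and x: "x \<in> {-1<..<1}" for i x
  proof -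
    let ?g = "\<lambda>x. sqrt (1 - x\<^sup>2) / sqrt (1 - (f x)\<^sup>2) * \<bar>deriv f x\<bar>"
    \<comment> \<open>An infimum of reals is a lower bound only for sets bounded below, here by
      0.\<close>
    have bd: "0 \<le> ?g y" if y: "y \<in> (\<Union>i\<in>I. branch a b i)" for y
    proof -
      obtain k where k: "k \<in> I" "y \<in> branch a b k" using y by blast
      have "y\<^sup>2 \<le> 1" using ab[OF k(1)] k(2) by (simp add: branch_def abs_square_le_1 abs_le_iff)
      moreover have "f y \<in> {-1..1}"
        using fh(3)[OF k] ends(3)[OF k(1), of y] k(2) by (auto simp: branch_def)
      then have "(f y)\<^sup>2 \<le> 1" by (simp add: abs_square_le_1 abs_le_iff)
      ultimately show ?thesis by simp
    qed
    have "check_lambda f I a b \<le> ?g (v i x)"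
      unfolding check_lambda_def
      by (rule cINF_lower) (use bd vf[OF i x] i in \<open>auto intro!: bdd_belowI[of _ 0]\<close>)
    \<comment> \<open>At y = v i x one has f y = x and |f' y| = 1 / |dv i x|, so C-expansion at y
      becomes a bound on the inverse branch at x.\<close>
    also have "\<dots> = sqrt (1 - (v i x)\<^sup>2) / (sqrt (1 - x\<^sup>2) * \<bar>dv i x\<bar>)"
      using vf[OF i x] by simp
    finally have le: "check_lambda f I a b \<le> sqrt (1 - (v i x)\<^sup>2) / (sqrt (1 - x\<^sup>2) * \<bar>dv i x\<bar>)" .
    have "x\<^sup>2 < 1" using x by (simp add: abs_square_less_1 abs_less_iff)
    then have "sqrt (1 - x\<^sup>2) * \<bar>dv i x\<bar> > 0" using nz(1)[OF i, of x] x by simp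
    with le lam show ?thesis by (simp add: pos_le_divide_eq pos_divide_le_eq field_simps)
  qed
  have len: "b i - a i > 0" if "i \<in> I" for i using ab(2)[OF that] by simp
  have reg: "regular_family D I (\<lambda>i t. dv i (cos (2 * t)) / (b i - a i)) \<and> regular_family D I
      (\<lambda>i t. (if cos (2 * t) = e then dv i e else (v i e - v i (cos (2 * t))) / (e - cos (2 * t))) / (b i - a i))"
    if e: "e \<in> {-1, 1}" for e
  proof (cases D)
    case (DD r)
    from sat[unfolded DD satisfies_D_def dcond.case] obtain C' where "\<forall>i\<in>I. \<exists>Dv. has_derivs_on (r + 1) (v i) Dv {-1..1} \<and>
               (\<forall>x\<in>{-1..1}. Dv 1 x \<noteq> 0 \<and> (\<forall>n\<le>r. \<bar>Dv (n + 1) x / Dv 1 x\<bar> \<le> C'))"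
      by (elim exE)
    from bchoice[OF this] obtain Dv where "\<forall>i\<in>I. has_derivs_on (r + 1) (v i) (Dv i) {-1..1} \<and>
               (\<forall>x\<in>{-1..1}. Dv i 1 x \<noteq> 0 \<and> (\<forall>n\<le>r. \<bar>Dv i (n + 1) x / Dv i 1 x\<bar> \<le> C'))"
      by (elim exE)
    then have Dv: "has_derivs_on (r + 1) (v i) (Dv i) {-1..1}"
      and Dvb: "\<And>x n. x \<in> {-1..1} \<Longrightarrow> n \<le> r \<Longrightarrow> Dv i 1 x \<noteq> 0 \<and> \<bar>Dv i (n + 1) x / Dv i 1 x\<bar> \<le> C'" if "i \<in> I" for i
      using that by blast+
    \<comment> \<open>The distortion condition brings its own derivatives of v; by uniqueness on the
      closed interval the first of them is \<open>dv i\<close>.\<close>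
    have D1: "Dv i 1 x = dv i x" if i: "i \<in> I" and x: "x \<in> {-1..1}" for i x
    proof -
      have "(v i has_real_derivative Dv i 1 x) (at x within {-1..1})"
        by (rule has_derivs_on_first[OF Dv[OF i] _ x]) simp
      with dv[OF i x] show ?thesis
        using vector_derivative_unique_within_closed_interval[of "-1" 1 x "v i" "Dv i 1 x" "dv i x"] x
        unfolding has_real_derivative_iff_has_vector_derivative by simp
    qed
    have bnd: "\<bar>Dv i (Suc n) x\<bar> \<le> (\<bar>C'\<bar> * B) * (b i - a i)" if "i \<in> I" "n \<le> r" "x \<in> {-1..1}" for i n x
    proof -
      have "\<bar>Dv i (Suc n) x\<bar> \<le> C' * \<bar>dv i x\<bar>"
        using Dvb[OF that(1) that(3,2)] D1[OF that(1,3)] by (auto simp: abs_divide pos_divide_le_eq)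
      also have "\<dots> \<le> \<bar>C'\<bar> * (B * (b i - a i))"
        using upper[OF that(1,3)] by (intro mult_mono) auto
      finally show ?thesis by (simp add: mult.assoc)
    qed
    note S = smooth_branch_families[OF Dv bnd len e]
    have "smooth_family r I (\<lambda>i t. dv i (cos (2 * t)) / (b i - a i))"
      by (rule smooth_family_cong[OF S(1)]) (use D1 in auto)
    moreover have "smooth_family r I (\<lambda>i t. (if cos (2 * t) = e then dv i e
           else (v i e - v i (cos (2 * t))) / (e - cos (2 * t))) / (b i - a i))"
      by (rule smooth_family_cong[OF S(2)]) (use e D1 in auto)
    ultimately show ?thesis by (simp add: regular_family_def DD)
  next
    case (AD \<delta>)
    then have \<delta>: "\<delta> > 0" using valid by (simp add: dcond_valid_def)
    from sat[unfolded AD satisfies_D_def dcond.case] obtain C' where "\<forall>i\<in>I. \<exists>g U. open U \<and> bernstein_region \<delta> \<subseteq> U \<and> g holomorphic_on U \<and>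
               (\<forall>x\<in>{-1..1}. g (complex_of_real x) = complex_of_real (v i x)) \<and>
               (\<forall>z\<in>bernstein_region \<delta>. deriv g z \<noteq> 0 \<and>
                   cmod (deriv (deriv g) z / deriv g z) \<le> C')"
      by (elim exE)
    from bchoice[OF this] obtain g where g: "\<forall>i\<in>I. \<exists>U. open U \<and> bernstein_region \<delta> \<subseteq> U \<and> g i holomorphic_on U \<and>
               (\<forall>x\<in>{-1..1}. g i (complex_of_real x) = complex_of_real (v i x)) \<and>
               (\<forall>z\<in>bernstein_region \<delta>. deriv (g i) z \<noteq> 0 \<and>
                   cmod (deriv (deriv (g i)) z / deriv (g i) z) \<le> C')"
      by (elim exE)
    have sub: "bernstein_interior \<delta> \<subseteq> bernstein_region \<delta>"
      by (auto simp: bernstein_interior_def bernstein_region_def)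
    have g1: "g i holomorphic_on bernstein_interior \<delta>" if "i \<in> I" for i
      using g that sub by (meson holomorphic_on_subset subset_trans)
    have g2: "g i (of_real x) = of_real (v i x)" if "i \<in> I" "x \<in> {-1..1}" for i x
      using g that by blast
    have g3: "deriv (g i) z \<noteq> 0" "cmod (deriv (deriv (g i)) z / deriv (g i) z) \<le> C'"
      if "i \<in> I" "z \<in> bernstein_interior \<delta>" for i z
      using g that sub by blast+
    have "analytic_family I (\<lambda>i t. dv i (cos (2 * t)) / (b i - a i))"
      by (rule analytic_branch_families(1)[OF \<delta>, where g = g and v = v and C = C' and B = B and e = e])
         (use g1 g2 g3 dv upper len e in auto)
    moreover have "analytic_family I (\<lambda>i t. (if cos (2 * t) = e then dv i e
           else (v i e - v i (cos (2 * t))) / (e - cos (2 * t))) / (b i - a i))"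
      by (rule analytic_branch_families(2)[OF \<delta>, where g = g and C = C' and B = B])
         (use g1 g2 g3 dv upper len e in auto)
    ultimately show ?thesis by (simp add: regular_family_def AD)
  qed
  have "branch_family D I v dv (\<lambda>i. b i - a i) B M (1 / check_lambda f I a b)"
  proof
    show "\<bar>v i x\<bar> \<le> 1" if "i \<in> I" "x \<in> {-1..1}" for i x
      using fh(4)[OF that] ab[OF that(1)] by auto
    show "M > 0" by (simp add: M_def)
    show "regular_family D I (\<lambda>i t. dv i (cos (2 * t)) / (b i - a i))" using reg[of 1] by simp
  qed (fact valid B len dv lower gap expansion reg[THEN conjunct2])+
  moreover have "f y \<in> {-1<..<1} \<and> v i (f y) = y" if "i \<in> I" "y \<in> branch a b i" for i y
    using ends(3)[OF that(1), of y] fh(3)[OF that] that(2) by (simp add: branch_def)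
  moreover have "continuous_on {-1..1} (dv i)" if "i \<in> I" for i
    using DERIV_continuous_on[OF ddv[OF that]] by simp
  ultimately show ?thesis
    using that[of dv B M] sign upper vf by simp
qed

theorem theorem4:
  fixes f :: "real \<Rightarrow> real" and I :: "'i set" and a b :: "'i \<Rightarrow> real"
    and fhat v :: "'i \<Rightarrow> real \<Rightarrow> real" and D :: dcond
  assumes "UNP f I a b fhat v"
    and "check_lambda f I a b > 0"
    and "dcond_valid D"
    and "satisfies_D D I v"
  shows "\<forall>p. p > 1 / check_lambda f I a b \<longrightarrow>
           (\<exists>K\<in>kappa D. \<forall>j k :: nat. (k = 0 \<or> real j / real k > p) \<longrightarrow>
              \<bar>Lmat f (\<Union>i\<in>I. branch a b i) j k\<bar> \<le> K \<bar>real j - p * real k\<bar>)"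
proof (intro allI impI)
  fix p assume p: "p > 1 / check_lambda f I a b"
  have p0: "p > 0" by (rule less_trans[OF _ p]) (use assms(2) in simp)
  have cI: "countable I" using assms(1) unfolding UNP_def by (elim conjE)
  have "\<forall>i\<in>I. -1 \<le> a i \<and> a i < b i \<and> b i \<le> 1"
    using assms(1) unfolding UNP_def by (elim conjE)
  then have ab: "-1 \<le> a i \<and> a i < b i \<and> b i \<le> 1" if "i \<in> I" for i
    using that by blast
  have "\<forall>i\<in>I. \<forall>j\<in>I. i \<noteq> j \<longrightarrow> branch a b i \<inter> branch a b j = {}"
    using assms(1) unfolding UNP_def by (elim conjE)
  then have disj: "branch a b i \<inter> branch a b j = {}" if "i \<in> I" "j \<in> I" "i \<noteq> j" for i j
    using that by blast
  obtain dv B M where fam: "branch_family D I v dv (\<lambda>i. b i - a i) B M (1 / check_lambda f I a b)"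
    and dvc: "\<And>i. i \<in> I \<Longrightarrow> continuous_on {-1..1} (dv i)"
    and sign: "\<And>i. i \<in> I \<Longrightarrow> \<exists>s\<in>{-1, 1}. \<forall>x\<in>{-1..1}. s * dv i x > 0"
    and upper: "\<And>i x. i \<in> I \<Longrightarrow> x \<in> {-1..1} \<Longrightarrow> \<bar>dv i x\<bar> \<le> B * (b i - a i)"
    and vf: "\<And>i x. i \<in> I \<Longrightarrow> x \<in> {-1<..<1} \<Longrightarrow> v i x \<in> branch a b i \<and> f (v i x) = x \<and> deriv f (v i x) = 1 / dv i x"
    and fv: "\<And>i y. i \<in> I \<Longrightarrow> y \<in> branch a b i \<Longrightarrow> f y \<in> {-1<..<1} \<and> v i (f y) = y"
    by (rule UNP_branch_family[OF assms]) (rule that)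
  interpret branch_family D I v dv "\<lambda>i. b i - a i" B M "1 / check_lambda f I a b"
    by (rule fam)
  obtain K where K: "K \<in> kappa D" "\<forall>i\<in>I. \<forall>j k. \<forall>y. k = 0 \<or> real j / real k > p \<longrightarrow>
    ((\<lambda>t. dv i (cos (2 * t)) * cheb k (v i (cos (2 * t))) * cos (2 * real j * t)) has_integral y)
      {pi / 4..pi / 4 + 2 * pi} \<longrightarrow> \<bar>y\<bar> \<le> (b i - a i) * K \<bar>real j - p * real k\<bar>"
    using branch_integral_decay[OF p p0] by (elim bexE)
  \<comment> \<open>One weight for two estimates: B * len dominates the integrand pointwise, while
    len itself multiplies K in the bound on the integral.\<close>
  define B' where "B' = max 1 B"
  \<comment> \<open>2 / pi bounds the prefactor in \<open>Lmat\<close>, and 2 bounds the total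
    length of the branches.\<close>
  define c where "c = 2 / pi * (2 * B')"
  have c: "c > 0" by (simp add: c_def B'_def less_max_iff_disj)
  have bound: "\<bar>Lmat f (\<Union>i\<in>I. branch a b i) j k\<bar> \<le> c * K \<bar>real j - p * real k\<bar>"
    if jk: "k = 0 \<or> real j / real k > p" for j k
  proof -
    define h where "h = (\<lambda>i x. \<bar>dv i x\<bar> * cheb k (v i x) * cheb j x)"
    define G where "G = (\<lambda>i x. h i x / sqrt (1 - x\<^sup>2))"
    define Kv where "Kv = K \<bar>real j - p * real k\<bar>"
    have Kv: "Kv \<ge> 0" unfolding Kv_def by (rule kappa_nonneg[OF K(1)]) simp
    have vc: "continuous_on {-1..1} (\<lambda>x. cheb k (v i x))" if i: "i \<in> I" for i
      by (rule continuous_on_compose2[OF continuous_on_cheb continuous_v[OF i]])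
         (use v_range[OF i] in \<open>auto simp: abs_le_iff\<close>)
    have hc: "continuous_on {-1..1} (h i)" if i: "i \<in> I" for i
      unfolding h_def by (intro continuous_intros dvc[OF i] vc[OF i] continuous_on_cheb)
    have GK: "\<bar>LBINT x:{-1<..<1}. G i x\<bar> \<le> B' * (b i - a i) * Kv" if i: "i \<in> I" for i
    proof -
      define P where "P = (\<lambda>t. dv i (cos (2 * t)) * cheb k (v i (cos (2 * t))) * cos (2 * real j * t))"
      obtain s where s: "s \<in> {-1, 1}" "\<And>x. x \<in> {-1..1} \<Longrightarrow> s * dv i x > 0" using sign[OF i] by blast
      have Pc: "continuous_on UNIV P"
        unfolding P_def
        by (intro continuous_intros continuous_on_compose2[OF dvc[OF i]] continuous_on_compose2[OF vc[OF i]]) auto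
      have Pper: "P (t + pi) = P t" for t
      proof -
        have "cos (2 * (t + pi)) = cos (2 * t)" by (simp add: distrib_left)
        moreover have "cos (2 * real j * (t + pi)) = cos (2 * real j * t)"
        proof -
          have "2 * real j * (t + pi) = 2 * real j * t + 2 * of_int (int j) * pi" by (simp add: algebra_simps)
          then show ?thesis by (simp only: cos_add cos_int_2pin sin_int_2pin) simp
        qed
        ultimately show ?thesis by (simp only: P_def)
      qed
      have Pev: "P (- t) = P t" for t by (simp add: P_def)
      have "(P has_integral (4 * integral {0..pi / 2} P)) {pi / 4..pi / 4 + 2 * pi}"
        using integrable_integral[OF integrable_continuous_real[OF continuous_on_subset[OF Pc subset_UNIV]]]
        unfolding integral_quarter_period[OF Pc Pper Pev, symmetric] .
      then have y: "\<bar>4 * integral {0..pi / 2} P\<bar> \<le> (b i - a i) * Kv"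
        unfolding Kv_def P_def by (rule K(2)[rule_format, OF i jk])
      have "(LBINT x:{-1<..<1}. G i x) = integral {0..pi / 2} (\<lambda>t. 2 * h i (cos (2 * t)))"
        unfolding G_def by (rule chebyshev_weight_integral(2)[OF hc[OF i]])
      \<comment> \<open>\<open>dv i\<close> has constant sign s, so its modulus is s *
        \<open>dv i\<close>, and the integrand becomes a multiple of P without an absolute
        value.\<close>
      also have "\<dots> = integral {0..pi / 2} (\<lambda>t. 2 * s * P t)"
      proof (rule integral_cong)
        fix t assume t: "t \<in> {0..pi / 2}"
        have "\<bar>dv i (cos (2 * t))\<bar> = s * dv i (cos (2 * t))"
          using s(1) s(2)[of "cos (2 * t)"] by auto
        then show "2 * h i (cos (2 * t)) = 2 * s * P t"
          unfolding h_def P_def cheb_cos_double[OF t] by simp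
      qed
      also have "\<dots> = 2 * s * integral {0..pi / 2} P" by simp
      finally have "\<bar>LBINT x:{-1<..<1}. G i x\<bar> = 2 * \<bar>integral {0..pi / 2} P\<bar>"
        using s(1) by (auto simp: abs_mult)
      also have "\<dots> \<le> 1 * ((b i - a i) * Kv)" using y by (simp add: abs_mult)
      also have "\<dots> \<le> B' * ((b i - a i) * Kv)"
        using ab[OF i] Kv by (intro mult_right_mono) (auto simp: B'_def)
      finally show ?thesis by (simp add: mult.assoc)
    qed
    have Gb: "\<bar>G i x\<bar> \<le> B' * (b i - a i) * (1 / sqrt (1 - x\<^sup>2))" if i: "i \<in> I" and x: "x \<in> {-1<..<1}" for i x
    proof -
      have "\<bar>h i x\<bar> \<le> (B * (b i - a i)) * 1 * 1"
        unfolding h_def abs_mult abs_abs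
        using upper[OF i, of x] x cheb_le_1 by (intro mult_mono) (auto intro: order_trans[OF abs_ge_zero])
      also have "\<dots> \<le> B' * (b i - a i)"
        using ab[OF i] by (simp add: B'_def mult_right_mono)
      finally have "\<bar>h i x\<bar> \<le> B' * (b i - a i)" .
      moreover have "x\<^sup>2 < 1" using x by (simp add: abs_square_less_1 abs_less_iff)
      ultimately show ?thesis
        unfolding G_def by (simp add: abs_divide divide_right_mono)
    qed
    have tr: "transfer f (\<Union>i\<in>I. branch a b i) (cheb k) x * cheb j x / sqrt (1 - x\<^sup>2) = (\<Sum>\<^sub>\<infinity>i\<in>I. G i x)"
      if x: "x \<in> {-1<..<1}" for x
    proof -
      \<comment> \<open>Every branch contains exactly one preimage of x, and disjoint branches give
        different ones; the sum over preimages becomes a sum over branches.\<close>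
      have bij: "bij_betw (\<lambda>i. v i x) I {y \<in> (\<Union>i\<in>I. branch a b i). f y = x}"
      proof (rule bij_betwI')
        show "(v i x = v j x) = (i = j)" if "i \<in> I" "j \<in> I" for i j
          using vf[OF that(1) x] vf[OF that(2) x] disj[OF that] by (cases "i = j") auto
        show "v i x \<in> {y \<in> (\<Union>i\<in>I. branch a b i). f y = x}" if "i \<in> I" for i
          using vf[OF that x] that by auto
        show "\<exists>i\<in>I. y = v i x" if y: "y \<in> {y \<in> (\<Union>i\<in>I. branch a b i). f y = x}" for y
        proof -
          obtain i where i: "i \<in> I" "y \<in> branch a b i" "f y = x" using y by blast
          then show ?thesis using fv[OF i(1,2)] by (intro bexI[of _ i]) auto
        qed
      qed
      have "transfer f (\<Union>i\<in>I. branch a b i) (cheb k) x = (\<Sum>\<^sub>\<infinity>i\<in>I. cheb k (v i x) / \<bar>deriv f (v i x)\<bar>)"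
        unfolding transfer_def by (rule infsum_reindex_bij_betw[OF bij, symmetric])
      also have "\<dots> = (\<Sum>\<^sub>\<infinity>i\<in>I. \<bar>dv i x\<bar> * cheb k (v i x))"
        by (rule infsum_cong) (use vf[OF _ x] in \<open>auto simp: abs_divide\<close>)
      finally have "transfer f (\<Union>i\<in>I. branch a b i) (cheb k) x * cheb j x / sqrt (1 - x\<^sup>2) =
          (\<Sum>\<^sub>\<infinity>i\<in>I. \<bar>dv i x\<bar> * cheb k (v i x)) * (cheb j x / sqrt (1 - x\<^sup>2))" by simp
      also have "\<dots> = (\<Sum>\<^sub>\<infinity>i\<in>I. \<bar>dv i x\<bar> * cheb k (v i x) * (cheb j x / sqrt (1 - x\<^sup>2)))"
        by (rule infsum_cmult_left'[symmetric])
      finally show ?thesis by (simp add: G_def h_def)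
    qed
    have "\<bar>LBINT x:{-1<..<1}. (\<Sum>\<^sub>\<infinity>i\<in>I. G i x)\<bar> \<le> (2 * B') * Kv"
    proof (rule set_integral_infsum_bound[OF cI])
      show "set_integrable lborel {-1<..<1} (G i)" if "i \<in> I" for i
        using chebyshev_weight_integral(1)[OF hc[OF that]] by (simp add: G_def)
      show "set_integrable lborel {-1<..<1} (\<lambda>x. 1 / sqrt (1 - x\<^sup>2))"
        by (rule chebyshev_weight_integral(1)) auto
      show "0 \<le> B' * (b i - a i)" if "i \<in> I" for i using ab[OF that] by (simp add: B'_def)
      show "(\<Sum>i\<in>F. B' * (b i - a i)) \<le> 2 * B'" if "finite F" "F \<subseteq> I" for F
      proof -
        have "(\<Sum>i\<in>F. b i - a i) \<le> 2"
          by (rule sum_branch_lengths[OF that(1)]) (use subsetD[OF that(2)] ab disj in auto)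
        then have "B' * (\<Sum>i\<in>F. b i - a i) \<le> B' * 2"
          by (rule mult_left_mono) (simp add: B'_def)
        then show ?thesis
          unfolding sum_distrib_left[symmetric] by (simp only: mult.commute)
      qed
    qed (use GK Gb Kv in auto)
    also have "(LBINT x:{-1<..<1}. (\<Sum>\<^sub>\<infinity>i\<in>I. G i x)) =
        (LBINT x:{-1<..<1}. transfer f (\<Union>i\<in>I. branch a b i) (cheb k) x * cheb j x / sqrt (1 - x\<^sup>2))"
      by (rule set_lebesgue_integral_cong) (auto simp: tr[simplified])
    finally have int: "\<bar>LBINT x:{-1<..<1}. transfer f (\<Union>i\<in>I. branch a b i) (cheb k) x * cheb j x / sqrt (1 - x\<^sup>2)\<bar> \<le> 2 * B' * Kv" .
    have "\<bar>Lmat f (\<Union>i\<in>I. branch a b i) j k\<bar> \<le> 2 / pi * (2 * B' * Kv)"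
      unfolding Lmat_def abs_mult using int by (intro mult_mono) (auto intro!: divide_right_mono)
    then show ?thesis by (simp add: c_def Kv_def mult.assoc)
  qed
  show "\<exists>K\<in>kappa D. \<forall>j k :: nat. (k = 0 \<or> real j / real k > p) \<longrightarrow>
      \<bar>Lmat f (\<Union>i\<in>I. branch a b i) j k\<bar> \<le> K \<bar>real j - p * real k\<bar>"
    by (rule bexI[OF _ kappa_scale[OF K(1) c]]) (use bound in blast)
qed

end
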